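(* Consider a nearest-neighbor, uniformly elliptic random walk in an i.i.d. random environment on $\mathbb{Z}^d$, $d\ge1$. If Sznitman's condition (T) holds relative to some unit vector $\hat u\in\mathcal{S}^{d-1}$, then the averaged logarithmic moment generating function $\Lambda_a$ is analytic on $\mathcal{C}$. Moreover, the Hessian $\mathcal{H}_a$ of $\Lambda_a$ is positive definite on $\mathcal{C}$.
   Context: **Model.** Let $U:=\{z\in\mathbb{Z}^d:|z_1|+\cdots+|z_d|=1\}$. An environment is $\omega=(\omega_x)_{x\in\mathbb{Z}^d}$, where $\omega_x=(\pi(x,x+z))_{z\in\mathbb{Z}^d}$ is a probability vector of transition probabilities; $\omega$ is sampled from a probability measure $\mathbb{P}$ on the product space $\Omega$. Assumptions: nearest-neighbor: $\mathbb{P}\{\pi(0,z)=0\}=1$ unless $z\in U$; uniformly elliptic: there is $\kappa>0$ with $\mathbb{P}\{\pi(0,z)\ge\kappa\}=1$ for every $z\in U$; i.i.d.: $(\omega_x)_{x\in\mathbb{Z}^d}$ is an i.i.d. collection under $\mathbb{P}$. Given $\omega$, $P_x^\omega$ is the law of the Markov chain $(X_n)_{n\ge0}$ started at $x$ with transition probabilities $\pi$; $P_x:=\mathbb{P}\times P_x^\omega$ (semi-direct product) is the averaged law, with expectation $E_x$. The subscript $o$ means that the starting point is the origin. $|\cdot|$ is the Euclidean norm. **Nestling.** The walk is non-nestling relative to a unit vector $\hat u$ if $\mathrm{ess\,inf}_{\mathbb{P}}\sum_{z\in U}\pi(0,z)\langle z,\hat u\rangle>0$. It is non-nestling if this holds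 for some unit vector, and nestling otherwise. **Regeneration time and condition (T).** For a unit vector $\hat u$ let $\tau_1:=\inf\{j>0:\langle X_i,\hat u\rangle<\langle X_j,\hat u\rangle\le\langle X_k,\hat u\rangle\text{ for all }i,k\text{ with }i<j<k\}$. Condition (T) relative to $\hat u$ means: $P_o(\lim_n\langle X_n,\hat u\rangle=\infty)=1$ and $E_o[\sup_{1\le i\le\tau_1}\exp\{c_1|X_i|\}]<\infty$ for some $c_1>0$. If the walk is non-nestling relative to $\hat u$, then it is known that $E_o[\exp\{c_2\tau_1\}]<\infty$ for some $c_2>0$, and in particular (T) holds relative to $\hat u$. Convention: if the walk is non-nestling, $\hat u$ is fixed to be a direction relative to which it is non-nestling, and $c_2>0$ is a fixed constant with $E_o[\exp\{c_2\tau_1\}]<\infty$; if the walk is nestling, $\hat u$ is a fixed direction relative to which (T) holds, and $c_1>0$ is a fixed constant with $E_o[\sup_{1\le i\le\tau_1}\exp\{c_1|X_i|\}]<\infty$. **$\Lambda_a$ and $\mathcal{C}$.** It is known (Varadhan) that the laws of $X_n/n$ under $P_o$ satisfy a large deviation principle (speed $n$) with a convex rate function $I_a$, and that for $\theta\in\mathbb{R}^d$ the limit $\Lambda_a(\theta):=\lim_{n\to\infty}\frac1n\log E_o[\exp\{\langle\theta,X_n\rangle\}]=\sup_{\xi\in\mathbb{R}^d}\{\langle\theta,\xi\rangle-I_a(\xi)\}$ exists. $\mathcal{C}:=\{\theta\in\mathbb{R}^d:|\theta|<c_2/2\}$ if the walk is non-nestling, and $\mathcal{C}:=\{\theta\in\mathbb{R}^d:|\theta|<c_1,\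 \Lambda_a(\theta)>0\}$ if the walk is nestling (and (T) holds). *)

theory Defs
  imports "HOL-Probability.Probability"
begin

section \<open>Environments\<close>

text \<open>The lattice of dimension \<open>d = CARD('d) \<ge> 1\<close> is the type \<open>int ^ 'd\<close>. In an environment
  \<open>\<omega>\<close>, the probability vector at \<open>x\<close> is the law \<open>\<omega> x\<close> of the increment of a
  step from \<open>x\<close>: the transition probability from \<open>x\<close> to \<open>x + z\<close> is \<open>pmf (\<omega> x) z\<close>.\<close>

type_synonym 'd environment = "int ^ 'd \<Rightarrow> (int ^ 'd) pmf"

type_synonym 'd path = "nat \<Rightarrow> int ^ 'd"

definition embed :: "int ^ 'd \<Rightarrow> real ^ 'd" where
  "embed z = (\<chi> i. real_of_int (z $ i))"

definition unit_steps :: "(int ^ 'd) set" where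
  "unit_steps = {z. (\<Sum>i\<in>UNIV. \<bar>z $ i\<bar>) = 1}"

lemma finite_unit_steps: "finite (unit_steps :: (int ^ 'd) set)"
proof (rule finite_subset)
  have *: "\<bar>z $ i\<bar> \<le> (\<Sum>i\<in>UNIV. \<bar>z $ i\<bar>)" for z :: "int ^ 'd" and i
    by (rule member_le_sum) auto
  show "unit_steps \<subseteq> vec_lambda ` (PiE UNIV (\<lambda>_ :: 'd. {-1 .. 1 :: int}))"
  proof
    fix z :: "int ^ 'd" assume "z \<in> unit_steps"
    then have "\<bar>z $ i\<bar> \<le> 1" for i
      using *[of z i] by (simp add: unit_steps_def)
    then have "-1 \<le> z $ i \<and> z $ i \<le> 1" for i
      by (metis abs_le_D1 abs_le_D2 minus_le_iff)
    then have "vec_nth z \<in> PiE UNIV (\<lambda>_. {-1 .. 1})"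
      by (auto simp: PiE_def)
    moreover have "z = vec_lambda (vec_nth z)"
      by simp
    ultimately show "z \<in> vec_lambda ` (PiE UNIV (\<lambda>_ :: 'd. {-1 .. 1 :: int}))"
      by blast
  qed
  show "finite (vec_lambda ` (PiE UNIV (\<lambda>_ :: 'd. {-1 .. 1 :: int})) :: (int ^ 'd) set)"
    by (intro finite_imageI finite_PiE) auto
qed

text \<open>Probability vectors carry the \<open>\<sigma>\<close>-algebra generated by their coordinates.\<close>

definition site_space :: "(int ^ 'd) pmf measure" where
  "site_space = vimage_algebra UNIV pmf (PiM UNIV (\<lambda>_. borel))"

definition env_space :: "'d::finite environment measure" where
  "env_space = PiM UNIV (\<lambda>_. site_space)"

definition path_space :: "'d::finite path measure" where
  "path_space = PiM UNIV (\<lambda>_. count_space UNIV)"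

definition nearest_neighbor :: "'d::finite environment measure \<Rightarrow> bool" where
  "nearest_neighbor P \<longleftrightarrow> (\<forall>z. z \<notin> unit_steps \<longrightarrow> (AE \<omega> in P. pmf (\<omega> 0) z = 0))"

definition uniformly_elliptic :: "'d::finite environment measure \<Rightarrow> bool" where
  "uniformly_elliptic P \<longleftrightarrow> (\<exists>\<kappa>>0. \<forall>z\<in>unit_steps. AE \<omega> in P. \<kappa> \<le> pmf (\<omega> 0) z)"

definition iid_environment :: "'d::finite environment measure \<Rightarrow> bool" where
  "iid_environment P \<longleftrightarrow>
     prob_space.indep_vars P (\<lambda>_. site_space) (\<lambda>x \<omega>. \<omega> x) UNIV \<and>
     (\<forall>x. distr P site_space (\<lambda>\<omega>. \<omega> x) = distr P site_space (\<lambda>\<omega>. \<omega> 0))"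

definition random_environment :: "'d::finite environment measure \<Rightarrow> bool" where
  "random_environment P \<longleftrightarrow> prob_space P \<and> sets P = sets env_space"


section \<open>Quenched and averaged laws\<close>

definition walk_kernel ::
    "'d::finite environment \<Rightarrow> int ^ 'd \<Rightarrow> nat \<Rightarrow> 'd path \<Rightarrow> (int ^ 'd) measure" where
  "walk_kernel \<omega> x n X =
     (case n of 0 \<Rightarrow> measure_pmf (return_pmf x)
      | Suc m \<Rightarrow> measure_pmf (map_pmf (\<lambda>z. X m + z) (\<omega> (X m))))"

text \<open>The law of the Markov chain is given by the Ionescu-Tulcea theorem.\<close>

definition quenched :: "'d::finite environment \<Rightarrow> int ^ 'd \<Rightarrow> 'd path measure" where
  "quenched \<omega> x =
     projective_family.lim UNIV (Ionescu_Tulcea.CI (walk_kernel \<omega> x) (\<lambda>_. count_space UNIV))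
       (\<lambda>_. count_space UNIV)"

lemma Ionescu_Tulcea_walk_kernel:
  fixes \<omega> :: "'d::finite environment"
  shows "Ionescu_Tulcea (walk_kernel \<omega> x) (\<lambda>_. count_space UNIV)"
proof (rule Ionescu_Tulcea.intro)
  fix n :: nat and X :: "'d path"
  show "prob_space (walk_kernel \<omega> x n X)"
    by (cases n) (simp_all add: walk_kernel_def measure_pmf.prob_space_axioms)
next
  fix n
  note [measurable] = measurable_measure_pmf
  show "walk_kernel \<omega> x n \<in> measurable (PiM {0..<n} (\<lambda>_. count_space UNIV)) (subprob_algebra (count_space UNIV))"
  proof (cases n)
    case 0 then show ?thesis
      by (simp add: walk_kernel_def[abs_def] measure_subprob)
  next
    case (Suc m)
    have "(\<lambda>X. X m) \<in> measurable (PiM {0..<n} (\<lambda>_. count_space UNIV)) (count_space UNIV :: (int^'d) measure)"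
      using Suc by (intro measurable_component_singleton) auto
    then have "(\<lambda>X. (\<lambda>y. measure_pmf (map_pmf (\<lambda>z. y + z) (\<omega> y))) (X m)) \<in> measurable (PiM {0..<n} (\<lambda>_. count_space UNIV)) (subprob_algebra (count_space UNIV))"
      by (rule measurable_compose) (rule measurable_measure_pmf)
    then show ?thesis unfolding Suc walk_kernel_def by simp
  qed
qed

definition cylinder :: "(int^'d) list \<Rightarrow> 'd::finite path set" where
  "cylinder xs = {X. \<forall>i<length xs. X i = xs ! i}"

lemma Int_stable_cylinder: "Int_stable (insert {} (range cylinder))"
proof -
  have *: "cylinder xs \<inter> cylinder ys \<in> insert {} (range cylinder)" if "length xs \<le> length ys" for xs ys :: "(int^'d) list"
  proof (cases "cylinder xs \<inter> cylinder ys = {}")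
    case False
    then obtain X where "\<And>i. i < length xs \<Longrightarrow> X i = xs ! i" "\<And>i. i < length ys \<Longrightarrow> X i = ys ! i"
      by (auto simp: cylinder_def)
    then have "\<And>i. i < length xs \<Longrightarrow> xs ! i = ys ! i" using that by (metis order.strict_trans2)
    then have "cylinder xs \<inter> cylinder ys = cylinder ys" using that by (auto simp: cylinder_def)
    then show ?thesis by blast
  qed simp
  have "cylinder xs \<inter> cylinder ys \<in> insert {} (range cylinder)" for xs ys :: "(int^'d) list"
    using *[of xs ys] *[of ys xs] by (metis Int_commute linorder_le_cases)
  then show ?thesis unfolding Int_stable_def by auto
qed

lemma cylinder_sets: "cylinder xs \<in> sets path_space"
proof -
  have "cylinder xs = {X\<in>space path_space. \<forall>i<length xs. X i = xs ! i}"
    by (simp add: cylinder_def path_space_def space_PiM)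
  also have "\<dots> \<in> sets path_space" unfolding path_space_def by measurable
  finally show ?thesis .
qed

lemma sets_path_space:
  "sets (path_space :: 'd::finite path measure) = sigma_sets UNIV (insert {} (range cylinder))"
proof (rule antisym)
  interpret S: sigma_algebra UNIV "sigma_sets UNIV (insert {} (range cylinder)) :: 'd path set set"
    by (rule sigma_algebra_sigma_sets) auto
  show "sets path_space \<subseteq> sigma_sets UNIV (insert {} (range cylinder) :: 'd path set set)"
  proof -
    have "sigma_sets UNIV {{X \<in> UNIV \<rightarrow>\<^sub>E UNIV. X i \<in> A} |i A. i \<in> UNIV \<and> A \<in> sets (count_space UNIV)}
       \<subseteq> sigma_sets UNIV (insert {} (range cylinder) :: 'd path set set)"
    proof (rule S.sigma_sets_subset, safe)
      fix i :: nat and A :: "(int^'d) set"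
      have "{X. X i \<in> A} = (\<Union>xs\<in>{xs. length xs = Suc i \<and> xs ! i \<in> A}. cylinder xs)"
      proof safe
        fix X :: "'d path" assume "X i \<in> A"
        then show "X \<in> (\<Union>xs\<in>{xs. length xs = Suc i \<and> xs ! i \<in> A}. cylinder xs)"
          by (intro UN_I[of "map X [0..<Suc i]"]) (auto simp: cylinder_def simp del: upt_Suc)
      qed (auto simp: cylinder_def)
      also have "\<dots> \<in> sigma_sets UNIV (insert {} (range cylinder))"
        by (rule S.countable_UN'') (auto)
      finally show "{X \<in> UNIV \<rightarrow>\<^sub>E UNIV. X i \<in> A} \<in> sigma_sets UNIV (insert {} (range cylinder))"
        by simp
    qed
    then show ?thesis
      unfolding path_space_def sets_PiM_single by simp
  qed
  show "sigma_sets UNIV (insert {} (range cylinder)) \<subseteq> sets (path_space :: 'd path measure)"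
  proof -
    have "space (path_space :: 'd path measure) = UNIV"
      by (simp add: path_space_def space_PiM)
    moreover have "insert {} (range cylinder) \<subseteq> sets (path_space :: 'd path measure)"
      by (auto simp: cylinder_sets)
    ultimately show ?thesis
      using sets.sigma_sets_subset[of "insert {} (range cylinder)" "path_space :: 'd path measure"] by simp
  qed
qed

lemma measurable_pmf_site: "(\<lambda>p. pmf p z) \<in> borel_measurable site_space"
proof -
  have "pmf \<in> measurable site_space (PiM UNIV (\<lambda>_. borel))"
    unfolding site_space_def by (rule measurable_vimage_algebra1) (simp add: space_PiM)
  then show ?thesis
    by (rule measurable_compose) (rule measurable_component_singleton, simp)
qed

lemma measurable_pmf_env: "(\<lambda>\<omega>. pmf (\<omega> y) z) \<in> borel_measurable env_space"
  unfolding env_space_def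
  by (rule measurable_compose[OF _ measurable_pmf_site]) (rule measurable_component_singleton, simp)

lemma quenched_cylinder:
  fixes \<omega> :: "'d::finite environment"
  shows "emeasure (quenched \<omega> x) {X. \<forall>i\<le>n. X i = a i} =
     indicator {x} (a 0) * (\<Prod>i<n. ennreal (pmf (\<omega> (a i)) (a (Suc i) - a i)))"
proof -
  let ?M = "\<lambda>_::nat. count_space UNIV :: (int^'d) measure"
  interpret Ionescu_Tulcea "walk_kernel \<omega> x" ?M
    by (rule Ionescu_Tulcea_walk_kernel)
  let ?s = "\<lambda>n. {restrict a {0..<n}}"
  have sets_s[measurable]: "?s n \<in> sets (PiM {0..<n} ?M)" for n
  proof -
    have "?s n = PiE {0..<n} (\<lambda>i. {a i})" by (intro set_eqI iffI; simp add: PiE_iff extensional_def fun_eq_iff; metis)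
    also have "\<dots> \<in> sets (PiM {0..<n} ?M)" by (rule sets_PiM_I_finite) auto
    finally show ?thesis .
  qed
  have step: "emeasure (C 0 (Suc n) (\<lambda>_. undefined)) (?s (Suc n)) =
     emeasure (walk_kernel \<omega> x n a) {a n} * emeasure (C 0 n (\<lambda>_. undefined)) (?s n)" for n
  proof -
    have u: "(\<lambda>_. undefined) \<in> space (PiM {0..<0} ?M)" by (simp add: space_PiM)
    have eq: "emeasure (eP n f) (?s (Suc n)) = emeasure (walk_kernel \<omega> x n a) {a n} * indicator (?s n) f"
      if f: "f \<in> space (PiM {0..<n} ?M)" for f
    proof -
      have "emeasure (eP n f) (?s (Suc n)) = emeasure (walk_kernel \<omega> x n f) ((\<lambda>y. f(n:=y)) -` ?s (Suc n) \<inter> UNIV)"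
        using emeasure_eP[OF f sets_s] by simp
      also have "(\<lambda>y. f(n:=y)) -` ?s (Suc n) \<inter> UNIV = (if f = restrict a {0..<n} then {a n} else {})"
      proof -
        have "f(n := y) = restrict a {0..<Suc n} \<longleftrightarrow> f = restrict a {0..<n} \<and> y = a n" for y
          using f by (auto simp: fun_eq_iff space_PiM PiE_iff extensional_def restrict_def less_Suc_eq)
        then show ?thesis by auto
      qed
      also have "emeasure (walk_kernel \<omega> x n f) \<dots> = emeasure (walk_kernel \<omega> x n a) {a n} * indicator (?s n) f"
        by (auto simp: walk_kernel_def split: nat.split)
      finally show ?thesis .
    qed
    have "emeasure (C 0 (Suc n) (\<lambda>_. undefined)) (?s (Suc n)) =
      (\<integral>\<^sup>+f. emeasure (eP n f) (?s (Suc n)) \<partial>C 0 n (\<lambda>_. undefined))"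
      using space_C[OF u, of n] measurable_eP[of n] sets_C[OF u, of n]
      by (simp add: emeasure_bind[OF _ _ sets_s] prob_space_C[OF u, THEN prob_space.not_empty] cong: measurable_cong_sets)
    also have "\<dots> = (\<integral>\<^sup>+f. emeasure (walk_kernel \<omega> x n a) {a n} * indicator (?s n) f \<partial>C 0 n (\<lambda>_. undefined))"
      using space_C[OF u, of n] by (intro nn_integral_cong eq) simp
    also have "\<dots> = emeasure (walk_kernel \<omega> x n a) {a n} * emeasure (C 0 n (\<lambda>_. undefined)) (?s n)"
      using sets_C[OF u, of n] sets_s[of n] by (intro nn_integral_cmult_indicator) simp
    finally show ?thesis .
  qed
  have C: "emeasure (C 0 (Suc n) (\<lambda>_. undefined)) (?s (Suc n)) =
     indicator {x} (a 0) * (\<Prod>i<n. ennreal (pmf (\<omega> (a i)) (a (Suc i) - a i)))" for n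
  proof (induction n)
    case 0
    have "emeasure (C 0 0 (\<lambda>_. undefined)) (?s 0) = 1"
      using sets_s[of 0] by (simp add: restrict_def)
    then show ?case
      unfolding step by (simp add: walk_kernel_def indicator_def)
  next
    case (Suc n)
    have "emeasure (walk_kernel \<omega> x (Suc n) a) {a (Suc n)} = ennreal (pmf (\<omega> (a n)) (a (Suc n) - a n))"
    proof -
      have "(\<lambda>z. a n + z) -` {a (Suc n)} = {a (Suc n) - a n}"
        by (auto simp: algebra_simps)
      then show ?thesis
        by (simp add: walk_kernel_def emeasure_pmf_single pmf_map measure_pmf_single)
    qed
    then show ?case
      unfolding step[of "Suc n"] Suc.IH by (simp add: mult_ac)
  qed
  have "{X. \<forall>i\<le>n. X i = a i} = prod_emb UNIV ?M {0..<Suc n} (?s (Suc n))"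
  proof -
    have "restrict X {0..<Suc n} = restrict a {0..<Suc n} \<longleftrightarrow> (\<forall>i\<le>n. X i = a i)" for X
    proof
      assume "restrict X {0..<Suc n} = restrict a {0..<Suc n}"
      then have "restrict X {0..<Suc n} i = restrict a {0..<Suc n} i" for i
        by (rule fun_cong)
      then show "\<forall>i\<le>n. X i = a i"
        by (metis atLeastLessThan_iff le0 le_imp_less_Suc restrict_apply')
    qed (intro restrict_ext, auto)
    then show ?thesis
      by (simp add: prod_emb_def space_PiM vimage_def del: atLeastLessThanSuc)
  qed
  then have "emeasure (quenched \<omega> x) {X. \<forall>i\<le>n. X i = a i} = emeasure (CI {0..<Suc n}) (?s (Suc n))"
    unfolding quenched_def using lim[of "{0..<Suc n}" "?s (Suc n)"] sets_s by simp
  also have "\<dots> = emeasure (C 0 (Suc n) (\<lambda>_. undefined)) (?s (Suc n))"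
    using emeasure_CI[of "{0..<Suc n}" "Suc n" "?s (Suc n)"] sets_s[of "Suc n"] sets.sets_into_space[OF sets_s[of "Suc n"]]
    by (simp add: prod_emb_id space_PiM)
  finally show ?thesis unfolding C .
qed

lemma prob_space_quenched:
  fixes \<omega> :: "'d::finite environment"
  shows "prob_space (quenched \<omega> x)"
proof -
  interpret Ionescu_Tulcea "walk_kernel \<omega> x" "\<lambda>_. count_space UNIV"
    by (rule Ionescu_Tulcea_walk_kernel)
  have "prod_emb UNIV (\<lambda>_. count_space UNIV) {} {\<lambda>_. undefined} = (UNIV :: 'd path set)"
    by (auto simp: prod_emb_def space_PiM)
  moreover have "{\<lambda>_. undefined} \<in> sets (PiM {} (\<lambda>_::nat. count_space UNIV :: (int^'d) measure))"
    by (simp add: PiM_empty)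
  ultimately have "emeasure (quenched \<omega> x) UNIV = emeasure (CI {}) {\<lambda>_. undefined}"
    unfolding quenched_def using lim[of "{}" "{\<lambda>_. undefined}"] by simp
  also have "\<dots> = emeasure (CI {}) (space (CI {}))"
    by (simp add: CI_def space_PiM)
  also have "\<dots> = 1"
    by (intro prob_space.emeasure_space_1 PF.prob_space_P) simp_all
  finally show ?thesis
    by (intro prob_spaceI) (simp add: quenched_def PF.space_lim space_PiM)
qed

lemma sets_quenched: "sets (quenched \<omega> x) = sets path_space"
proof -
  interpret Ionescu_Tulcea "walk_kernel \<omega> x" "\<lambda>_. count_space UNIV"
    by (rule Ionescu_Tulcea_walk_kernel)
  show ?thesis
    unfolding quenched_def path_space_def by simp
qed

lemma measurable_quenched:
  "(\<lambda>\<omega>. quenched \<omega> (x :: int ^ 'd::finite)) \<in> measurable env_space (subprob_algebra path_space)"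
proof (rule measurable_subprob_algebra_generated[OF sets_path_space Int_stable_cylinder])
  fix \<omega>
  show "subprob_space (quenched \<omega> x)"
    using prob_space_quenched by (rule prob_space_imp_subprob_space)
  show "sets (quenched \<omega> x) = sets path_space" by (rule sets_quenched)
next
  have space: "space (quenched \<omega> x) = UNIV" for \<omega>
    using sets_eq_imp_space_eq[OF sets_quenched] by (simp add: path_space_def space_PiM)
  then have 1: "emeasure (quenched \<omega> x) UNIV = 1" for \<omega>
    using prob_space.emeasure_space_1[OF prob_space_quenched] by metis
  show "(\<lambda>\<omega>. emeasure (quenched \<omega> x) UNIV) \<in> borel_measurable env_space"
    unfolding 1 by simp
  fix A :: "'d path set" assume "A \<in> insert {} (range cylinder)"
  then consider "A = {}" | xs where "A = cylinder xs" by auto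
  then show "(\<lambda>\<omega>. emeasure (quenched \<omega> x) A) \<in> borel_measurable env_space"
  proof cases
    case 2
    show ?thesis
    proof (cases xs)
      case Nil then show ?thesis using 2 by (simp add: cylinder_def 1)
    next
      case (Cons y ys)
      note measurable_pmf_env[measurable]
      from Cons have "A = {X. \<forall>i\<le>length ys. X i = xs ! i}"
        unfolding 2 cylinder_def by (simp add: less_Suc_eq_le)
      then show ?thesis
        by (simp add: quenched_cylinder) measurable
    qed
  qed simp
qed auto

text \<open>The semidirect product of \<open>P\<close> with the kernel \<open>\<omega> \<mapsto> quenched \<omega> x\<close>.\<close>

definition averaged ::
    "'d::finite environment measure \<Rightarrow> int ^ 'd \<Rightarrow> ('d environment \<times> 'd path) measure" where
  "averaged P x =
     P \<bind> (\<lambda>\<omega>. distr (quenched \<omega> x) (env_space \<Otimes>\<^sub>M path_space) (\<lambda>X. (\<omega>, X)))"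

lemma emeasure_averaged:
  assumes P: "random_environment P" and A[measurable]: "A \<in> sets (env_space \<Otimes>\<^sub>M path_space)"
  shows "emeasure (averaged P x) A = (\<integral>\<^sup>+\<omega>. emeasure (quenched \<omega> x) (Pair \<omega> -` A) \<partial>P)"
proof -
  have [measurable_cong]: "sets P = sets env_space" and "prob_space P"
    using P by (auto simp: random_environment_def)
  note [measurable] = measurable_quenched
  have space: "space (quenched \<omega> x) = UNIV" for \<omega>
    using sets_eq_imp_space_eq[OF sets_quenched] by (simp add: path_space_def space_PiM)
  have K: "(\<lambda>\<omega>. distr (quenched \<omega> x) (env_space \<Otimes>\<^sub>M path_space) (\<lambda>X. (\<omega>, X)))
      \<in> measurable P (subprob_algebra (env_space \<Otimes>\<^sub>M path_space))"
    by (rule measurable_distr2[where M = path_space]) measurable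
  have "emeasure (averaged P x) A =
      (\<integral>\<^sup>+\<omega>. emeasure (distr (quenched \<omega> x) (env_space \<Otimes>\<^sub>M path_space) (\<lambda>X. (\<omega>, X))) A \<partial>P)"
    unfolding averaged_def
    by (rule emeasure_bind[OF prob_space.not_empty[OF \<open>prob_space P\<close>] K A])
  also have "\<dots> = (\<integral>\<^sup>+\<omega>. emeasure (quenched \<omega> x) (Pair \<omega> -` A) \<partial>P)"
  proof (rule nn_integral_cong)
    fix \<omega> assume "\<omega> \<in> space P"
    then have "\<omega> \<in> space env_space"
      using sets_eq_imp_space_eq[OF \<open>sets P = sets env_space\<close>] by simp
    then have "(\<lambda>X. (\<omega>, X)) \<in> measurable (quenched \<omega> x) (env_space \<Otimes>\<^sub>M path_space)"
      by (simp add: measurable_cong_sets[OF sets_quenched refl])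
    then show "emeasure (distr (quenched \<omega> x) (env_space \<Otimes>\<^sub>M path_space) (\<lambda>X. (\<omega>, X))) A =
        emeasure (quenched \<omega> x) (Pair \<omega> -` A)"
      by (simp add: emeasure_distr space)
  qed
  finally show ?thesis .
qed


section \<open>Nestling, regeneration time, and condition (T)\<close>

definition drift :: "'d::finite environment \<Rightarrow> real ^ 'd \<Rightarrow> real" where
  "drift \<omega> u = (\<Sum>z\<in>unit_steps. pmf (\<omega> 0) z * (embed z \<bullet> u))"

definition ess_inf :: "'a measure \<Rightarrow> ('a \<Rightarrow> real) \<Rightarrow> ereal" where
  "ess_inf M f = - esssup M (\<lambda>x. - ereal (f x))"

definition non_nestling_along :: "'d::finite environment measure \<Rightarrow> real ^ 'd \<Rightarrow> bool" where
  "non_nestling_along P u \<longleftrightarrow> 0 < ess_inf P (\<lambda>\<omega>. drift \<omega> u)"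

definition non_nestling :: "'d::finite environment measure \<Rightarrow> bool" where
  "non_nestling P \<longleftrightarrow> (\<exists>u. norm u = 1 \<and> non_nestling_along P u)"

text \<open>The infimum is \<open>\<infinity>\<close> if there is no regeneration level.\<close>

definition regeneration_time :: "real ^ 'd \<Rightarrow> 'd::finite path \<Rightarrow> enat" where
  "regeneration_time u X =
     Inf (enat ` {j. 0 < j \<and> (\<forall>i k. i < j \<and> j < k \<longrightarrow>
       embed (X i) \<bullet> u < embed (X j) \<bullet> u \<and> embed (X j) \<bullet> u \<le> embed (X k) \<bullet> u)})"

definition exp_enat :: "real \<Rightarrow> enat \<Rightarrow> ennreal" where
  "exp_enat c t = (case t of enat n \<Rightarrow> ennreal (exp (c * real n)) | \<infinity> \<Rightarrow> \<infinity>)"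

definition time_exp_moment ::
    "'d::finite environment measure \<Rightarrow> real ^ 'd \<Rightarrow> real \<Rightarrow> ennreal" where
  "time_exp_moment P u c = (\<integral>\<^sup>+(\<omega>, X). exp_enat c (regeneration_time u X) \<partial>averaged P 0)"

definition range_exp_moment ::
    "'d::finite environment measure \<Rightarrow> real ^ 'd \<Rightarrow> real \<Rightarrow> ennreal" where
  "range_exp_moment P u c =
     (\<integral>\<^sup>+(\<omega>, X). (SUP i\<in>{i. 1 \<le> i \<and> enat i \<le> regeneration_time u X}.
        ennreal (exp (c * norm (embed (X i))))) \<partial>averaged P 0)"

definition condition_T :: "'d::finite environment measure \<Rightarrow> real ^ 'd \<Rightarrow> bool" where
  "condition_T P u \<longleftrightarrow>
     (AE (\<omega>, X) in averaged P 0. filterlim (\<lambda>n. embed (X n) \<bullet> u) at_top sequentially) \<and>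
     (\<exists>c>0. range_exp_moment P u c < \<infinity>)"


section \<open>Logarithmic moment generating function\<close>

definition log_mgf :: "'d::finite environment measure \<Rightarrow> real ^ 'd \<Rightarrow> real" where
  "log_mgf P \<theta> =
     lim (\<lambda>n. ln (\<integral>(\<omega>, X). exp (\<theta> \<bullet> embed (X n)) \<partial>averaged P 0) / real n)"

definition regular_region ::
    "'d::finite environment measure \<Rightarrow> real \<Rightarrow> real \<Rightarrow> (real ^ 'd) set" where
  "regular_region P c\<^sub>1 c\<^sub>2 =
     (if non_nestling P then {\<theta>. norm \<theta> < c\<^sub>2 / 2}
      else {\<theta>. norm \<theta> < c\<^sub>1 \<and> log_mgf P \<theta> > 0})"


section \<open>Real analytic functions and Hessians\<close>

text \<open>A local expansion in a power series indexed by multi-indices \<open>'d \<Rightarrow> nat\<close>; \<open>has_sum\<close> is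
  unconditional, hence absolute, convergence.\<close>

definition real_analytic_at :: "(real ^ 'd \<Rightarrow> real) \<Rightarrow> real ^ 'd \<Rightarrow> bool" where
  "real_analytic_at f x \<longleftrightarrow>
     (\<exists>r>0. \<exists>a :: ('d \<Rightarrow> nat) \<Rightarrow> real. \<forall>y\<in>ball x r.
        ((\<lambda>\<alpha>. a \<alpha> * (\<Prod>i\<in>UNIV. (y $ i - x $ i) ^ \<alpha> i)) has_sum f y) UNIV)"

definition real_analytic_on :: "(real ^ 'd \<Rightarrow> real) \<Rightarrow> (real ^ 'd) set \<Rightarrow> bool" where
  "real_analytic_on f S \<longleftrightarrow> (\<forall>x\<in>S. real_analytic_at f x)"

definition partial_deriv :: "'d \<Rightarrow> (real ^ 'd \<Rightarrow> real) \<Rightarrow> real ^ 'd \<Rightarrow> real" where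
  "partial_deriv i f x = deriv (\<lambda>t. f (x + t *\<^sub>R axis i 1)) 0"

definition hessian :: "(real ^ 'd \<Rightarrow> real) \<Rightarrow> real ^ 'd \<Rightarrow> real ^ 'd ^ 'd" where
  "hessian f x = (\<chi> i j. partial_deriv i (partial_deriv j f) x)"

definition positive_definite :: "real ^ 'd ^ 'd \<Rightarrow> bool" where
  "positive_definite A \<longleftrightarrow> transpose A = A \<and> (\<forall>v. v \<noteq> 0 \<longrightarrow> 0 < v \<bullet> (A *v v))"

end

theory Submission
  imports Defs
begin

text \<open>
  Call a path a block if it stays in the half-space above its starting level, ends strictly above
  all earlier levels, and cannot be split into two such paths. Since a walk that has just regenerated
  only sees fresh sites, the averaged weight of a concatenation of blocks is the product of the
  weights, so that the moment generating function is governed by a renewal equation: if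
  \<open>block \<theta> j\<close> is the total weight of the blocks of length \<open>j\<close>, tilted by \<open>exp (\<theta> \<bullet> x)\<close>, then
  \<open>\<Lambda>\<^sub>a \<theta>\<close> is the root \<open>r\<close> of \<open>(\<Sum>j. block \<theta> j * exp (- r * j)) = 1\<close>, provided that the unfinished
  first regeneration block grows more slowly than \<open>exp (r * j)\<close>. The exponential moments give this
  bound on the region of the theorem; in the nestling case \<open>\<Lambda>\<^sub>a \<theta> > 0\<close> forces a positive root, because
  finite traps show that \<open>\<Lambda>\<^sub>a\<close> would otherwise vanish.

  The root is an analytic function of \<open>\<theta>\<close>, since the equation can be solved by a contraction in the
  Banach algebra of absolutely convergent power series. Averaging the equation at \<open>\<theta> + t v\<close> and
  \<open>\<theta> - t v\<close> and using \<open>cosh z \<ge> 1 + z\<^sup>2 / 8\<close> bounds the second symmetric difference of \<open>\<Lambda>\<^sub>a\<close> from below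
  by \<open>(v \<bullet> x - c k)\<^sup>2\<close> for every block of displacement \<open>x\<close> and length \<open>k\<close>, where \<open>c\<close> is the derivative
  of \<open>\<Lambda>\<^sub>a\<close> along \<open>v\<close>; by ellipticity there are enough blocks for this to be positive.
\<close>

section \<open>Absolutely convergent power series in several variables\<close>

text \<open>What decides everything is the gap between the growth rate of the unfinished block and
  the root r: it provides an exponential moment for the block length at the root, and with it
  convergence of the root equation in a whole neighbourhood. In the non-nestling case the unfinished
  part has rate at most \<open>norm \<theta> - c\<^sub>2\<close>, while tilts of at least
  \<open>exp (- norm \<theta> * j)\<close> put the root at or above \<open>- norm \<theta>\<close>;
  the gap is positive as soon as \<open>2 * norm \<theta> < c\<^sub>2\<close>, the origin of the
  radius \<open>c\<^sub>2 / 2\<close>. In the nestling case the displacement moment controls the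
  unfinished part only at rate 0, whence the restriction to positive values of
  \<open>log_mgf\<close>. A further obstacle is that \<open>log_mgf\<close> is a \<open>lim\<close>:
  at every point near \<theta> the limit must be shown to exist. The two-sided renewal estimates do
  this at any solution of the root equation at which the unfinished part is controlled, and identify
  the solution with \<open>log_mgf\<close>. Analyticity is thus proved for the solution and then
  transferred.\<close>

definition vmonom :: "real ^ 'd \<Rightarrow> ('d \<Rightarrow> nat) \<Rightarrow> real" where
  "vmonom y \<alpha> = (\<Prod>i\<in>UNIV. (y $ i) ^ \<alpha> i)"

definition msize :: "('d \<Rightarrow> nat) \<Rightarrow> nat" where
  "msize \<alpha> = (\<Sum>i\<in>UNIV. \<alpha> i)"

definition cube :: "real \<Rightarrow> (real ^ 'd) set" where
  "cube \<rho> = {y. \<forall>i. \<bar>y $ i\<bar> \<le> \<rho>}"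

text \<open>An upper bound for the weighted l1 norm of some coefficient family, with the
  coefficients themselves hidden, so that such bounds combine like norms in a Banach algebra. The
  cube is where this norm dominates every monomial.\<close>

definition series_bound :: "real \<Rightarrow> (real ^ 'd \<Rightarrow> real) \<Rightarrow> real \<Rightarrow> bool" where
  "series_bound \<rho> f B \<longleftrightarrow> (\<exists>a.
     (\<lambda>\<alpha>. \<bar>a \<alpha>\<bar> * \<rho> ^ msize \<alpha>) summable_on UNIV \<and>
     (\<Sum>\<^sub>\<infinity>\<alpha>. \<bar>a \<alpha>\<bar> * \<rho> ^ msize \<alpha>) \<le> B \<and>
     (\<forall>y\<in>cube \<rho>. ((\<lambda>\<alpha>. a \<alpha> * vmonom y \<alpha>) has_sum f y) UNIV))"

lemma vmonom_add: "vmonom y (\<lambda>i. \<alpha> i + \<beta> i) = vmonom y \<alpha> * vmonom y \<beta>"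
  by (simp add: vmonom_def power_add prod.distrib)

lemma msize_add: "msize (\<lambda>i. \<alpha> i + \<beta> i) = msize \<alpha> + msize \<beta>"
  by (simp add: msize_def sum.distrib)

lemma vmonom_zero [simp]: "vmonom y (\<lambda>_. 0) = 1"
  by (simp add: vmonom_def)

lemma msize_zero [simp]: "msize (\<lambda>_. 0) = 0"
  by (simp add: msize_def)

lemma vmonom_unit:
  fixes y :: "real ^ 'd::finite"
  shows "vmonom y (\<lambda>i. if i = j then 1 else 0) = y $ j"
proof -
  have "vmonom y (\<lambda>i. if i = j then 1 else 0) = (\<Prod>i\<in>UNIV. if i = j then y $ i else 1)"
    unfolding vmonom_def by (intro prod.cong) auto
  then show ?thesis by simp
qed

lemma msize_unit [simp]: "msize (\<lambda>i :: 'd::finite. if i = j then 1 else 0) = 1"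
  by (simp add: msize_def)

lemma abs_vmonom_le:
  fixes y :: "real ^ 'd::finite"
  assumes "y \<in> cube \<rho>"
  shows "\<bar>vmonom y \<alpha>\<bar> \<le> \<rho> ^ msize \<alpha>"
proof -
  have "\<bar>vmonom y \<alpha>\<bar> = (\<Prod>i\<in>UNIV. \<bar>y $ i\<bar> ^ \<alpha> i)"
    by (simp add: vmonom_def abs_prod power_abs)
  also have "\<dots> \<le> (\<Prod>i\<in>UNIV. \<rho> ^ \<alpha> i)"
    using assms by (intro prod_mono) (auto simp: cube_def intro: power_mono)
  finally show ?thesis by (simp add: msize_def power_sum)
qed

lemma has_sum_fibres:
  fixes h :: "'i \<Rightarrow> real"
  assumes "(h has_sum S) A" "\<And>b. (h has_sum g b) (A \<inter> l -` {b})"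
  shows "(g has_sum S) UNIV"
proof (rule has_sum_SigmaD)
  have "bij_betw (\<lambda>i. (l i, i)) A (Sigma UNIV (\<lambda>b. A \<inter> l -` {b}))"
    by (rule bij_betwI[of _ _ _ snd]) auto
  from has_sum_reindex_bij_betw[OF this, of "\<lambda>(b, i). h i" S]
  show "((\<lambda>(b, i). h i) has_sum S) (Sigma UNIV (\<lambda>b. A \<inter> l -` {b}))"
    using assms(1) by simp
  show "\<And>x. x \<in> UNIV \<Longrightarrow> ((\<lambda>y. case (x, y) of (b, i) \<Rightarrow> h i) has_sum g x) (A \<inter> l -` {x})"
    using assms(2) by simp
qed

text \<open>Collecting the terms that carry the same multi-index \<open>l i\<close> can only
  decrease the norm, by the triangle inequality on each fibre. Products, infinite sums and the
  elementary series all come from this by a suitable choice of index set.\<close>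

lemma series_boundI_indexed:
  fixes c :: "'i \<Rightarrow> real" and l :: "'i \<Rightarrow> 'd::finite \<Rightarrow> nat"
  assumes \<rho>: "0 < \<rho>"
    and S: "((\<lambda>i. \<bar>c i\<bar> * \<rho> ^ msize (l i)) has_sum S) A" and "S \<le> B"
    and f: "\<And>y. y \<in> cube \<rho> \<Longrightarrow> ((\<lambda>i. c i * vmonom y (l i)) has_sum f y) A"
  shows "series_bound \<rho> f B"
proof -
  let ?F = "\<lambda>\<alpha>. A \<inter> l -` {\<alpha>}"
  let ?n = "\<lambda>i. \<bar>c i\<bar> * \<rho> ^ msize (l i)"
  define a where "a \<alpha> = infsum c (?F \<alpha>)" for \<alpha>
  have n_summable: "?n summable_on ?F \<alpha>" for \<alpha>
    using S by (intro summable_on_subset_banach[where B = "?F \<alpha>" and A = A]) (auto simp: summable_on_def)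
  have abs_c: "(\<lambda>i. \<bar>c i\<bar>) summable_on ?F \<alpha>" for \<alpha>
  proof -
    \<comment> \<open>On the fibre of \<alpha> the weight is a nonzero constant and can be divided
      out.\<close>
    have "(\<lambda>i. ?n i * (1 / \<rho> ^ msize \<alpha>)) summable_on ?F \<alpha>"
      using n_summable by (rule summable_on_cmult_left)
    then show ?thesis
      by (rule summable_on_cong[THEN iffD1, rotated]) (use \<rho> in auto)
  qed
  then have "c summable_on ?F \<alpha>" for \<alpha>
    using abs_summable_summable[of c] by simp
  then have a: "(c has_sum a \<alpha>) (?F \<alpha>)" for \<alpha>
    unfolding a_def by simp
  define N where "N \<alpha> = infsum ?n (?F \<alpha>)" for \<alpha>
  have N: "(?n has_sum N \<alpha>) (?F \<alpha>)" for \<alpha>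
    unfolding N_def using n_summable by simp
  have N_sum: "(N has_sum S) UNIV"
    by (rule has_sum_fibres[OF S N])
  have aN: "\<bar>a \<alpha>\<bar> * \<rho> ^ msize \<alpha> \<le> N \<alpha>" for \<alpha>
  proof -
    have "\<bar>a \<alpha>\<bar> \<le> (\<Sum>\<^sub>\<infinity>i\<in>?F \<alpha>. \<bar>c i\<bar>)"
      unfolding a_def using norm_infsum_bound[of c "?F \<alpha>"] abs_c by simp
    then have "\<bar>a \<alpha>\<bar> * \<rho> ^ msize \<alpha> \<le> (\<Sum>\<^sub>\<infinity>i\<in>?F \<alpha>. \<bar>c i\<bar>) * \<rho> ^ msize \<alpha>"
      using \<rho> by (intro mult_right_mono) auto
    also have "\<dots> = (\<Sum>\<^sub>\<infinity>i\<in>?F \<alpha>. \<bar>c i\<bar> * \<rho> ^ msize \<alpha>)"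
      by (simp add: infsum_cmult_left')
    also have "\<dots> = N \<alpha>"
      unfolding N_def by (rule infsum_cong) auto
    finally show ?thesis .
  qed
  have sum_a: "(\<lambda>\<alpha>. \<bar>a \<alpha>\<bar> * \<rho> ^ msize \<alpha>) summable_on UNIV"
    by (rule summable_on_comparison_test[of N]) (use N_sum aN \<rho> in \<open>auto simp: summable_on_def\<close>)
  moreover have "(\<Sum>\<^sub>\<infinity>\<alpha>. \<bar>a \<alpha>\<bar> * \<rho> ^ msize \<alpha>) \<le> B"
    using has_sum_mono[OF has_sum_infsum[OF sum_a] N_sum aN] \<open>S \<le> B\<close> by simp
  moreover have "((\<lambda>\<alpha>. a \<alpha> * vmonom y \<alpha>) has_sum f y) UNIV" if "y \<in> cube \<rho>" for y
  proof (rule has_sum_fibres[OF f[OF that]])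
    fix \<alpha>
    have "((\<lambda>i. c i * vmonom y \<alpha>) has_sum a \<alpha> * vmonom y \<alpha>) (?F \<alpha>)"
      using a by (rule has_sum_cmult_left)
    then show "((\<lambda>i. c i * vmonom y (l i)) has_sum a \<alpha> * vmonom y \<alpha>) (?F \<alpha>)"
      by (rule has_sum_cong[THEN iffD1, rotated]) auto
  qed
  ultimately show ?thesis
    unfolding series_bound_def by blast
qed

lemma series_bound_mono:
  assumes "series_bound \<rho> f B" "B \<le> B'"
  shows "series_bound \<rho> f B'"
proof -
  from assms(1) obtain a where "(\<lambda>\<alpha>. \<bar>a \<alpha>\<bar> * \<rho> ^ msize \<alpha>) summable_on UNIV"
      "(\<Sum>\<^sub>\<infinity>\<alpha>. \<bar>a \<alpha>\<bar> * \<rho> ^ msize \<alpha>) \<le> B"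
      "\<forall>y\<in>cube \<rho>. ((\<lambda>\<alpha>. a \<alpha> * vmonom y \<alpha>) has_sum f y) UNIV"
    unfolding series_bound_def by blast
  with assms(2) show ?thesis
    unfolding series_bound_def by (intro exI[of _ a]) auto
qed

lemma series_bound_cong:
  assumes "series_bound \<rho> f B" "\<And>y. y \<in> cube \<rho> \<Longrightarrow> f y = g y"
  shows "series_bound \<rho> g B"
proof -
  from assms(1) obtain a where "(\<lambda>\<alpha>. \<bar>a \<alpha>\<bar> * \<rho> ^ msize \<alpha>) summable_on UNIV"
      "(\<Sum>\<^sub>\<infinity>\<alpha>. \<bar>a \<alpha>\<bar> * \<rho> ^ msize \<alpha>) \<le> B"
      "\<forall>y\<in>cube \<rho>. ((\<lambda>\<alpha>. a \<alpha> * vmonom y \<alpha>) has_sum f y) UNIV"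
    unfolding series_bound_def by blast
  with assms(2) show ?thesis
    unfolding series_bound_def by (intro exI[of _ a]) auto
qed

lemma series_bound_abs_le:
  fixes f :: "real ^ 'd::finite \<Rightarrow> real"
  assumes "series_bound \<rho> f B" "y \<in> cube \<rho>"
  shows "\<bar>f y\<bar> \<le> B"
proof -
  obtain a where a: "(\<lambda>\<alpha>. \<bar>a \<alpha>\<bar> * \<rho> ^ msize \<alpha>) summable_on UNIV"
      "(\<Sum>\<^sub>\<infinity>\<alpha>. \<bar>a \<alpha>\<bar> * \<rho> ^ msize \<alpha>) \<le> B" "((\<lambda>\<alpha>. a \<alpha> * vmonom y \<alpha>) has_sum f y) UNIV"
    using assms unfolding series_bound_def by blast
  have "norm (f y) \<le> (\<Sum>\<^sub>\<infinity>\<alpha>. \<bar>a \<alpha>\<bar> * \<rho> ^ msize \<alpha>)"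
    by (rule norm_infsum_le[OF a(3) has_sum_infsum[OF a(1)]])
       (use abs_vmonom_le[OF assms(2)] in \<open>auto simp: abs_mult intro: mult_left_mono\<close>)
  with a(2) show ?thesis by simp
qed

section \<open>Elementary series, products and infinite sums\<close>

lemma series_bound_const:
  assumes "0 < \<rho>"
  shows "series_bound \<rho> (\<lambda>_ :: real ^ 'd::finite. c) \<bar>c\<bar>"
  by (rule series_boundI_indexed[where A = "{()}" and c = "\<lambda>_. c" and l = "\<lambda>_ _. 0" and S = "\<bar>c\<bar>"])
     (use assms in \<open>auto intro!: has_sum_finiteI\<close>)

lemma series_bound_component:
  assumes "0 < \<rho>"
  shows "series_bound \<rho> (\<lambda>y :: real ^ 'd::finite. y $ j) \<rho>"
  by (rule series_boundI_indexed[where A = "{()}" and c = "\<lambda>_. 1" and S = "\<rho>"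
        and l = "\<lambda>_ i. if i = j then 1 else 0"])
     (use assms in \<open>auto intro!: has_sum_finiteI simp: vmonom_unit\<close>)

lemma has_sum_times:
  fixes f :: "'a \<Rightarrow> real" and g :: "'b \<Rightarrow> real"
  assumes "(f has_sum S) A" "(g has_sum T) B"
  shows "((\<lambda>(x, y). f x * g y) has_sum S * T) (A \<times> B)"
proof (rule has_sum_SigmaI)
  show "((\<lambda>y. case (x, y) of (x, y) \<Rightarrow> f x * g y) has_sum f x * T) B" for x
    using has_sum_cmult_right[OF assms(2)] by simp
  show "((\<lambda>x. f x * T) has_sum S * T) A"
    using assms(1) by (rule has_sum_cmult_left)
  have af: "(\<lambda>x. norm (f x)) summable_on A" and ag: "(\<lambda>x. norm (g x)) summable_on B"
    using assms summable_on_iff_abs_summable_on_real by (auto simp: summable_on_def)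
  have "(\<lambda>(x, y). \<bar>f x\<bar> * \<bar>g y\<bar>) summable_on A \<times> B"
  proof (rule summable_on_SigmaI)
    show "((\<lambda>y. case (x, y) of (x, y) \<Rightarrow> \<bar>f x\<bar> * \<bar>g y\<bar>) has_sum \<bar>f x\<bar> * (\<Sum>\<^sub>\<infinity>y\<in>B. norm (g y))) B" for x
      using has_sum_cmult_right[OF has_sum_infsum[OF ag]] by simp
    show "(\<lambda>x. \<bar>f x\<bar> * (\<Sum>\<^sub>\<infinity>y\<in>B. norm (g y))) summable_on A"
      using summable_on_cmult_left[OF af] by simp
  qed auto
  then show "(\<lambda>(x, y). f x * g y) summable_on A \<times> B"
    using abs_summable_summable[of "\<lambda>(x, y). f x * g y" "A \<times> B"]
    by (simp add: case_prod_unfold abs_mult)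
qed

text \<open>The Cauchy product: pairs of multi-indices, labelled by their sum, carry the product
  coefficients, so the norms multiply.\<close>

lemma series_bound_mult:
  fixes f g :: "real ^ 'd::finite \<Rightarrow> real"
  assumes \<rho>: "0 < \<rho>" and f: "series_bound \<rho> f B" and g: "series_bound \<rho> g C"
  shows "series_bound \<rho> (\<lambda>y. f y * g y) (B * C)"
proof -
  obtain a where a: "(\<lambda>\<alpha>. \<bar>a \<alpha>\<bar> * \<rho> ^ msize \<alpha>) summable_on UNIV"
      "(\<Sum>\<^sub>\<infinity>\<alpha>. \<bar>a \<alpha>\<bar> * \<rho> ^ msize \<alpha>) \<le> B"
      "\<And>y. y \<in> cube \<rho> \<Longrightarrow> ((\<lambda>\<alpha>. a \<alpha> * vmonom y \<alpha>) has_sum f y) UNIV"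
    using f unfolding series_bound_def by blast
  obtain b where b: "(\<lambda>\<alpha>. \<bar>b \<alpha>\<bar> * \<rho> ^ msize \<alpha>) summable_on UNIV"
      "(\<Sum>\<^sub>\<infinity>\<alpha>. \<bar>b \<alpha>\<bar> * \<rho> ^ msize \<alpha>) \<le> C"
      "\<And>y. y \<in> cube \<rho> \<Longrightarrow> ((\<lambda>\<alpha>. b \<alpha> * vmonom y \<alpha>) has_sum g y) UNIV"
    using g unfolding series_bound_def by blast
  show ?thesis
  proof (rule series_boundI_indexed[OF \<rho>])
    let ?l = "\<lambda>(\<alpha>, \<beta>) i. \<alpha> i + \<beta> i"
    show "((\<lambda>x. \<bar>case x of (\<alpha>, \<beta>) \<Rightarrow> a \<alpha> * b \<beta>\<bar> * \<rho> ^ msize (?l x)) has_sum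
        (\<Sum>\<^sub>\<infinity>\<alpha>. \<bar>a \<alpha>\<bar> * \<rho> ^ msize \<alpha>) * (\<Sum>\<^sub>\<infinity>\<alpha>. \<bar>b \<alpha>\<bar> * \<rho> ^ msize \<alpha>)) (UNIV \<times> UNIV)"
      using has_sum_times[OF has_sum_infsum[OF a(1)] has_sum_infsum[OF b(1)]]
      by (simp add: case_prod_unfold msize_add power_add abs_mult mult_ac)
    show "((\<lambda>x. (case x of (\<alpha>, \<beta>) \<Rightarrow> a \<alpha> * b \<beta>) * vmonom y (?l x)) has_sum f y * g y) (UNIV \<times> UNIV)"
      if "y \<in> cube \<rho>" for y
      using has_sum_times[OF a(3)[OF that] b(3)[OF that]]
      by (simp add: case_prod_unfold vmonom_add mult_ac)
    have "0 \<le> (\<Sum>\<^sub>\<infinity>\<alpha>. \<bar>a \<alpha>\<bar> * \<rho> ^ msize \<alpha>)" "0 \<le> (\<Sum>\<^sub>\<infinity>\<alpha>. \<bar>b \<alpha>\<bar> * \<rho> ^ msize \<alpha>)"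
      using \<rho> by (auto intro!: infsum_nonneg)
    then show "(\<Sum>\<^sub>\<infinity>\<alpha>. \<bar>a \<alpha>\<bar> * \<rho> ^ msize \<alpha>) * (\<Sum>\<^sub>\<infinity>\<alpha>. \<bar>b \<alpha>\<bar> * \<rho> ^ msize \<alpha>) \<le> B * C"
      using a(2) b(2) by (intro mult_mono) auto
  qed
qed

text \<open>Completeness of the algebra. The index set consists of the pairs (k, \<alpha>), on which
  the coefficients are absolutely summable because the norms \<open>B k\<close> are
  summable.\<close>

lemma series_bound_infsum:
  fixes f :: "'k \<Rightarrow> real ^ 'd::finite \<Rightarrow> real"
  assumes \<rho>: "0 < \<rho>" and f: "\<And>k. k \<in> K \<Longrightarrow> series_bound \<rho> (f k) (B k)"
    and B: "B summable_on K" and S: "(\<Sum>\<^sub>\<infinity>k\<in>K. B k) \<le> S"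
  shows "series_bound \<rho> (\<lambda>y. \<Sum>\<^sub>\<infinity>k\<in>K. f k y) S"
proof -
  have "\<forall>k\<in>K. \<exists>a. (\<lambda>\<alpha>. \<bar>a \<alpha>\<bar> * \<rho> ^ msize \<alpha>) summable_on UNIV \<and>
      (\<Sum>\<^sub>\<infinity>\<alpha>. \<bar>a \<alpha>\<bar> * \<rho> ^ msize \<alpha>) \<le> B k \<and>
      (\<forall>y\<in>cube \<rho>. ((\<lambda>\<alpha>. a \<alpha> * vmonom y \<alpha>) has_sum f k y) UNIV)"
    using f unfolding series_bound_def by blast
  from bchoice[OF this] obtain a where
      a: "\<And>k. k \<in> K \<Longrightarrow> (\<lambda>\<alpha>. \<bar>a k \<alpha>\<bar> * \<rho> ^ msize \<alpha>) summable_on UNIV"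
      "\<And>k. k \<in> K \<Longrightarrow> (\<Sum>\<^sub>\<infinity>\<alpha>. \<bar>a k \<alpha>\<bar> * \<rho> ^ msize \<alpha>) \<le> B k"
      "\<And>k y. k \<in> K \<Longrightarrow> y \<in> cube \<rho> \<Longrightarrow> ((\<lambda>\<alpha>. a k \<alpha> * vmonom y \<alpha>) has_sum f k y) UNIV"
    by blast
  define N where "N k = (\<Sum>\<^sub>\<infinity>\<alpha>. \<bar>a k \<alpha>\<bar> * \<rho> ^ msize \<alpha>)" for k
  have N: "((\<lambda>\<alpha>. \<bar>a k \<alpha>\<bar> * \<rho> ^ msize \<alpha>) has_sum N k) UNIV" if "k \<in> K" for k
    unfolding N_def using a(1)[OF that] by simp
  have N_nonneg: "0 \<le> N k" for k
    unfolding N_def using \<rho> by (auto intro!: infsum_nonneg)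
  have N_summable: "N summable_on K"
    by (rule summable_on_comparison_test[OF B]) (use a(2) N_nonneg in \<open>auto simp: N_def\<close>)
  have sum: "(\<lambda>(k, \<alpha>). \<bar>a k \<alpha>\<bar> * \<rho> ^ msize \<alpha>) summable_on (K \<times> UNIV)"
    by (rule summable_on_SigmaI[OF _ N_summable]) (use N \<rho> in auto)
  show ?thesis
  proof (rule series_boundI_indexed[OF \<rho>])
    show "((\<lambda>x. \<bar>case x of (k, \<alpha>) \<Rightarrow> a k \<alpha>\<bar> * \<rho> ^ msize (snd x)) has_sum infsum N K) (K \<times> UNIV)"
      by (rule has_sum_SigmaI[OF _ has_sum_infsum[OF N_summable]])
         (use N sum in \<open>auto simp: case_prod_unfold\<close>)
    have "infsum N K \<le> infsum B K"
      using a(2) by (intro infsum_mono N_summable B) (simp add: N_def)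
    with S show "infsum N K \<le> S" by simp
    fix y :: "real ^ 'd" assume y: "y \<in> cube \<rho>"
    have "(\<lambda>x. norm (case x of (k, \<alpha>) \<Rightarrow> a k \<alpha> * vmonom y \<alpha>)) summable_on (K \<times> UNIV)"
      by (rule Infinite_Sum.abs_summable_on_comparison_test'[OF sum])
         (use abs_vmonom_le[OF y] in \<open>auto simp: abs_mult intro!: mult_left_mono\<close>)
    then have sum_y: "(\<lambda>(k, \<alpha>). a k \<alpha> * vmonom y \<alpha>) summable_on (K \<times> UNIV)"
      by (rule abs_summable_summable)
    have "(\<lambda>k. norm (f k y)) summable_on K"
      by (rule Infinite_Sum.abs_summable_on_comparison_test'[OF B])
         (use series_bound_abs_le[OF f y] in simp)
    then have "((\<lambda>k. f k y) has_sum (\<Sum>\<^sub>\<infinity>k\<in>K. f k y)) K"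
      by (rule has_sum_infsum[OF abs_summable_summable])
    from has_sum_SigmaI[OF _ this, of "\<lambda>(k, \<alpha>). a k \<alpha> * vmonom y \<alpha>"] a(3) y sum_y
    show "((\<lambda>x. (case x of (k, \<alpha>) \<Rightarrow> a k \<alpha>) * vmonom y (snd x)) has_sum (\<Sum>\<^sub>\<infinity>k\<in>K. f k y)) (K \<times> UNIV)"
      by (simp add: case_prod_unfold)
  qed
qed

lemma series_bound_add:
  fixes f g :: "real ^ 'd::finite \<Rightarrow> real"
  assumes \<rho>: "0 < \<rho>" and f: "series_bound \<rho> f B" and g: "series_bound \<rho> g C"
  shows "series_bound \<rho> (\<lambda>y. f y + g y) (B + C)"
proof -
  \<comment> \<open>The two summands form a series indexed by \<open>bool\<close>.\<close>
  have "series_bound \<rho> (\<lambda>y. \<Sum>\<^sub>\<infinity>k\<in>UNIV. (if k then f else g) y) (B + C)"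
    by (rule series_bound_infsum[OF \<rho>, where B = "\<lambda>k. if k then B else C"])
       (use f g in \<open>auto simp: UNIV_bool\<close>)
  then show ?thesis by (simp add: UNIV_bool add.commute)
qed

lemma series_bound_cmult:
  fixes f :: "real ^ 'd::finite \<Rightarrow> real"
  assumes "0 < \<rho>" "series_bound \<rho> f B"
  shows "series_bound \<rho> (\<lambda>y. c * f y) (\<bar>c\<bar> * B)"
  by (rule series_bound_mult[OF assms(1) series_bound_const[OF assms(1)] assms(2)])

lemma series_bound_diff:
  fixes f g :: "real ^ 'd::finite \<Rightarrow> real"
  assumes \<rho>: "0 < \<rho>" and f: "series_bound \<rho> f B" and g: "series_bound \<rho> g C"
  shows "series_bound \<rho> (\<lambda>y. f y - g y) (B + C)"
  using series_bound_add[OF \<rho> f series_bound_cmult[OF \<rho> g, of "- 1"]] by simp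

lemma series_bound_sum:
  fixes f :: "'k \<Rightarrow> real ^ 'd::finite \<Rightarrow> real"
  assumes "0 < \<rho>" "finite K" "\<And>k. k \<in> K \<Longrightarrow> series_bound \<rho> (f k) (B k)"
  shows "series_bound \<rho> (\<lambda>y. \<Sum>k\<in>K. f k y) (\<Sum>k\<in>K. B k)"
  using series_bound_infsum[OF assms(1,3), of K] assms(2) by simp

lemma series_bound_power:
  fixes f :: "real ^ 'd::finite \<Rightarrow> real"
  assumes "0 < \<rho>" "series_bound \<rho> f B"
  shows "series_bound \<rho> (\<lambda>y. f y ^ n) (B ^ n)"
proof (induction n)
  case 0
  show ?case using series_bound_const[OF assms(1), of 1] by simp
next
  case (Suc n)
  show ?case using series_bound_mult[OF assms Suc.IH] by simp
qed

lemma series_bound_nonneg: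
  assumes "0 \<le> \<rho>" "series_bound \<rho> f B"
  shows "0 \<le> B"
proof -
  have "0 \<in> cube \<rho>" using assms(1) by (simp add: cube_def)
  from series_bound_abs_le[OF assms(2) this] show ?thesis by linarith
qed

lemma diff_in_cube:
  fixes x y :: "real ^ 'd::finite"
  assumes "y \<in> ball x \<rho>"
  shows "y - x \<in> cube \<rho>"
proof -
  have "\<bar>(y - x) $ i\<bar> \<le> \<rho>" for i
    using assms component_le_norm_cart[of "y - x" i] by (simp add: dist_norm norm_minus_commute)
  then show ?thesis by (simp add: cube_def)
qed

lemma series_bound_real_analytic:
  fixes f g :: "real ^ 'd::finite \<Rightarrow> real"
  assumes "0 < \<rho>" "series_bound \<rho> f B" "\<And>y. y \<in> cube \<rho> \<Longrightarrow> g (x + y) = f y"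
  shows "real_analytic_at g x"
proof -
  obtain a where a: "\<And>y. y \<in> cube \<rho> \<Longrightarrow> ((\<lambda>\<alpha>. a \<alpha> * vmonom y \<alpha>) has_sum f y) UNIV"
    using assms(2) unfolding series_bound_def by blast
  have "((\<lambda>\<alpha>. a \<alpha> * (\<Prod>i\<in>UNIV. (y $ i - x $ i) ^ \<alpha> i)) has_sum g y) UNIV" if "y \<in> ball x \<rho>" for y
    using a[of "y - x"] assms(3)[of "y - x"] diff_in_cube[OF that] by (simp add: vmonom_def)
  then show ?thesis
    unfolding real_analytic_at_def using assms(1) by blast
qed

section \<open>An analytic implicit function\<close>

lemma exp_has_sum_shift:
  fixes x :: real
  shows "((\<lambda>n. x ^ (n + k) / fact (n + k)) has_sum exp x - (\<Sum>i<k. x ^ i / fact i)) UNIV"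
proof (rule norm_summable_imp_has_sum)
  have "summable (\<lambda>n. norm (x ^ n / fact n))"
    using summable_norm_exp[of x] by (simp add: divide_inverse_commute)
  then show "summable (\<lambda>n. norm (x ^ (n + k) / fact (n + k)))"
    by (subst summable_iff_shift)
  have "(\<lambda>n. x ^ n / fact n) sums exp x"
    using exp_converges[of x] by (simp add: divide_inverse_commute)
  then show "(\<lambda>n. x ^ (n + k) / fact (n + k)) sums (exp x - (\<Sum>i<k. x ^ i / fact i))"
    by (subst sums_iff_shift) simp
qed

text \<open>\<open>E ^ n - F ^ n\<close> is \<open>E - F\<close> times n products of norm at most
  \<open>B ^ (n - 1)\<close>, so the n-th exponential term costs
  \<open>D * B ^ (n - 1) / fact (n - 1)\<close>. Subtracting the linear part starts the sum at n = 2
  and leaves \<open>exp B - 1\<close> in place of \<open>exp B\<close>; this factor is small for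
  small B and makes the Picard map contract.\<close>

lemma series_bound_exp_remainder:
  fixes E F :: "real ^ 'd::finite \<Rightarrow> real"
  assumes \<rho>: "0 < \<rho>" and E: "series_bound \<rho> E B" and F: "series_bound \<rho> F B"
    and D: "series_bound \<rho> (\<lambda>y. E y - F y) D"
  shows "series_bound \<rho> (\<lambda>y. exp (E y) - exp (F y) - (E y - F y)) (D * (exp B - 1))"
proof -
  let ?f = "\<lambda>n y. (E y ^ (n + 2) - F y ^ (n + 2)) / fact (n + 2)"
  have B_sum: "((\<lambda>n. D * (B ^ (n + 1) / fact (n + 1))) has_sum D * (exp B - 1)) UNIV"
    by (intro has_sum_cmult_right) (use exp_has_sum_shift[of B 1] in simp)
  have "series_bound \<rho> (\<lambda>y. \<Sum>\<^sub>\<infinity>n. ?f n y) (D * (exp B - 1))"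
  proof (rule series_bound_infsum[OF \<rho>])
    fix n :: nat
    have "series_bound \<rho> (\<lambda>y. 1 / fact (n + 2) * ((E y - F y) * (\<Sum>i<n + 2. F y ^ (n + 2 - Suc i) * E y ^ i)))
      (\<bar>1 / fact (n + 2)\<bar> * (D * (\<Sum>i<n + 2. B ^ (n + 2 - Suc i) * B ^ i)))"
      by (intro series_bound_cmult series_bound_mult series_bound_sum series_bound_power \<rho> E F D finite_lessThan)
    then have "series_bound \<rho> (?f n) (\<bar>1 / fact (n + 2)\<bar> * (D * (\<Sum>i<n + 2. B ^ (n + 2 - Suc i) * B ^ i)))"
      by (rule series_bound_cong) (simp only: power_diff_sumr2[symmetric] times_divide_eq_left mult_1_left)
    also have "(\<Sum>i<n + 2. B ^ (n + 2 - Suc i) * B ^ i) = (\<Sum>i<n + 2. B ^ (n + 1))"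
      by (intro sum.cong refl) (auto simp flip: power_add)
    also have "\<bar>1 / fact (n + 2)\<bar> * (D * (\<Sum>i<n + 2. B ^ (n + 1))) = D * (B ^ (n + 1) / fact (n + 1))"
    proof -
      have "\<bar>1 / (a * b)\<bar> * (D * (a * c)) = D * (c / b)" if "0 < a" "0 < b" for a b c :: real
        using that by (simp add: field_simps)
      from this[of "real (n + 2)" "fact (n + 1)" "B ^ (n + 1)"] show ?thesis
        using fact_Suc[of "n + 1", where 'a = real] by (simp del: fact_Suc power_Suc)
    qed
    finally show "series_bound \<rho> (?f n) (D * (B ^ (n + 1) / fact (n + 1)))" .
  qed (use B_sum in \<open>auto simp: has_sum_iff\<close>)
  then show ?thesis
  proof (rule series_bound_cong)
    fix y
    have two: "(\<Sum>i<2. z ^ i / fact i) = 1 + z" for z :: real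
      by (simp add: numeral_2_eq_2)
    have "?f n y = E y ^ (n + 2) / fact (n + 2) + - (F y ^ (n + 2) / fact (n + 2))" for n
      by (rule trans[OF diff_divide_distrib diff_conv_add_uminus])
    then have "((\<lambda>n. ?f n y) has_sum (exp (E y) - (1 + E y)) + - (exp (F y) - (1 + F y))) UNIV"
      using has_sum_add[OF exp_has_sum_shift[of "E y" 2] has_sum_uminusI[OF exp_has_sum_shift[of "F y" 2]]]
      unfolding two by presburger
    then show "(\<Sum>\<^sub>\<infinity>n. ?f n y) = exp (E y) - exp (F y) - (E y - F y)"
      by (simp only: has_sum_iff)
  qed
qed

text \<open>The index set stands for the blocks, with displacement x, duration k and weights w
  tilted so as to form a probability at the base point; \<eta> is part of the gap between the root
  and the growth rate of the unfinished block. Displacements are measured in the l1 norm because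
  this is the coefficient norm of a linear form.\<close>

locale tilted_increments =
  fixes I :: "'i set" and w :: "'i \<Rightarrow> real" and x :: "'i \<Rightarrow> real ^ 'd::finite" and k :: "'i \<Rightarrow> real" and \<eta> :: real
  assumes w_nonneg: "i \<in> I \<Longrightarrow> 0 \<le> w i"
    and k_ge_1: "i \<in> I \<Longrightarrow> 1 \<le> k i"
    and x_le_k: "i \<in> I \<Longrightarrow> (\<Sum>j\<in>UNIV. \<bar>x i $ j\<bar>) \<le> k i"
    and w_sum: "(w has_sum 1) I"
    and \<eta>_pos: "0 < \<eta>"
    and exp_moment: "(\<lambda>i. w i * exp (\<eta> * k i)) summable_on I"
begin

definition mean_time :: real where
  "mean_time = (\<Sum>\<^sub>\<infinity>i\<in>I. w i * k i)"

text \<open>One factor k comes from the difference of the exponents \<open>s y * k i\<close>, the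
  second from \<open>exp z - 1 \<le> z * exp z\<close>; the rate \<open>\<eta> / 2\<close>
  accommodates exponents of norm at most \<open>2 * \<sigma> * k i\<close> with \<sigma> at most
  \<open>\<eta> / 4\<close>.\<close>

definition moment2 :: real where
  "moment2 = (\<Sum>\<^sub>\<infinity>i\<in>I. w i * ((k i)\<^sup>2 * exp (\<eta> / 2 * k i)))"

text \<open>A fixed point of \<open>picard\<close> solves \<open>(\<Sum>i. w i * exp (y \<bullet> x i - s y * k i)) = 1\<close>. The terms linear
  in \<open>s\<close> cancel at \<open>y = 0\<close>, \<open>s = 0\<close>, which makes it a contraction near \<open>0\<close>.\<close>

definition picard :: "(real ^ 'd \<Rightarrow> real) \<Rightarrow> real ^ 'd \<Rightarrow> real" where
  "picard s y = (\<Sum>\<^sub>\<infinity>i\<in>I. w i * (exp (y \<bullet> x i - s y * k i) - 1 + s y * k i)) / mean_time"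

section \<open>Moments of the block length\<close>

lemma summable_dominated:
  assumes "\<And>i. i \<in> I \<Longrightarrow> \<bar>h i\<bar> \<le> C * exp (\<eta> * k i)"
  shows "(\<lambda>i. w i * h i) summable_on I"
proof -
  have "(\<lambda>i. norm (w i * h i)) summable_on I"
  proof (rule Infinite_Sum.abs_summable_on_comparison_test')
    show "(\<lambda>i. C * (w i * exp (\<eta> * k i))) summable_on I"
      using exp_moment by (rule summable_on_cmult_right)
    show "norm (w i * h i) \<le> C * (w i * exp (\<eta> * k i))" if "i \<in> I" for i
      using mult_left_mono[OF assms[OF that] w_nonneg[OF that]] w_nonneg[OF that]
      by (simp add: abs_mult mult_ac)
  qed
  then show ?thesis by (rule abs_summable_summable)
qed

text \<open>One of the two factors \<open>exp (\<eta> / 2 * z)\<close> in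
  \<open>exp (\<eta> * z)\<close> pays for the square, by the quadratic Taylor bound.\<close>

lemma square_exp_le: "z\<^sup>2 * exp (\<eta> / 2 * z) \<le> 8 / \<eta>\<^sup>2 * exp (\<eta> * z)" if "0 \<le> z" for z
proof -
  have "0 \<le> \<eta> / 2 * z"
    using that \<eta>_pos by simp
  from exp_lower_Taylor_quadratic[OF this] this
  have "(\<eta> / 2 * z)\<^sup>2 / 2 \<le> exp (\<eta> / 2 * z)"
    by linarith
  then have "z\<^sup>2 \<le> 8 / \<eta>\<^sup>2 * exp (\<eta> / 2 * z)"
    using \<eta>_pos by (simp add: field_simps power2_eq_square)
  then have "z\<^sup>2 * exp (\<eta> / 2 * z) \<le> 8 / \<eta>\<^sup>2 * exp (\<eta> / 2 * z) * exp (\<eta> / 2 * z)"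
    by (intro mult_right_mono) auto
  also have "\<dots> = 8 / \<eta>\<^sup>2 * exp (\<eta> * z)"
    by (simp flip: exp_add)
  finally show ?thesis .
qed

lemma moment2_summable: "(\<lambda>i. w i * ((k i)\<^sup>2 * exp (\<eta> / 2 * k i))) summable_on I"
proof (rule summable_dominated)
  show "\<bar>(k i)\<^sup>2 * exp (\<eta> / 2 * k i)\<bar> \<le> 8 / \<eta>\<^sup>2 * exp (\<eta> * k i)" if "i \<in> I" for i
    using square_exp_le[of "k i"] k_ge_1[OF that] by simp
qed

lemma moment2_nonneg: "0 \<le> moment2"
  unfolding moment2_def using w_nonneg by (intro infsum_nonneg mult_nonneg_nonneg) auto

lemma k_le_exp: "k i \<le> 1 / \<eta> * exp (\<eta> * k i)"
proof -
  have "\<eta> * k i \<le> exp (\<eta> * k i)"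
    using exp_ge_add_one_self[of "\<eta> * k i"] by linarith
  then show ?thesis
    using \<eta>_pos by (simp add: field_simps)
qed

lemma mean_summable: "(\<lambda>i. w i * k i) summable_on I"
  by (rule summable_dominated[where C = "1 / \<eta>"]) (use k_le_exp k_ge_1 in force)

lemma mean_has_sum: "((\<lambda>i. w i * k i) has_sum mean_time) I"
  unfolding mean_time_def using mean_summable by simp

lemma mean_time_ge_1: "1 \<le> mean_time"
proof (rule has_sum_mono[OF w_sum mean_has_sum])
  show "w i \<le> w i * k i" if "i \<in> I" for i
    using mult_left_mono[OF k_ge_1 w_nonneg] that by force
qed

lemma series_bound_inner:
  assumes "0 < \<rho>" "i \<in> I"
  shows "series_bound \<rho> (\<lambda>y. y \<bullet> x i) (\<rho> * k i)"
proof -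
  have "series_bound \<rho> (\<lambda>y. \<Sum>j\<in>UNIV. x i $ j * y $ j) (\<Sum>j\<in>UNIV. \<bar>x i $ j\<bar> * \<rho>)"
    by (intro series_bound_sum series_bound_cmult series_bound_component assms(1) finite)
  then have "series_bound \<rho> (\<lambda>y. y \<bullet> x i) (\<Sum>j\<in>UNIV. \<bar>x i $ j\<bar> * \<rho>)"
    by (rule series_bound_cong) (simp add: inner_vec_def mult.commute)
  then show ?thesis
  proof (rule series_bound_mono)
    have "(\<Sum>j\<in>UNIV. \<bar>x i $ j\<bar> * \<rho>) = \<rho> * (\<Sum>j\<in>UNIV. \<bar>x i $ j\<bar>)"
      by (simp add: sum_distrib_left mult.commute)
    also have "\<dots> \<le> \<rho> * k i"
      using assms x_le_k by (intro mult_left_mono) auto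
    finally show "(\<Sum>j\<in>UNIV. \<bar>x i $ j\<bar> * \<rho>) \<le> \<rho> * k i" .
  qed
qed

lemma exp_minus_1_le: "exp z - 1 \<le> z * exp z" for z :: real
  using exp_ge_add_one_self[of "- z"] by (simp add: exp_minus field_simps)

text \<open>Stated for a number c in place of a function, since it is applied at a fixed y to the
  value \<open>s y\<close>. Each of the three terms is at most
  \<open>exp (\<eta> * k i)\<close>.\<close>

lemma picard_summable:
  assumes y: "y \<in> cube \<rho>" and c: "\<bar>c\<bar> \<le> \<sigma>" and \<rho>: "0 < \<rho>" "\<rho> \<le> \<sigma>" and \<sigma>: "\<sigma> \<le> \<eta> / 4"
  shows "(\<lambda>i. w i * (exp (y \<bullet> x i - c * k i) - 1 + c * k i)) summable_on I"
proof (rule summable_dominated)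
  fix i assume i: "i \<in> I"
  have "\<bar>y \<bullet> x i\<bar> \<le> \<rho> * k i"
    using series_bound_abs_le[OF series_bound_inner[OF \<rho>(1) i] y] .
  also have "\<dots> \<le> \<eta> / 4 * k i"
    using \<rho> \<sigma> k_ge_1[OF i] by (intro mult_right_mono) auto
  finally have 1: "\<bar>y \<bullet> x i\<bar> \<le> \<eta> / 4 * k i" .
  have 2: "\<bar>c * k i\<bar> \<le> \<eta> / 4 * k i"
    unfolding abs_mult using c \<sigma> k_ge_1[OF i] by (intro mult_mono) auto
  have "exp (y \<bullet> x i - c * k i) \<le> exp (\<eta> * k i)"
    using 1 2 \<eta>_pos k_ge_1[OF i] by (auto simp: abs_le_iff)
  moreover have "1 \<le> exp (\<eta> * k i)"
    using \<eta>_pos k_ge_1[OF i] by simp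
  moreover have "\<bar>c * k i\<bar> \<le> exp (\<eta> * k i)"
  proof -
    have "\<eta> / 4 * k i \<le> \<eta> * k i"
      using \<eta>_pos k_ge_1[OF i] by (intro mult_right_mono) auto
    with 2 exp_ge_add_one_self[of "\<eta> * k i"] show ?thesis by linarith
  qed
  ultimately show "\<bar>exp (y \<bullet> x i - c * k i) - 1 + c * k i\<bar> \<le> 3 * exp (\<eta> * k i)"
    using exp_gt_zero[of "y \<bullet> x i - c * k i"] unfolding abs_le_iff by linarith
qed

text \<open>Because \<open>s y * k i\<close> is added inside the sum, the i-th term of the
  difference is exactly the exponential remainder for two exponents that differ by
  \<open>- k i * (s y - t y)\<close>. Its norm carries the extra factor
  \<open>exp (2 * \<sigma> * k i) - 1\<close>, so the Lipschitz constant is of order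
  \<sigma>.\<close>

lemma picard_contraction:
  assumes \<rho>: "0 < \<rho>" "\<rho> \<le> \<sigma>" and \<sigma>: "\<sigma> \<le> \<eta> / 4"
    and s: "series_bound \<rho> s \<sigma>" and t: "series_bound \<rho> t \<sigma>"
    and D: "series_bound \<rho> (\<lambda>y. s y - t y) D"
  shows "series_bound \<rho> (\<lambda>y. picard s y - picard t y) (2 * \<sigma> * moment2 * D)"
proof -
  have D0: "0 \<le> D" using series_bound_nonneg[OF _ D] \<rho> by simp
  let ?E = "\<lambda>s i y. y \<bullet> x i - s y * k i"
  let ?g = "\<lambda>i y. w i * (exp (?E s i y) - exp (?E t i y) - (?E s i y - ?E t i y))"
  have sb: "series_bound \<rho> (?E s' i) (2 * \<sigma> * k i)" if i: "i \<in> I" and s': "series_bound \<rho> s' \<sigma>" for s' i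
  proof -
    have "series_bound \<rho> (\<lambda>y. y \<bullet> x i - k i * s' y) (\<rho> * k i + \<bar>k i\<bar> * \<sigma>)"
      by (intro series_bound_diff series_bound_inner series_bound_cmult \<rho> i s')
    then have "series_bound \<rho> (?E s' i) (\<rho> * k i + \<bar>k i\<bar> * \<sigma>)"
      by (simp add: mult.commute)
    then show ?thesis
      by (rule series_bound_mono) (use k_ge_1[OF i] \<rho> in \<open>simp add: mult.commute\<close>)
  qed
  have "series_bound \<rho> (\<lambda>y. \<Sum>\<^sub>\<infinity>i\<in>I. ?g i y) (2 * \<sigma> * moment2 * D)"
  proof (rule series_bound_infsum[OF \<rho>(1)])
    fix i assume i: "i \<in> I"
    have "series_bound \<rho> (\<lambda>y. - k i * (s y - t y)) (\<bar>- k i\<bar> * D)"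
      by (intro series_bound_cmult \<rho> D)
    then have "series_bound \<rho> (\<lambda>y. ?E s i y - ?E t i y) (k i * D)"
      using k_ge_1[OF i] by (simp add: algebra_simps)
    from series_bound_cmult[OF \<rho>(1) series_bound_exp_remainder[OF \<rho>(1) sb[OF i s] sb[OF i t] this], of "w i"]
    show "series_bound \<rho> (?g i) (w i * ((k i)\<^sup>2 * exp (\<eta> / 2 * k i)) * (2 * \<sigma> * D))"
    proof (rule series_bound_mono)
      have "exp (2 * \<sigma> * k i) - 1 \<le> 2 * \<sigma> * k i * exp (2 * \<sigma> * k i)"
        by (rule exp_minus_1_le)
      also have "\<dots> \<le> 2 * \<sigma> * k i * exp (\<eta> / 2 * k i)"
        using \<rho> \<sigma> k_ge_1[OF i] by (intro mult_left_mono) auto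
      finally have "k i * D * (exp (2 * \<sigma> * k i) - 1) \<le> k i * D * (2 * \<sigma> * k i * exp (\<eta> / 2 * k i))"
        using k_ge_1[OF i] D0 by (intro mult_left_mono) auto
      from mult_left_mono[OF this w_nonneg[OF i]]
      show "\<bar>w i\<bar> * (k i * D * (exp (2 * \<sigma> * k i) - 1)) \<le>
          w i * ((k i)\<^sup>2 * exp (\<eta> / 2 * k i)) * (2 * \<sigma> * D)"
        using w_nonneg[OF i] by (simp add: power2_eq_square mult_ac)
    qed
  next
    show "(\<lambda>i. w i * ((k i)\<^sup>2 * exp (\<eta> / 2 * k i)) * (2 * \<sigma> * D)) summable_on I"
      using moment2_summable by (rule summable_on_cmult_left)
    show "(\<Sum>\<^sub>\<infinity>i\<in>I. w i * ((k i)\<^sup>2 * exp (\<eta> / 2 * k i)) * (2 * \<sigma> * D)) \<le> 2 * \<sigma> * moment2 * D"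
      by (simp add: infsum_cmult_left' moment2_def)
  qed
  from series_bound_cmult[OF \<rho>(1) this, of "1 / mean_time"]
  have "series_bound \<rho> (\<lambda>y. picard s y - picard t y) (\<bar>1 / mean_time\<bar> * (2 * \<sigma> * moment2 * D))"
  proof (rule series_bound_cong)
    fix y :: "real ^ 'd" assume y: "y \<in> cube \<rho>"
    have "(\<Sum>\<^sub>\<infinity>i\<in>I. w i * (exp (?E s i y) - 1 + s y * k i)) - (\<Sum>\<^sub>\<infinity>i\<in>I. w i * (exp (?E t i y) - 1 + t y * k i))
      = (\<Sum>\<^sub>\<infinity>i\<in>I. w i * (exp (?E s i y) - 1 + s y * k i) - w i * (exp (?E t i y) - 1 + t y * k i))"
      using has_sum_add[OF has_sum_infsum[OF picard_summable[OF y series_bound_abs_le[OF s y] \<rho> \<sigma>]]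
          has_sum_uminusI[OF has_sum_infsum[OF picard_summable[OF y series_bound_abs_le[OF t y] \<rho> \<sigma>]]]]
      by (intro infsumI[symmetric]) simp
    also have "\<dots> = (\<Sum>\<^sub>\<infinity>i\<in>I. ?g i y)"
      by (intro infsum_cong) (simp add: algebra_simps)
    finally show "1 / mean_time * (\<Sum>\<^sub>\<infinity>i\<in>I. ?g i y) = picard s y - picard t y"
      by (simp only: picard_def diff_divide_distrib[symmetric] times_divide_eq_left mult_1_left)
  qed
  then show ?thesis
  proof (rule series_bound_mono)
    have "0 \<le> 2 * \<sigma> * moment2 * D"
      using D0 moment2_nonneg \<rho> by simp
    then show "\<bar>1 / mean_time\<bar> * (2 * \<sigma> * moment2 * D) \<le> 2 * \<sigma> * moment2 * D"
      using mult_right_mono[of "\<bar>1 / mean_time\<bar>" 1] mean_time_ge_1 by simp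
  qed
qed

text \<open>The exponents \<open>y \<bullet> x i\<close> vanish at y = 0, so the image of 0 has norm
  of order \<rho>. Choosing \<rho> small relative to \<sigma> therefore keeps all iterates in the
  ball of radius \<sigma>.\<close>

lemma picard_zero:
  assumes \<rho>: "0 < \<rho>" "\<rho> \<le> \<eta> / 4"
  shows "series_bound \<rho> (picard (\<lambda>_. 0)) (\<rho> * moment2)"
proof -
  have "series_bound \<rho> (\<lambda>y. \<Sum>\<^sub>\<infinity>i\<in>I. w i * (exp (y \<bullet> x i) - 1)) (\<rho> * moment2)"
  proof (rule series_bound_infsum[OF \<rho>(1)])
    fix i assume i: "i \<in> I"
    have z: "series_bound \<rho> (\<lambda>_::real^'d. 0) (\<rho> * k i)"
      using series_bound_mono[OF series_bound_const[OF \<rho>(1), of 0], of "\<rho> * k i"] \<rho> k_ge_1[OF i] by simp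
    \<comment> \<open>The linear part that the remainder removes is added back as a separate term of
      norm \<open>\<rho> * k i\<close>.\<close>
    have "series_bound \<rho> (\<lambda>y. (exp (y \<bullet> x i) - exp 0 - (y \<bullet> x i - 0)) + y \<bullet> x i)
        (\<rho> * k i * (exp (\<rho> * k i) - 1) + \<rho> * k i)"
      by (intro series_bound_add series_bound_exp_remainder series_bound_inner z \<rho> i)
         (use series_bound_inner[OF \<rho>(1) i] in simp)
    from series_bound_cmult[OF \<rho>(1) this, of "w i"]
    have "series_bound \<rho> (\<lambda>y. w i * (exp (y \<bullet> x i) - 1)) (\<bar>w i\<bar> * (\<rho> * k i * (exp (\<rho> * k i) - 1) + \<rho> * k i))"
      by (simp add: algebra_simps)
    then show "series_bound \<rho> (\<lambda>y. w i * (exp (y \<bullet> x i) - 1)) (\<rho> * (w i * ((k i)\<^sup>2 * exp (\<eta> / 2 * k i))))"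
    proof (rule series_bound_mono)
      have "k i * exp (\<rho> * k i) \<le> (k i)\<^sup>2 * exp (\<eta> / 2 * k i)"
        unfolding power2_eq_square using k_ge_1[OF i] \<rho> by (intro mult_mono) auto
      from mult_left_mono[OF this, of "\<rho> * w i"]
      show "\<bar>w i\<bar> * (\<rho> * k i * (exp (\<rho> * k i) - 1) + \<rho> * k i) \<le> \<rho> * (w i * ((k i)\<^sup>2 * exp (\<eta> / 2 * k i)))"
        using w_nonneg[OF i] \<rho> by (simp add: algebra_simps)
    qed
  next
    show "(\<lambda>i. \<rho> * (w i * ((k i)\<^sup>2 * exp (\<eta> / 2 * k i)))) summable_on I"
      using moment2_summable by (rule summable_on_cmult_right)
    show "(\<Sum>\<^sub>\<infinity>i\<in>I. \<rho> * (w i * ((k i)\<^sup>2 * exp (\<eta> / 2 * k i)))) \<le> \<rho> * moment2"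
      by (simp add: infsum_cmult_right' moment2_def)
  qed
  from series_bound_cmult[OF \<rho>(1) this, of "1 / mean_time"]
  have "series_bound \<rho> (picard (\<lambda>_. 0)) (\<bar>1 / mean_time\<bar> * (\<rho> * moment2))"
    by (rule series_bound_cong) (simp add: picard_def)
  then show ?thesis
  proof (rule series_bound_mono)
    have "0 \<le> \<rho> * moment2"
      using moment2_nonneg \<rho> by simp
    then show "\<bar>1 / mean_time\<bar> * (\<rho> * moment2) \<le> \<rho> * moment2"
      using mult_right_mono[of "\<bar>1 / mean_time\<bar>" 1] mean_time_ge_1 by simp
  qed
qed

section \<open>Picard iteration and the implicit function\<close>

primrec iter :: "nat \<Rightarrow> real ^ 'd \<Rightarrow> real" where
  "iter 0 = (\<lambda>_. 0)"
| "iter (Suc n) = picard (iter n)"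

theorem implicit_function:
  assumes "0 < \<sigma>\<^sub>0"
  obtains \<rho> \<sigma> s where "0 < \<rho>" "\<rho> \<le> \<sigma>" "\<sigma> \<le> \<sigma>\<^sub>0" "series_bound \<rho> s \<sigma>"
    "\<And>y. y \<in> cube \<rho> \<Longrightarrow> ((\<lambda>i. w i * exp (y \<bullet> x i - s y * k i)) has_sum 1) I"
proof -
  \<comment> \<open>\<sigma> makes the contraction factor \<open>2 * \<sigma> * moment2\<close> at
    most 1/2 and keeps the exponents within reach of \<eta>; \<rho> makes the first iterate have
    norm at most \<open>\<sigma> / 2\<close>. The added 1 keeps both denominators positive.\<close>
  define \<sigma> where "\<sigma> = min (min \<sigma>\<^sub>0 (\<eta> / 4)) (1 / (4 * (moment2 + 1)))"
  define \<rho> where "\<rho> = \<sigma> / (2 * (moment2 + 1))"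
  have \<sigma>: "0 < \<sigma>" "\<sigma> \<le> \<sigma>\<^sub>0" "\<sigma> \<le> \<eta> / 4" "\<sigma> \<le> 1 / (4 * (moment2 + 1))"
    using assms \<eta>_pos moment2_nonneg by (auto simp: \<sigma>_def)
  have "\<sigma> * (4 * (moment2 + 1)) \<le> 1 / (4 * (moment2 + 1)) * (4 * (moment2 + 1))"
    using \<sigma>(4) moment2_nonneg by (intro mult_right_mono) auto
  then have half: "2 * \<sigma> * moment2 \<le> 1 / 2"
    using moment2_nonneg \<sigma>(1) by (simp add: algebra_simps)
  have \<rho>: "0 < \<rho>" "\<rho> \<le> \<sigma>"
    using \<sigma>(1) moment2_nonneg by (auto simp: \<rho>_def field_simps mult_le_cancel_right1)
  have \<rho>M: "\<rho> * moment2 \<le> \<sigma> / 2"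
    using \<sigma>(1) moment2_nonneg by (simp add: \<rho>_def field_simps)
  have contr: "series_bound \<rho> (\<lambda>y. picard s y - picard t y) (D / 2)"
    if "series_bound \<rho> s \<sigma>" "series_bound \<rho> t \<sigma>" "series_bound \<rho> (\<lambda>y. s y - t y) D" for s t D
  proof (rule series_bound_mono[OF picard_contraction[OF \<rho> \<sigma>(3) that]])
    have "0 \<le> D" using series_bound_nonneg[OF _ that(3)] \<rho> by simp
    from mult_right_mono[OF half this] show "2 * \<sigma> * moment2 * D \<le> D / 2" by simp
  qed
  \<comment> \<open>The first bound is the partial sum of the geometric series of increments, so no
    iterate leaves the ball of radius \<sigma>.\<close>
  have iter: "series_bound \<rho> (iter n) (\<sigma> * (1 - 1 / 2 ^ n)) \<and>
      series_bound \<rho> (\<lambda>y. iter (Suc n) y - iter n y) (\<sigma> / 2 ^ Suc n)" for n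
  proof (induction n)
    case 0
    show ?case
      using series_bound_const[OF \<rho>(1), of 0] series_bound_mono[OF picard_zero[OF \<rho>(1)] \<rho>M] \<rho> \<sigma> by simp
  next
    case (Suc n)
    have le: "\<sigma> * (1 - 1 / 2 ^ n) \<le> \<sigma>" for n
      using \<sigma> by (simp add: mult_le_cancel_left1)
    from Suc series_bound_add[OF \<rho>(1), of "iter n" "\<sigma> * (1 - 1 / 2 ^ n)" "\<lambda>y. iter (Suc n) y - iter n y" "\<sigma> / 2 ^ Suc n"]
    have 1: "series_bound \<rho> (iter (Suc n)) (\<sigma> * (1 - 1 / 2 ^ Suc n))"
      by (simp add: field_simps)
    moreover have "series_bound \<rho> (\<lambda>y. picard (iter (Suc n)) y - picard (iter n) y) (\<sigma> / 2 ^ Suc n / 2)"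
      by (rule contr[OF series_bound_mono[OF 1 le] series_bound_mono[OF _ le]]) (use Suc in auto)
    ultimately show ?case by (simp add: mult_ac)
  qed
  have iter_le: "series_bound \<rho> (iter n) \<sigma>" for n
    by (rule series_bound_mono[OF conjunct1[OF iter]]) (use \<sigma> in \<open>simp add: mult_le_cancel_left1\<close>)
  define s where "s y = (\<Sum>\<^sub>\<infinity>n. iter (Suc n) y - iter n y)" for y
  have geo: "((\<lambda>n. \<sigma> / 2 ^ Suc n) has_sum \<sigma>) UNIV"
  proof (rule sums_nonneg_imp_has_sum)
    show "(\<lambda>n. \<sigma> / 2 ^ Suc n) sums \<sigma>"
      using sums_mult[OF power_half_series, of \<sigma>] by (simp add: power_divide)
  qed (use \<sigma> in auto)
  have s: "series_bound \<rho> s \<sigma>"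
    unfolding s_def
    by (rule series_bound_infsum[OF \<rho>(1) conjunct2[OF iter]]) (use geo in \<open>auto simp: has_sum_iff\<close>)
  have lim: "(\<lambda>n. iter n y) \<longlonglongrightarrow> s y" if y: "y \<in> cube \<rho>" for y
  proof -
    have "(\<lambda>n. norm (iter (Suc n) y - iter n y)) summable_on UNIV"
      by (rule Infinite_Sum.abs_summable_on_comparison_test'[of "\<lambda>n. \<sigma> / 2 ^ Suc n"])
         (use geo series_bound_abs_le[OF conjunct2[OF iter] y] in \<open>auto simp: summable_on_def simp del: iter.simps\<close>)
    then have "((\<lambda>n. iter (Suc n) y - iter n y) has_sum s y) UNIV"
      unfolding s_def by (rule has_sum_infsum[OF abs_summable_summable])
    then have "(\<lambda>n. iter (Suc n) y - iter n y) sums s y"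
      by (rule has_sum_imp_sums)
    then show ?thesis
      unfolding sums_def sum_lessThan_telescope[of "\<lambda>n. iter n y"] by simp
  qed
  have fixpoint: "picard s y = s y" if y: "y \<in> cube \<rho>" for y
  proof -
    \<comment> \<open>\<open>picard s y\<close> depends on s only through the number
      \<open>s y\<close>, so the contraction may be applied to constant functions and then evaluated
      at y.\<close>
    have lip: "\<bar>picard (iter n) y - picard s y\<bar> \<le> \<bar>iter n y - s y\<bar> / 2" for n
    proof -
      have bound: "series_bound \<rho> (\<lambda>_::real^'d. c) \<sigma>" if "\<bar>c\<bar> \<le> \<sigma>" for c
        using series_bound_mono[OF series_bound_const[OF \<rho>(1)] that] .
      have "series_bound \<rho> (\<lambda>z. picard (\<lambda>_. iter n y) z - picard (\<lambda>_. s y) z) (\<bar>iter n y - s y\<bar> / 2)"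
        by (intro contr bound series_bound_const \<rho> series_bound_abs_le[OF iter_le y] series_bound_abs_le[OF s y])
      from series_bound_abs_le[OF this y] show ?thesis
        by (simp add: picard_def)
    qed
    have "(\<lambda>n. \<bar>iter n y - s y\<bar> / 2) \<longlonglongrightarrow> \<bar>s y - s y\<bar> / 2"
      by (intro tendsto_intros lim y) auto
    then have "(\<lambda>n. \<bar>iter n y - s y\<bar> / 2) \<longlonglongrightarrow> 0"
      by simp
    then have "(\<lambda>n. picard (iter n) y - picard s y) \<longlonglongrightarrow> 0"
      by (rule Lim_null_comparison[OF always_eventually, rotated]) (use lip in auto)
    then have "(\<lambda>n. iter (Suc n) y) \<longlonglongrightarrow> picard s y"
      by (simp add: Lim_null[symmetric] LIM_zero_cancel)
    moreover have "(\<lambda>n. iter (Suc n) y) \<longlonglongrightarrow> s y"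
      using lim[OF y] by (rule LIMSEQ_Suc)
    ultimately show ?thesis by (rule LIMSEQ_unique)
  qed
  have "((\<lambda>i. w i * exp (y \<bullet> x i - s y * k i)) has_sum 1) I" if y: "y \<in> cube \<rho>" for y
  proof -
    have "(\<Sum>\<^sub>\<infinity>i\<in>I. w i * (exp (y \<bullet> x i - s y * k i) - 1 + s y * k i)) = mean_time * s y"
      using fixpoint[OF y] mean_time_ge_1 by (simp add: picard_def field_simps)
    then have "((\<lambda>i. w i * (exp (y \<bullet> x i - s y * k i) - 1 + s y * k i)) has_sum mean_time * s y) I"
      using picard_summable[OF y series_bound_abs_le[OF s y] \<rho> \<sigma>(3)] by (simp add: has_sum_iff)
    \<comment> \<open>Adding the total mass 1 and subtracting \<open>mean_time * s y\<close> undoes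
      the normalisation in \<open>picard\<close>.\<close>
    from has_sum_add[OF has_sum_add[OF this w_sum] has_sum_uminusI[OF has_sum_cmult_left[OF mean_has_sum, of "s y"]]]
    show ?thesis by (simp add: algebra_simps)
  qed
  then show ?thesis
    using that[OF \<rho> \<sigma>(2) s] by blast
qed

end

section \<open>Differentiation of power series and Hessians\<close>

definition abs_coeffs :: "real \<Rightarrow> (('d \<Rightarrow> nat) \<Rightarrow> real) \<Rightarrow> bool" where
  "abs_coeffs \<rho> a \<longleftrightarrow> (\<lambda>\<alpha>. \<bar>a \<alpha>\<bar> * \<rho> ^ msize \<alpha>) summable_on UNIV"

definition psum :: "(('d \<Rightarrow> nat) \<Rightarrow> real) \<Rightarrow> real ^ 'd \<Rightarrow> real" where
  "psum a y = (\<Sum>\<^sub>\<infinity>\<alpha>. a \<alpha> * vmonom y \<alpha>)"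

definition dcoeff :: "'d \<Rightarrow> (('d \<Rightarrow> nat) \<Rightarrow> real) \<Rightarrow> ('d \<Rightarrow> nat) \<Rightarrow> real" where
  "dcoeff j a \<beta> = real (Suc (\<beta> j)) * a (\<beta>(j := Suc (\<beta> j)))"

text \<open>The truncated exponent at \<open>\<alpha> j = 0\<close> is harmless, as the factor
  \<open>\<alpha> j\<close> vanishes there.\<close>

definition vmonom_deriv :: "real ^ 'd \<Rightarrow> 'd \<Rightarrow> ('d \<Rightarrow> nat) \<Rightarrow> real" where
  "vmonom_deriv y j \<alpha> = real (\<alpha> j) * vmonom y (\<alpha>(j := \<alpha> j - 1))"

lemma vmonom_split:
  fixes y :: "real ^ 'd::finite"
  shows "vmonom y \<alpha> = y $ j ^ \<alpha> j * (\<Prod>i\<in>UNIV - {j}. (y $ i) ^ \<alpha> i)"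
  unfolding vmonom_def by (rule prod.remove) auto

lemma vmonom_deriv_eq:
  fixes y :: "real ^ 'd::finite"
  shows "vmonom_deriv y j \<alpha> = real (\<alpha> j) * y $ j ^ (\<alpha> j - 1) * (\<Prod>i\<in>UNIV - {j}. (y $ i) ^ \<alpha> i)"
  unfolding vmonom_deriv_def vmonom_split[of y _ j] by simp

lemma msize_update:
  fixes \<alpha> :: "'d::finite \<Rightarrow> nat"
  shows "msize (\<alpha>(j := n)) = n + (\<Sum>i\<in>UNIV - {j}. \<alpha> i)"
proof -
  have "msize (\<alpha>(j := n)) = (\<alpha>(j := n)) j + (\<Sum>i\<in>UNIV - {j}. (\<alpha>(j := n)) i)"
    unfolding msize_def by (rule sum.remove) auto
  also have "(\<Sum>i\<in>UNIV - {j}. (\<alpha>(j := n)) i) = (\<Sum>i\<in>UNIV - {j}. \<alpha> i)"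
    by (intro sum.cong) auto
  finally show ?thesis by (simp only: fun_upd_same)
qed

lemma msize_split:
  fixes \<alpha> :: "'d::finite \<Rightarrow> nat"
  shows "msize \<alpha> = \<alpha> j + (\<Sum>i\<in>UNIV - {j}. \<alpha> i)"
  using msize_update[of \<alpha> j "\<alpha> j"] by simp

text \<open>An elementary form of Cauchy's estimate; by convexity the left side is even at most
  \<open>s ^ n - r ^ n\<close>. Differentiation thus costs only a factor \<open>1 / (s - r)\<close>
  when the radius shrinks from s to r.\<close>

lemma mult_power_diff_le:
  fixes r s :: real
  assumes "0 \<le> r" "r \<le> s"
  shows "real n * r ^ (n - 1) * (s - r) \<le> s ^ n"
proof (cases n)
  case (Suc m)
  have "real (Suc m) * r ^ m * (s - r) \<le> s ^ Suc m"
  proof (induction m)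
    case 0
    show ?case using assms by simp
  next
    case (Suc m)
    have "real (Suc (Suc m)) * r ^ Suc m * (s - r) = r * (real (Suc m) * r ^ m * (s - r)) + r ^ Suc m * (s - r)"
      by (simp add: algebra_simps)
    also have "\<dots> \<le> r * s ^ Suc m + s ^ Suc m * (s - r)"
      using assms by (intro add_mono mult_left_mono mult_right_mono Suc power_mono) auto
    finally show ?case by (simp add: algebra_simps)
  qed
  with Suc show ?thesis by simp
qed (use assms in simp)

lemma vmonom_deriv_bound:
  fixes y :: "real ^ 'd::finite"
  assumes "y \<in> cube r" "0 < r" "r < s"
  shows "\<bar>vmonom_deriv y j \<alpha>\<bar> \<le> s ^ msize \<alpha> / (s - r)"
proof (cases "\<alpha> j = 0")
  case False
  then have m: "msize \<alpha> = Suc (msize (\<alpha>(j := \<alpha> j - 1)))"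
    by (simp add: msize_update msize_split[of \<alpha> j])
  have "\<bar>vmonom_deriv y j \<alpha>\<bar> \<le> real (msize \<alpha>) * r ^ (msize \<alpha> - 1)"
    unfolding vmonom_deriv_def abs_mult
  proof (intro mult_mono)
    have "\<alpha> j \<le> msize \<alpha>"
      using msize_split[of \<alpha> j] by linarith
    then show "\<bar>real (\<alpha> j)\<bar> \<le> real (msize \<alpha>)" by simp
    show "\<bar>vmonom y (\<alpha>(j := \<alpha> j - 1))\<bar> \<le> r ^ (msize \<alpha> - 1)"
      using abs_vmonom_le[OF assms(1), of "\<alpha>(j := \<alpha> j - 1)"] unfolding m by simp
  qed auto
  also have "\<dots> \<le> s ^ msize \<alpha> / (s - r)"
    using mult_power_diff_le[of r s "msize \<alpha>"] assms by (simp add: pos_le_divide_eq)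
  finally show ?thesis .
qed (use assms in \<open>simp add: vmonom_deriv_def\<close>)

lemma abs_coeffs_vmonom_deriv:
  fixes a :: "('d::finite \<Rightarrow> nat) \<Rightarrow> real"
  assumes a: "abs_coeffs s a" and y: "y \<in> cube r" and r: "0 < r" "r < s"
  shows "(\<lambda>\<alpha>. norm (a \<alpha> * vmonom_deriv y j \<alpha>)) summable_on UNIV"
proof (rule Infinite_Sum.abs_summable_on_comparison_test')
  show "(\<lambda>\<alpha>. \<bar>a \<alpha>\<bar> * s ^ msize \<alpha> * (1 / (s - r))) summable_on UNIV"
    using a unfolding abs_coeffs_def by (rule summable_on_cmult_left)
  show "norm (a \<alpha> * vmonom_deriv y j \<alpha>) \<le> \<bar>a \<alpha>\<bar> * s ^ msize \<alpha> * (1 / (s - r))" for \<alpha>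
    using mult_left_mono[OF vmonom_deriv_bound[OF y r, of j \<alpha>], of "\<bar>a \<alpha>\<bar>"] by (simp add: abs_mult)
qed

text \<open>Indices with \<open>\<alpha> j = 0\<close> contribute nothing, and raising the j-th
  entry by one is a bijection onto the remaining ones.\<close>

lemma reindex_dcoeff:
  fixes a :: "('d::finite \<Rightarrow> nat) \<Rightarrow> real"
  assumes "((\<lambda>\<alpha>. a \<alpha> * vmonom_deriv y j \<alpha>) has_sum S) UNIV"
  shows "((\<lambda>\<beta>. dcoeff j a \<beta> * vmonom y \<beta>) has_sum S) UNIV"
proof -
  let ?h = "\<lambda>\<beta> :: 'd \<Rightarrow> nat. \<beta>(j := Suc (\<beta> j))"
  have inj: "inj ?h"
  proof (rule injI)
    fix \<beta> \<gamma> assume "?h \<beta> = ?h \<gamma>"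
    then have "(?h \<beta>) i = (?h \<gamma>) i" for i by simp
    then show "\<beta> = \<gamma>"
      by (intro ext) (metis fun_upd_apply nat.inject)
  qed
  have range: "\<alpha> \<in> range ?h" if "\<alpha> j \<noteq> 0" for \<alpha>
    using that by (intro image_eqI[of _ _ "\<alpha>(j := \<alpha> j - 1)"]) auto
  have "((\<lambda>\<alpha>. a \<alpha> * vmonom_deriv y j \<alpha>) has_sum S) (range ?h)"
    by (rule has_sum_cong_neutral[THEN iffD1, OF _ _ _ assms])
       (use range in \<open>auto simp: vmonom_deriv_def\<close>)
  then show ?thesis
    unfolding has_sum_reindex[OF inj] by (simp add: o_def dcoeff_def vmonom_deriv_def mult_ac)
qed

lemma abs_coeffs_dcoeff:
  fixes a :: "('d::finite \<Rightarrow> nat) \<Rightarrow> real"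
  assumes a: "abs_coeffs s a" and r: "0 < r" "r < s"
  shows "abs_coeffs r (dcoeff j a)"
proof -
  \<comment> \<open>At the corner of the cube every monomial equals
    \<open>r ^ msize \<alpha>\<close>, so the weighted norm of the derived coefficients is the value
    of a series to which \<open>reindex_dcoeff\<close> applies.\<close>
  define y :: "real ^ 'd" where "y = (\<chi> i. r)"
  have y: "y \<in> cube r"
    using r by (simp add: y_def cube_def)
  have mon: "vmonom y \<alpha> = r ^ msize \<alpha>" for \<alpha>
    by (simp add: vmonom_def y_def msize_def power_sum)
  then have pos: "0 \<le> vmonom_deriv y j \<alpha>" for \<alpha>
    using r by (simp add: vmonom_deriv_def)
  have "(\<lambda>\<alpha>. \<bar>a \<alpha>\<bar> * vmonom_deriv y j \<alpha>) summable_on UNIV"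
    using abs_coeffs_vmonom_deriv[OF a y r, of j] pos by (simp add: abs_mult)
  from reindex_dcoeff[OF has_sum_infsum[OF this]]
  have "(\<lambda>\<beta>. dcoeff j (\<lambda>\<alpha>. \<bar>a \<alpha>\<bar>) \<beta> * vmonom y \<beta>) summable_on UNIV"
    by (auto simp: summable_on_def)
  then show ?thesis
    unfolding abs_coeffs_def mon dcoeff_def by (simp add: abs_mult)
qed

lemma psum_dcoeff:
  fixes a :: "('d::finite \<Rightarrow> nat) \<Rightarrow> real"
  assumes "abs_coeffs s a" "y \<in> cube r" "0 < r" "r < s"
  shows "((\<lambda>\<alpha>. a \<alpha> * vmonom_deriv y j \<alpha>) has_sum psum (dcoeff j a) y) UNIV"
proof -
  have "((\<lambda>\<alpha>. a \<alpha> * vmonom_deriv y j \<alpha>) has_sum (\<Sum>\<^sub>\<infinity>\<alpha>. a \<alpha> * vmonom_deriv y j \<alpha>)) UNIV"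
    by (rule has_sum_infsum[OF abs_summable_summable[OF abs_coeffs_vmonom_deriv[OF assms]]])
  moreover from reindex_dcoeff[OF this] have "psum (dcoeff j a) y = (\<Sum>\<^sub>\<infinity>\<alpha>. a \<alpha> * vmonom_deriv y j \<alpha>)"
    unfolding psum_def by (rule infsumI)
  ultimately show ?thesis by simp
qed

lemma psum_has_sum:
  fixes a :: "('d::finite \<Rightarrow> nat) \<Rightarrow> real"
  assumes "abs_coeffs s a" "y \<in> cube s"
  shows "((\<lambda>\<alpha>. a \<alpha> * vmonom y \<alpha>) has_sum psum a y) UNIV"
  unfolding psum_def
proof (rule has_sum_infsum[OF abs_summable_summable])
  show "(\<lambda>\<alpha>. norm (a \<alpha> * vmonom y \<alpha>)) summable_on UNIV"
    by (rule Infinite_Sum.abs_summable_on_comparison_test'[OF assms(1)[unfolded abs_coeffs_def]])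
       (use abs_vmonom_le[OF assms(2)] in \<open>auto simp: abs_mult intro: mult_left_mono\<close>)
qed

lemma has_real_derivative_vmonom_line:
  fixes z w :: "real ^ 'd::finite"
  shows "((\<lambda>t. vmonom (z + t *\<^sub>R w) \<alpha>) has_real_derivative
    (\<Sum>j\<in>UNIV. w $ j * vmonom_deriv (z + t *\<^sub>R w) j \<alpha>)) (at t within S)"
proof -
  have "((\<lambda>t. \<Prod>j\<in>UNIV. (z $ j + t * w $ j) ^ \<alpha> j) has_real_derivative
      (\<Sum>j\<in>UNIV. (real (\<alpha> j) * (z $ j + t * w $ j) ^ (\<alpha> j - 1) * w $ j) *
        (\<Prod>i\<in>UNIV - {j}. (z $ i + t * w $ i) ^ \<alpha> i))) (at t)"
    by (intro has_field_derivative_prod) (auto intro!: derivative_eq_intros)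
  from has_field_derivative_at_within[OF this, of S] show ?thesis
    unfolding vmonom_deriv_eq vmonom_def by (simp add: mult_ac)
qed

lemma has_sum_finite_sum:
  fixes f :: "'j \<Rightarrow> 'a \<Rightarrow> real"
  assumes "finite J" "\<And>j. j \<in> J \<Longrightarrow> (f j has_sum S j) A"
  shows "((\<lambda>x. \<Sum>j\<in>J. f j x) has_sum (\<Sum>j\<in>J. S j)) A"
  using assms
proof (induction J rule: finite_induct)
  case (insert j J)
  then show ?case by (simp add: has_sum_add)
qed simp

text \<open>The strict inequality leaves room for a cube of smaller radius r around the point. There
  \<open>vmonom_deriv_bound\<close> dominates the derived series uniformly, so termwise
  differentiation is justified by the Weierstrass test.\<close>

lemma has_real_derivative_psum_line:
  fixes a :: "('d::finite \<Rightarrow> nat) \<Rightarrow> real"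
  assumes a: "abs_coeffs \<rho> a" and t: "\<And>i. \<bar>(z + t *\<^sub>R w) $ i\<bar> < \<rho>"
  shows "((\<lambda>t. psum a (z + t *\<^sub>R w)) has_real_derivative
    (\<Sum>j\<in>UNIV. w $ j * psum (dcoeff j a) (z + t *\<^sub>R w))) (at t)"
proof -
  define m where "m = Max (insert 0 (range (\<lambda>i. \<bar>(z + t *\<^sub>R w) $ i\<bar>)))"
  have "0 < \<rho>"
    using t[of undefined] by linarith
  then have m: "m < \<rho>" "0 \<le> m"
    unfolding m_def using t by auto
  have m3: "\<bar>(z + t *\<^sub>R w) $ i\<bar> \<le> m" for i
    unfolding m_def by (intro Max_ge) auto
  define r where "r = (m + \<rho>) / 2"
  have r: "0 < r" "r < \<rho>" "\<bar>(z + t *\<^sub>R w) $ i\<bar> < r" for i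
    using m m3[of i] \<open>0 < \<rho>\<close> by (auto simp: r_def)
  define T where "T = {t. z + t *\<^sub>R w \<in> cube r}"
  have "convex T"
  proof (rule convexI)
    fix p q u v :: real
    assume pq: "p \<in> T" "q \<in> T" and uv: "0 \<le> u" "0 \<le> v" "u + v = 1"
    have "\<bar>(z + (u *\<^sub>R p + v *\<^sub>R q) *\<^sub>R w) $ i\<bar> \<le> r" for i
    proof -
      have "(z + (u *\<^sub>R p + v *\<^sub>R q) *\<^sub>R w) $ i = (u + v) * z $ i + (u * p + v * q) * w $ i"
        using uv(3) by simp
      also have "\<dots> = u * (z $ i + p * w $ i) + v * (z $ i + q * w $ i)"
        by (simp add: algebra_simps)
      also have "\<bar>\<dots>\<bar> \<le> u * \<bar>z $ i + p * w $ i\<bar> + v * \<bar>z $ i + q * w $ i\<bar>"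
        using uv abs_triangle_ineq[of "u * (z $ i + p * w $ i)" "v * (z $ i + q * w $ i)"] by (simp add: abs_mult)
      also have "\<dots> \<le> r"
        using pq uv by (intro convex_bound_le) (auto simp: T_def cube_def)
      finally show ?thesis .
    qed
    then show "u *\<^sub>R p + v *\<^sub>R q \<in> T"
      by (simp add: T_def cube_def)
  qed
  have "t \<in> interior T"
  proof (rule interiorI)
    have "{t. \<forall>i. \<bar>(z + t *\<^sub>R w) $ i\<bar> < r} = (\<Inter>i. {t. \<bar>z $ i + t * w $ i\<bar> < r})"
      by auto
    also have "open \<dots>"
      by (intro open_INT ballI open_Collect_less continuous_intros) auto
    finally show "open {t. \<forall>i. \<bar>(z + t *\<^sub>R w) $ i\<bar> < r}" .
    show "t \<in> {t. \<forall>i. \<bar>(z + t *\<^sub>R w) $ i\<bar> < r}"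
      using r(3) by simp
    show "{t. \<forall>i. \<bar>(z + t *\<^sub>R w) $ i\<bar> < r} \<subseteq> T"
      by (auto simp: T_def cube_def intro: less_imp_le)
  qed
  \<comment> \<open>Termwise differentiation concerns sequences, so the multi-indices are enumerated
    by e; absolute convergence makes the order irrelevant.\<close>
  have "infinite (range (\<lambda>n (_ :: 'd). n :: nat))"
    by (rule range_inj_infinite) (auto simp: inj_def fun_eq_iff)
  then have inf: "infinite (UNIV :: ('d \<Rightarrow> nat) set)"
    by (rule infinite_super[OF subset_UNIV])
  define e where "e = from_nat_into (UNIV :: ('d \<Rightarrow> nat) set)"
  have e: "bij_betw e UNIV UNIV"
    unfolding e_def by (rule bij_betw_from_nat_into[OF _ inf]) simp
  let ?f = "\<lambda>n t. a (e n) * vmonom (z + t *\<^sub>R w) (e n)"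
  let ?f' = "\<lambda>n t. a (e n) * (\<Sum>j\<in>UNIV. w $ j * vmonom_deriv (z + t *\<^sub>R w) j (e n))"
  define M where "M \<alpha> = \<bar>a \<alpha>\<bar> * \<rho> ^ msize \<alpha> * ((\<Sum>j\<in>UNIV. \<bar>w $ j\<bar>) / (\<rho> - r))" for \<alpha>
  have "M summable_on UNIV"
    unfolding M_def using a[unfolded abs_coeffs_def] by (rule summable_on_cmult_left)
  then have "(\<lambda>n. M (e n)) summable_on UNIV"
    using summable_on_reindex_bij_betw[OF e] by blast
  then have M: "summable (\<lambda>n. M (e n))"
    by (rule summable_on_imp_summable)
  have bound: "norm (?f' n t) \<le> M (e n)" if "t \<in> T" for n t
  proof -
    have "\<bar>\<Sum>j\<in>UNIV. w $ j * vmonom_deriv (z + t *\<^sub>R w) j (e n)\<bar> \<le>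
        (\<Sum>j\<in>UNIV. \<bar>w $ j\<bar> * (\<rho> ^ msize (e n) / (\<rho> - r)))"
      unfolding abs_mult[symmetric]
    proof (rule order_trans[OF sum_abs sum_mono])
      show "\<bar>w $ j * vmonom_deriv (z + t *\<^sub>R w) j (e n)\<bar> \<le> \<bar>w $ j\<bar> * (\<rho> ^ msize (e n) / (\<rho> - r))" for j
        unfolding abs_mult using that
        by (intro mult_left_mono vmonom_deriv_bound r(1,2)) (auto simp: T_def)
    qed
    also have "\<dots> = (\<Sum>j\<in>UNIV. \<bar>w $ j\<bar>) * (\<rho> ^ msize (e n) / (\<rho> - r))"
      by (simp only: sum_distrib_right)
    finally have "\<bar>a (e n)\<bar> * \<bar>\<Sum>j\<in>UNIV. w $ j * vmonom_deriv (z + t *\<^sub>R w) j (e n)\<bar> \<le>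
        \<bar>a (e n)\<bar> * ((\<Sum>j\<in>UNIV. \<bar>w $ j\<bar>) * (\<rho> ^ msize (e n) / (\<rho> - r)))"
      by (intro mult_left_mono) auto
    then show ?thesis
      by (simp add: abs_mult M_def mult_ac)
  qed
  have sums_e: "(\<lambda>n. h (e n)) sums S" if "(h has_sum S) UNIV" for h :: "('d \<Rightarrow> nat) \<Rightarrow> real" and S
    using that has_sum_reindex_bij_betw[OF e, of h S] by (intro has_sum_imp_sums) auto
  have cube: "z + t *\<^sub>R w \<in> cube \<rho>" if "t \<in> T" for t
    using that r(2) by (auto simp: T_def cube_def intro: order_trans less_imp_le)
  have f_sums: "(\<lambda>n. ?f n t) sums psum a (z + t *\<^sub>R w)" if "t \<in> T" for t
    by (rule sums_e[OF psum_has_sum[OF a cube[OF that]]])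
  have t_T: "t \<in> T"
    using \<open>t \<in> interior T\<close> interior_subset by blast
  have deriv: "((\<lambda>t. \<Sum>n. ?f n t) has_real_derivative (\<Sum>n. ?f' n t)) (at t)"
  proof (rule has_field_derivative_series'(2)[OF \<open>convex T\<close>, where f = ?f and f' = ?f'])
    show "(?f n has_real_derivative ?f' n t) (at t within T)" for n t
      by (intro DERIV_cmult has_real_derivative_vmonom_line)
    show "uniformly_convergent_on T (\<lambda>n t. \<Sum>i<n. ?f' i t)"
      by (rule Weierstrass_m_test'[OF bound M])
    show "summable (\<lambda>n. ?f n t)"
      using f_sums[OF t_T] by (simp add: sums_iff)
  qed fact+
  have "((\<lambda>\<alpha>. \<Sum>j\<in>UNIV. w $ j * (a \<alpha> * vmonom_deriv (z + t *\<^sub>R w) j \<alpha>)) has_sum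
      (\<Sum>j\<in>UNIV. w $ j * psum (dcoeff j a) (z + t *\<^sub>R w))) UNIV"
    by (intro has_sum_finite_sum finite_UNIV has_sum_cmult_right psum_dcoeff[OF a _ r(1,2)])
       (use t_T in \<open>auto simp: T_def\<close>)
  then have "(\<Sum>n. ?f' n t) = (\<Sum>j\<in>UNIV. w $ j * psum (dcoeff j a) (z + t *\<^sub>R w))"
    by (intro sums_unique[symmetric] sums_e) (simp add: sum_distrib_left mult_ac)
  with deriv have "((\<lambda>t. \<Sum>n. ?f n t) has_real_derivative
      (\<Sum>j\<in>UNIV. w $ j * psum (dcoeff j a) (z + t *\<^sub>R w))) (at t)"
    by simp
  moreover have "eventually (\<lambda>t. psum a (z + t *\<^sub>R w) = (\<Sum>n. ?f n t)) (nhds t)"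
    using eventually_nhds_in_open[OF open_interior \<open>t \<in> interior T\<close>]
  proof eventually_elim
    case (elim t)
    then have "t \<in> T" using interior_subset by blast
    from f_sums[OF this] show ?case by (simp add: sums_iff)
  qed
  ultimately show ?thesis
    by (subst DERIV_cong_ev[OF refl _ refl]) auto
qed

lemma psum_zero:
  fixes a :: "('d::finite \<Rightarrow> nat) \<Rightarrow> real"
  shows "psum a 0 = a (\<lambda>_. 0)"
proof -
  have "vmonom (0 :: real ^ 'd) \<alpha> = 0" if "\<alpha> \<noteq> (\<lambda>_. 0)" for \<alpha>
    using that by (auto simp: vmonom_def fun_eq_iff)
  then have "((\<lambda>\<alpha>. a \<alpha> * vmonom 0 \<alpha>) has_sum a (\<lambda>_. 0)) UNIV"
    by (intro has_sum_finite_neutralI[of "{\<lambda>_. 0}"]) auto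
  then show ?thesis
    unfolding psum_def by (rule infsumI)
qed

lemma dcoeff_commute: "dcoeff i (dcoeff j a) (\<lambda>_. 0) = dcoeff j (dcoeff i a) (\<lambda>_. 0)"
  by (cases "i = j") (auto simp: dcoeff_def fun_upd_twist)

section \<open>Partial derivatives and the quadratic form of the Hessian\<close>

lemma partial_deriv_psum:
  fixes a :: "('d::finite \<Rightarrow> nat) \<Rightarrow> real"
  assumes a: "abs_coeffs \<rho> a" and g: "\<And>y. (\<And>i. \<bar>y $ i\<bar> < \<rho>) \<Longrightarrow> g (x + y) = psum a y"
    and y: "\<And>i. \<bar>y $ i\<bar> < \<rho>"
  shows "partial_deriv j g (x + y) = psum (dcoeff j a) y"
proof -
  have "open {t. \<forall>i. \<bar>(y + t *\<^sub>R axis j 1) $ i\<bar> < \<rho>}"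
  proof -
    have "{t. \<forall>i. \<bar>(y + t *\<^sub>R axis j 1) $ i\<bar> < \<rho>} = (\<Inter>i. {t. \<bar>y $ i + t * axis j 1 $ i\<bar> < \<rho>})"
      by auto
    also have "open \<dots>"
      by (intro open_INT ballI open_Collect_less continuous_intros) auto
    finally show ?thesis .
  qed
  from eventually_nhds_in_open[OF this, of 0]
  have "\<forall>\<^sub>F t in nhds 0. g (x + y + t *\<^sub>R axis j 1) = psum a (y + t *\<^sub>R axis j 1)"
    using y by (auto elim!: eventually_mono simp: add.assoc intro!: g)
  moreover have "((\<lambda>t. psum a (y + t *\<^sub>R axis j 1)) has_real_derivative
      (\<Sum>i\<in>UNIV. axis j 1 $ i * psum (dcoeff i a) (y + 0 *\<^sub>R axis j 1))) (at 0)"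
    by (rule has_real_derivative_psum_line[OF a]) (use y in simp)
  moreover have "(\<Sum>i\<in>UNIV. axis j 1 $ i * psum (dcoeff i a) (y + 0 *\<^sub>R axis j 1)) = psum (dcoeff j a) y"
    by (simp add: axis_def if_distrib[of "\<lambda>c. c * _"] cong: if_cong)
  ultimately have "((\<lambda>t. g (x + y + t *\<^sub>R axis j 1)) has_real_derivative psum (dcoeff j a) y) (at 0)"
    by (subst DERIV_cong_ev[OF refl _ refl]) auto
  then show ?thesis
    unfolding partial_deriv_def by (rule DERIV_imp_deriv)
qed

lemma hessian_psum:
  fixes a :: "('d::finite \<Rightarrow> nat) \<Rightarrow> real"
  assumes \<rho>: "0 < \<rho>" and a: "abs_coeffs \<rho> a" and g: "\<And>y. (\<And>i. \<bar>y $ i\<bar> < \<rho>) \<Longrightarrow> g (x + y) = psum a y"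
  shows "hessian g x $ i $ j = psum (dcoeff i (dcoeff j a)) 0"
proof -
  have "partial_deriv i (partial_deriv j g) (x + 0) = psum (dcoeff i (dcoeff j a)) 0"
  proof (rule partial_deriv_psum)
    show "abs_coeffs (\<rho> / 2) (dcoeff j a)"
      by (rule abs_coeffs_dcoeff[OF a]) (use \<rho> in auto)
    show "partial_deriv j g (x + y) = psum (dcoeff j a) y" if "\<And>i. \<bar>y $ i\<bar> < \<rho> / 2" for y
      by (rule partial_deriv_psum[OF a g]) (use that \<rho> in \<open>auto intro: less_trans[OF that]\<close>)
  qed (use \<rho> in auto)
  then show ?thesis by (simp add: hessian_def)
qed

text \<open>Symmetric differences are the form in which root equations at opposite points can be
  compared. Of the first-order limit only the existence is recorded, as the spanning argument for
  blocks works with any value c. The second-order limit follows from one application of l'Hospital's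
  rule and the derivative of \<phi> at 0.\<close>

lemma hessian_symmetric_differences:
  fixes f g :: "real ^ 'd::finite \<Rightarrow> real"
  assumes \<rho>: "0 < \<rho>" and f: "series_bound \<rho> f B" and g: "\<And>y. y \<in> cube \<rho> \<Longrightarrow> g (x + y) = f y"
  shows "transpose (hessian g x) = hessian g x"
    and "\<exists>c. ((\<lambda>t. (g (x + t *\<^sub>R v) - g (x - t *\<^sub>R v)) / (2 * t)) \<longlongrightarrow> c) (at_right 0)"
    and "((\<lambda>t. (g (x + t *\<^sub>R v) + g (x - t *\<^sub>R v) - 2 * g x) / t\<^sup>2) \<longlongrightarrow> v \<bullet> (hessian g x *v v)) (at_right 0)"
proof -
  obtain a where "abs_coeffs \<rho> a"
      and fa: "\<And>y. y \<in> cube \<rho> \<Longrightarrow> ((\<lambda>\<alpha>. a \<alpha> * vmonom y \<alpha>) has_sum f y) UNIV"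
    using f unfolding series_bound_def abs_coeffs_def by blast
  note a = this(1)
  have ga: "g (x + y) = psum a y" if "\<And>i. \<bar>y $ i\<bar> < \<rho>" for y
  proof -
    have "y \<in> cube \<rho>" using that by (auto simp: cube_def intro: less_imp_le)
    from g[OF this] fa[OF this] show ?thesis by (simp add: psum_def infsumI)
  qed
  have hess: "hessian g x $ i $ j = dcoeff i (dcoeff j a) (\<lambda>_. 0)" for i j
    using hessian_psum[OF \<rho> a ga] by (simp add: psum_zero)
  show "transpose (hessian g x) = hessian g x"
    by (simp add: vec_eq_iff transpose_def hess dcoeff_commute)
  define \<phi> where "\<phi> t = (\<Sum>j\<in>UNIV. v $ j * psum (dcoeff j a) (0 + t *\<^sub>R v))" for t
  obtain \<delta> where \<delta>: "0 < \<delta>" "\<And>t i. \<bar>t\<bar> < \<delta> \<Longrightarrow> \<bar>(0 + t *\<^sub>R v) $ i\<bar> < \<rho> / 2"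
  proof
    show "0 < \<rho> / 2 / (norm v + 1)"
      using \<rho> by (simp add: add_nonneg_pos)
    show "\<bar>(0 + t *\<^sub>R v) $ i\<bar> < \<rho> / 2" if "\<bar>t\<bar> < \<rho> / 2 / (norm v + 1)" for t i
    proof -
      have "\<bar>(0 + t *\<^sub>R v) $ i\<bar> \<le> \<bar>t\<bar> * (norm v + 1)"
        using component_le_norm_cart[of v i] by (auto simp: abs_mult intro!: mult_left_mono)
      also have "\<dots> < \<rho> / 2"
        using that by (subst (asm) pos_less_divide_eq) (auto simp: add_nonneg_pos)
      finally show ?thesis .
    qed
  qed
  have \<delta>': "\<bar>(0 + t *\<^sub>R v) $ i\<bar> < \<rho>" if "\<bar>t\<bar> < \<delta>" for t i
    using \<delta>(2)[OF that, of i] \<rho> by linarith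
  have D1: "((\<lambda>t. psum a (0 + t *\<^sub>R v)) has_real_derivative \<phi> t) (at t)" if "\<bar>t\<bar> < \<delta>" for t
    unfolding \<phi>_def
    by (rule has_real_derivative_psum_line[OF a \<delta>'[OF that]])
  have gt: "g (x + t *\<^sub>R v) = psum a (0 + t *\<^sub>R v)" if "\<bar>t\<bar> < \<delta>" for t
    using ga[OF \<delta>'[OF that]] by simp
  have D1': "((\<lambda>t. g (x + t *\<^sub>R v)) has_real_derivative \<phi> t) (at t)" if "\<bar>t\<bar> < \<delta>" for t
  proof -
    have "t \<in> {-\<delta><..<\<delta>}" using that by auto
    from eventually_nhds_in_open[OF open_greaterThanLessThan this]
    have "\<forall>\<^sub>F t in nhds t. g (x + t *\<^sub>R v) = psum a (0 + t *\<^sub>R v)"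
    proof eventually_elim
      case (elim t)
      then show ?case by (intro gt) auto
    qed
    then show ?thesis
      using D1[OF that] by (subst DERIV_cong_ev[OF refl _ refl]) auto
  qed
  have D1'': "((\<lambda>t. g (x - t *\<^sub>R v)) has_real_derivative - \<phi> (- t)) (at t)" if "\<bar>t\<bar> < \<delta>" for t
  proof -
    have "(uminus has_real_derivative - 1) (at t)"
      by (auto intro!: derivative_eq_intros)
    from DERIV_chain2[OF D1' this] that show ?thesis by simp
  qed
  have D2: "(\<phi> has_real_derivative v \<bullet> (hessian g x *v v)) (at 0)"
  proof -
    have "(\<phi> has_real_derivative
        (\<Sum>j\<in>UNIV. v $ j * (\<Sum>i\<in>UNIV. v $ i * psum (dcoeff i (dcoeff j a)) (0 + 0 *\<^sub>R v)))) (at 0)"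
      unfolding \<phi>_def [abs_def]
      by (intro DERIV_sum DERIV_cmult has_real_derivative_psum_line[OF abs_coeffs_dcoeff[OF a, of "\<rho> / 2"]])
         (use \<rho> in auto)
    also have "(\<Sum>j\<in>UNIV. v $ j * (\<Sum>i\<in>UNIV. v $ i * psum (dcoeff i (dcoeff j a)) (0 + 0 *\<^sub>R v))) =
        (\<Sum>j\<in>UNIV. v $ j * (\<Sum>i\<in>UNIV. v $ i * dcoeff j (dcoeff i a) (\<lambda>_. 0)))"
      by (intro sum.cong refl) (simp add: psum_zero dcoeff_commute)
    also have "\<dots> = v \<bullet> (hessian g x *v v)"
      by (simp add: inner_vec_def matrix_vector_mult_def hess mult.commute)
    finally show ?thesis .
  qed
  have small: "\<forall>\<^sub>F t in at_right 0. 0 < t \<and> \<bar>t\<bar> < \<delta>"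
    using eventually_at_right_less[of "0 :: real"] eventually_at_right_real[OF \<delta>(1)] by eventually_elim auto
  show "\<exists>c. ((\<lambda>t. (g (x + t *\<^sub>R v) - g (x - t *\<^sub>R v)) / (2 * t)) \<longlongrightarrow> c) (at_right 0)"
  proof
    have "((\<lambda>t. g (x + t *\<^sub>R v) - g (x - t *\<^sub>R v)) has_real_derivative \<phi> 0 - - \<phi> (- 0)) (at 0)"
      by (intro DERIV_diff D1' D1'') (use \<delta> in auto)
    then have "((\<lambda>t. (g (x + t *\<^sub>R v) - g (x - t *\<^sub>R v)) / t) \<longlongrightarrow> \<phi> 0 + \<phi> 0) (at 0)"
      by (simp add: has_field_derivative_iff)
    then have "((\<lambda>t. (g (x + t *\<^sub>R v) - g (x - t *\<^sub>R v)) / t / 2) \<longlongrightarrow> (\<phi> 0 + \<phi> 0) / 2) (at_right 0)"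
      by (intro tendsto_divide tendsto_const) (auto intro: tendsto_within_subset)
    then show "((\<lambda>t. (g (x + t *\<^sub>R v) - g (x - t *\<^sub>R v)) / (2 * t)) \<longlongrightarrow> \<phi> 0) (at_right 0)"
      by (simp add: mult.commute)
  qed
  show "((\<lambda>t. (g (x + t *\<^sub>R v) + g (x - t *\<^sub>R v) - 2 * g x) / t\<^sup>2) \<longlongrightarrow> v \<bullet> (hessian g x *v v)) (at_right 0)"
  proof (rule lhopital_right_0[where f' = "\<lambda>t. \<phi> t - \<phi> (- t)" and g' = "\<lambda>t. 2 * t"])
    have "isCont (\<lambda>t. g (x + t *\<^sub>R v)) 0" "isCont (\<lambda>t. g (x - t *\<^sub>R v)) 0"
      using DERIV_isCont[OF D1'[of 0]] DERIV_isCont[OF D1''[of 0]] \<delta> by auto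
    then have "((\<lambda>t. g (x + t *\<^sub>R v) + g (x - t *\<^sub>R v) - 2 * g x) \<longlongrightarrow> g x + g x - 2 * g x) (at_right 0)"
      by (intro tendsto_intros) (auto simp: isCont_def intro: tendsto_within_subset)
    then show "((\<lambda>t. g (x + t *\<^sub>R v) + g (x - t *\<^sub>R v) - 2 * g x) \<longlongrightarrow> 0) (at_right 0)"
      by simp
    have "((\<lambda>t :: real. t\<^sup>2) \<longlongrightarrow> 0\<^sup>2) (at_right 0)"
      by (intro tendsto_intros)
    then show "((\<lambda>t :: real. t\<^sup>2) \<longlongrightarrow> 0) (at_right 0)" by simp
    show "\<forall>\<^sub>F t in at_right 0. t\<^sup>2 \<noteq> (0 :: real)" "\<forall>\<^sub>F t in at_right 0. 2 * t \<noteq> (0 :: real)"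
      using small by (auto elim: eventually_mono)
    show "\<forall>\<^sub>F t in at_right 0. ((\<lambda>t. g (x + t *\<^sub>R v) + g (x - t *\<^sub>R v) - 2 * g x) has_real_derivative
        \<phi> t - \<phi> (- t)) (at t)"
      using small
    proof eventually_elim
      case (elim t)
      then have t: "\<bar>t\<bar> < \<delta>" ..
      show ?case
        using DERIV_diff[OF DERIV_add[OF D1'[OF t] D1''[OF t]] DERIV_const[of "2 * g x"]] by simp
    qed
    show "\<forall>\<^sub>F t in at_right 0. ((\<lambda>t :: real. t\<^sup>2) has_real_derivative 2 * t) (at t)"
      by (auto intro!: always_eventually derivative_eq_intros)
    let ?H = "v \<bullet> (hessian g x *v v)"
    have l: "((\<lambda>t. (\<phi> t - \<phi> 0) / t) \<longlongrightarrow> ?H) (at 0)"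
      using D2 by (simp add: has_field_derivative_iff)
    have "((\<lambda>t. (\<phi> (- t) - \<phi> 0) / - t) \<longlongrightarrow> ?H) (at 0)"
    proof (rule filterlim_compose[OF l])
      have "(uminus \<longlongrightarrow> - 0) (at (0 :: real))"
        by (intro tendsto_intros)
      then show "filterlim uminus (at 0) (at (0 :: real))"
        by (auto simp: filterlim_at eventually_at_filter)
    qed
    with l have "((\<lambda>t. ((\<phi> t - \<phi> 0) / t + (\<phi> (- t) - \<phi> 0) / - t) / 2) \<longlongrightarrow> (?H + ?H) / 2) (at_right 0)"
      by (intro tendsto_intros) (auto intro: tendsto_within_subset)
    then have "((\<lambda>t. ((\<phi> t - \<phi> 0) / t + (\<phi> (- t) - \<phi> 0) / - t) / 2) \<longlongrightarrow> ?H) (at_right 0)"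
      by simp
    then show "((\<lambda>t. (\<phi> t - \<phi> (- t)) / (2 * t)) \<longlongrightarrow> ?H) (at_right 0)"
    proof (rule Lim_transform_eventually)
      show "\<forall>\<^sub>F t in at_right 0. ((\<phi> t - \<phi> 0) / t + (\<phi> (- t) - \<phi> 0) / - t) / 2 = (\<phi> t - \<phi> (- t)) / (2 * t)"
        using small by eventually_elim (simp add: field_simps)
    qed
  qed
qed

text \<open>\<open>cosh z - 1\<close> is half the square of
  \<open>exp (z / 2) - exp (- z / 2)\<close>, whose modulus is at least that of
  \<open>z / 2\<close>; this crude linear bound is the origin of 1/8.\<close>

lemma exp_add_exp_minus_ge: "1 + z\<^sup>2 / 8 \<le> (exp z + exp (- z)) / 2" for z :: real
proof -
  have *: "z / 2 \<le> exp (z / 2) - exp (- z / 2)" if "0 \<le> z" for z :: real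
  proof -
    have "exp (- z / 2) \<le> 1"
      using that by simp
    with exp_ge_add_one_self[of "z / 2"] show ?thesis by linarith
  qed
  have "(z / 2)\<^sup>2 \<le> (exp (z / 2) - exp (- z / 2))\<^sup>2"
  proof (cases "0 \<le> z")
    case True
    then show ?thesis by (intro power_mono *) auto
  next
    case False
    then have "(- z / 2)\<^sup>2 \<le> (exp (- z / 2) - exp (- (- z) / 2))\<^sup>2"
      by (intro power_mono *) auto
    then show ?thesis by (simp add: power2_commute)
  qed
  also have "\<dots> = exp z + exp (- z) - 2"
  proof -
    have "(exp (z / 2))\<^sup>2 = exp z" "(exp (- z / 2))\<^sup>2 = exp (- z)" "exp (z / 2) * exp (- z / 2) = 1"
      by (simp_all flip: exp_double exp_add)
    then show ?thesis by (simp only: power2_diff mult.assoc)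
  qed
  finally show ?thesis by (simp add: power_divide)
qed

section \<open>Convexity of the implicit root\<close>

context tilted_increments
begin

text \<open>With e the mean of p and q, the average of the two equations says that the sum of
  \<open>w j * exp (- e * k j) * cosh (z j)\<close> is 1. Using
  \<open>exp (- e * k j) \<ge> 1 - e * k j\<close> for all blocks, and the quadratic gain of cosh
  only for the block i, bounds this sum below by \<open>1 - e * mean_time\<close> plus the
  gain.\<close>

lemma even_part_lower_bound:
  assumes p: "((\<lambda>i. w i * exp (a \<bullet> x i - p * k i)) has_sum 1) I"
    and q: "((\<lambda>i. w i * exp (- a \<bullet> x i - q * k i)) has_sum 1) I"
    and i: "i \<in> I"
  shows "w i / 8 * exp (- ((p + q) / 2) * k i) * (a \<bullet> x i - (p - q) / 2 * k i)\<^sup>2 \<le> mean_time * ((p + q) / 2)"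
proof -
  define e where "e = (p + q) / 2"
  define z where "z i = a \<bullet> x i - (p - q) / 2 * k i" for i
  let ?T = "\<lambda>j. w j / 8 * exp (- e * k j) * (z j)\<^sup>2"
  let ?lhs = "\<lambda>j. w j + - (w j * k j * e) + (if j = i then ?T j else 0)"
  let ?rhs = "\<lambda>j. (w j * exp (a \<bullet> x j - p * k j) + w j * exp (- a \<bullet> x j - q * k j)) / 2"
  have "((\<lambda>j. if j = i then ?T j else 0) has_sum ?T i) I"
    using i by (intro has_sum_finite_neutralI[of "{i}"]) auto
  then have lhs: "(?lhs has_sum 1 + - (mean_time * e) + ?T i) I"
    by (intro has_sum_add w_sum has_sum_uminusI has_sum_cmult_left mean_has_sum)
  have rhs: "(?rhs has_sum (1 + 1) / 2) I"
    by (intro has_sum_divide_const has_sum_add p q)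
  have "?lhs j \<le> ?rhs j" if j: "j \<in> I" for j
  proof -
    have "a \<bullet> x j - p * k j = - e * k j + z j" "- a \<bullet> x j - q * k j = - e * k j + - z j"
      by (simp_all add: e_def z_def field_simps)
    then have r: "?rhs j = w j * exp (- e * k j) * ((exp (z j) + exp (- z j)) / 2)"
      by (simp only: exp_add) (simp add: field_simps)
    have "w j * exp (- e * k j) * (1 + (z j)\<^sup>2 / 8) \<le> ?rhs j"
      unfolding r by (intro mult_left_mono exp_add_exp_minus_ge mult_nonneg_nonneg w_nonneg j) auto
    moreover have "w j * (1 + - e * k j) \<le> w j * exp (- e * k j)"
      by (intro mult_left_mono exp_ge_add_one_self w_nonneg j)
    moreover have "0 \<le> ?T j"
      using w_nonneg[OF j] by simp
    ultimately show ?thesis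
      by (auto simp: algebra_simps)
  qed
  from has_sum_mono[OF lhs rhs this] show ?thesis
    by (simp add: e_def z_def)
qed

text \<open>The function g enters through the hypothesis that every small solution of the equation
  is one of its values, so it agrees with the implicit function near \<theta> and inherits the
  expansion. The third claim is \<open>even_part_lower_bound\<close> at
  \<open>t *\<^sub>R v\<close>, divided by \<open>t\<^sup>2\<close>, in the limit t \<rightarrow>
  0.\<close>

theorem implicit_root_analytic:
  fixes g :: "real ^ 'd \<Rightarrow> real"
  assumes "0 < \<sigma>\<^sub>0"
    and root: "\<And>y r. y \<in> cube \<sigma>\<^sub>0 \<Longrightarrow> \<bar>r\<bar> \<le> \<sigma>\<^sub>0 \<Longrightarrow>
      ((\<lambda>i. w i * exp (y \<bullet> x i - r * k i)) has_sum 1) I \<Longrightarrow> g (\<theta> + y) = r\<^sub>0 + r"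
  shows "real_analytic_at g \<theta>"
    and "transpose (hessian g \<theta>) = hessian g \<theta>"
    and "\<exists>c. \<forall>i\<in>I. w i / 8 * (v \<bullet> x i - c * k i)\<^sup>2 \<le> mean_time / 2 * (v \<bullet> (hessian g \<theta> *v v))"
proof -
  obtain \<rho> \<sigma> s where \<rho>: "0 < \<rho>" "\<rho> \<le> \<sigma>" "\<sigma> \<le> \<sigma>\<^sub>0" and s: "series_bound \<rho> s \<sigma>"
    and s_root: "\<And>y. y \<in> cube \<rho> \<Longrightarrow> ((\<lambda>i. w i * exp (y \<bullet> x i - s y * k i)) has_sum 1) I"
    using implicit_function[OF assms(1)] by metis
  have gs: "g (\<theta> + y) = r\<^sub>0 + s y" if y: "y \<in> cube \<rho>" for y
  proof (rule root[OF _ _ s_root[OF y]])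
    show "y \<in> cube \<sigma>\<^sub>0"
      using y \<rho> by (auto simp: cube_def intro: order_trans)
    show "\<bar>s y\<bar> \<le> \<sigma>\<^sub>0"
      using series_bound_abs_le[OF s y] \<rho> by simp
  qed
  have g0: "g \<theta> = r\<^sub>0"
    using root[of 0 0] w_sum assms(1) by (simp add: cube_def)
  have sb: "series_bound \<rho> (\<lambda>y. r\<^sub>0 + s y) (\<bar>r\<^sub>0\<bar> + \<sigma>)"
    by (intro series_bound_add series_bound_const \<rho> s)
  show "real_analytic_at g \<theta>"
    by (rule series_bound_real_analytic[OF \<rho>(1) sb gs])
  note hess = hessian_symmetric_differences[OF \<rho>(1) sb gs]
  show "transpose (hessian g \<theta>) = hessian g \<theta>"
    by (rule hess(1))
  let ?H = "v \<bullet> (hessian g \<theta> *v v)"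
  obtain c where c: "((\<lambda>t. (g (\<theta> + t *\<^sub>R v) - g (\<theta> - t *\<^sub>R v)) / (2 * t)) \<longlongrightarrow> c) (at_right 0)"
    using hess(2) by blast
  define \<delta> where "\<delta> = \<rho> / (norm v + 1)"
  have \<delta>: "0 < \<delta>"
    using \<rho>(1) by (simp add: \<delta>_def add_nonneg_pos)
  have cube: "t *\<^sub>R v \<in> cube \<rho>" if "\<bar>t\<bar> < \<delta>" for t
  proof -
    have "\<bar>(t *\<^sub>R v) $ i\<bar> \<le> \<bar>t\<bar> * (norm v + 1)" for i
      using component_le_norm_cart[of v i] by (auto simp: abs_mult intro!: mult_left_mono)
    also have "\<bar>t\<bar> * (norm v + 1) \<le> \<rho>"
      using that unfolding \<delta>_def by (subst (asm) pos_less_divide_eq) (auto simp: add_nonneg_pos)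
    finally show ?thesis by (simp add: cube_def)
  qed
  have small: "\<forall>\<^sub>F t in at_right 0. 0 < t \<and> \<bar>t\<bar> < \<delta>"
    using eventually_at_right_less[of "0 :: real"] eventually_at_right_real[OF \<delta>] by eventually_elim auto
  let ?E = "\<lambda>t. (g (\<theta> + t *\<^sub>R v) + g (\<theta> - t *\<^sub>R v) - 2 * g \<theta>) / t\<^sup>2"
  let ?O = "\<lambda>t. (g (\<theta> + t *\<^sub>R v) - g (\<theta> - t *\<^sub>R v)) / (2 * t)"
  have "w i / 8 * (v \<bullet> x i - c * k i)\<^sup>2 \<le> mean_time / 2 * ?H" if i: "i \<in> I" for i
  proof (rule tendsto_le[OF trivial_limit_at_right_real])
    show "((\<lambda>t. mean_time / 2 * ?E t) \<longlongrightarrow> mean_time / 2 * ?H) (at_right 0)"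
      by (intro tendsto_intros hess(3))
    have "((\<lambda>t. w i / 8 * exp (- (?E t * t\<^sup>2 / 2) * k i) * (v \<bullet> x i - ?O t * k i)\<^sup>2) \<longlongrightarrow>
        w i / 8 * exp (- (?H * 0\<^sup>2 / 2) * k i) * (v \<bullet> x i - c * k i)\<^sup>2) (at_right 0)"
      by (intro tendsto_intros hess(3) c) auto
    then show "((\<lambda>t. w i / 8 * exp (- (?E t * t\<^sup>2 / 2) * k i) * (v \<bullet> x i - ?O t * k i)\<^sup>2) \<longlongrightarrow>
        w i / 8 * (v \<bullet> x i - c * k i)\<^sup>2) (at_right 0)"
      by simp
    show "\<forall>\<^sub>F t in at_right 0. w i / 8 * exp (- (?E t * t\<^sup>2 / 2) * k i) * (v \<bullet> x i - ?O t * k i)\<^sup>2 \<le> mean_time / 2 * ?E t"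
      using small
    proof eventually_elim
      case (elim t)
      then have t: "0 < t" "t *\<^sub>R v \<in> cube \<rho>" "- (t *\<^sub>R v) \<in> cube \<rho>"
        using cube[of t] cube[of "- t"] by auto
      define p q where "p = s (t *\<^sub>R v)" and "q = s (- (t *\<^sub>R v))"
      have gp: "g (\<theta> + t *\<^sub>R v) = r\<^sub>0 + p" and gq: "g (\<theta> - t *\<^sub>R v) = r\<^sub>0 + q"
        using gs[OF t(2)] gs[OF t(3)] by (simp_all add: p_def q_def)
      have E: "?E t = (p + q) / t\<^sup>2" and O: "?O t = (p - q) / 2 / t"
        unfolding gp gq g0 by (simp_all add: mult.commute)
      have "w i / 8 * exp (- ((p + q) / 2) * k i) * (t *\<^sub>R v \<bullet> x i - (p - q) / 2 * k i)\<^sup>2 \<le> mean_time * ((p + q) / 2)"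
        using even_part_lower_bound[OF s_root[OF t(2)] s_root[OF t(3)] i] by (simp only: p_def q_def)
      moreover define e o' where "e = ?E t" and "o' = ?O t"
      moreover have "t *\<^sub>R v \<bullet> x i - (p - q) / 2 * k i = t * (v \<bullet> x i - o' * k i)"
        unfolding o'_def O using t(1) by (simp add: field_simps)
      moreover have "(p + q) / 2 = e * t\<^sup>2 / 2"
        unfolding e_def E using t(1) by simp
      ultimately have "w i / 8 * exp (- (e * t\<^sup>2 / 2) * k i) * (t * (v \<bullet> x i - o' * k i))\<^sup>2 \<le> mean_time * (e * t\<^sup>2 / 2)"
        by (simp only:)
      then have "(w i / 8 * exp (- (e * t\<^sup>2 / 2) * k i) * (v \<bullet> x i - o' * k i)\<^sup>2) * t\<^sup>2 \<le> (mean_time / 2 * e) * t\<^sup>2"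
        by (simp add: power_mult_distrib mult_ac)
      then show ?case
        unfolding e_def o'_def by (rule mult_right_le_imp_le) (use t(1) in simp)
    qed
  qed
  then show "\<exists>c. \<forall>i\<in>I. w i / 8 * (v \<bullet> x i - c * k i)\<^sup>2 \<le> mean_time / 2 * ?H"
    by blast
qed

end


section \<open>Growth of renewal sequences\<close>

text \<open>As j starts at 1, induction bounds each \<open>z (n - j)\<close> by
  \<open>C * n\<close>, and a total mass of at most 1 leaves room for one more C. Linear growth
  suffices because only exponential rates matter.\<close>

lemma renewal_upper_bound:
  fixes z f :: "nat \<Rightarrow> real"
  assumes z: "\<And>n. z n \<le> C + (\<Sum>j=1..n. f j * z (n - j))"
    and f: "\<And>j. 0 \<le> f j" "\<And>n. (\<Sum>j=1..n. f j) \<le> 1" and C: "0 \<le> C"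
  shows "z n \<le> C * (real n + 1)"
proof (induction n rule: less_induct)
  case (less n)
  show ?case
  proof (cases "n = 0")
    case True
    then show ?thesis using z[of 0] by simp
  next
    case False
    have "(\<Sum>j=1..n. f j * z (n - j)) \<le> (\<Sum>j=1..n. f j * (C * real n))"
    proof (intro sum_mono mult_left_mono f)
      fix j assume j: "j \<in> {1..n}"
      then have "z (n - j) \<le> C * (real (n - j) + 1)"
        by (intro less) auto
      also have "\<dots> \<le> C * real n"
        using j C by (intro mult_left_mono) (auto simp: of_nat_diff)
      finally show "z (n - j) \<le> C * real n" .
    qed
    also have "\<dots> = (\<Sum>j=1..n. f j) * (C * real n)"
      by (simp only: sum_distrib_right)
    also have "\<dots> \<le> 1 * (C * real n)"
      using C by (intro mult_right_mono f) auto
    finally show ?thesis using z[of n] by (simp add: algebra_simps)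
  qed
qed

text \<open>Tilting by \<open>exp (\<epsilon> * j)\<close> multiplies \<open>f 1\<close> by
  \<open>exp \<epsilon>\<close>, and this gain outweighs the tail beyond a large J. The truncated
  tilted sequence has mass at least 1, which makes \<open>c * exp (- \<epsilon> * n)\<close> a
  subsolution of the renewal inequality.\<close>

lemma renewal_lower_bound:
  fixes z f :: "nat \<Rightarrow> real"
  assumes z: "\<And>n. (\<Sum>j=1..n. f j * z (n - j)) \<le> z n" and z0: "0 < z 0" and z_nonneg: "\<And>n. 0 \<le> z n"
    and f: "\<And>j. 0 \<le> f j" "0 < f 1" "f 0 = 0" "f sums 1" and \<epsilon>: "0 < \<epsilon>"
  shows "\<exists>c>0. \<forall>n. c * exp (- \<epsilon> * real n) \<le> z n"
proof -
  have "0 < f 1 * (exp \<epsilon> - 1)"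
    using f(2) \<epsilon> by simp
  then have "1 - f 1 * (exp \<epsilon> - 1) < 1" by simp
  from order_tendstoD(1)[OF f(4)[unfolded sums_def] this]
  obtain J\<^sub>0 where "\<And>J. J\<^sub>0 \<le> J \<Longrightarrow> 1 - f 1 * (exp \<epsilon> - 1) < (\<Sum>j<J. f j)"
    by (auto simp: eventually_sequentially)
  then obtain J where J: "1 - f 1 * (exp \<epsilon> - 1) < (\<Sum>j<Suc (Suc J). f j)"
    by (meson le_SucI order_refl)
  have "(\<Sum>j<Suc (Suc J). f j + (if j = 1 then f 1 * (exp \<epsilon> - 1) else 0)) \<le> (\<Sum>j<Suc (Suc J). f j * exp (\<epsilon> * real j))"
  proof (rule sum_mono)
    show "f j + (if j = 1 then f 1 * (exp \<epsilon> - 1) else 0) \<le> f j * exp (\<epsilon> * real j)" for j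
      using f(1)[of j] \<epsilon> mult_left_mono[of 1 "exp (\<epsilon> * real j)" "f j"] by (auto simp: algebra_simps)
  qed
  then have J1: "1 \<le> (\<Sum>j<Suc (Suc J). f j * exp (\<epsilon> * real j))"
    using J by (simp only: sum.distrib sum.delta finite_lessThan) simp
  \<comment> \<open>Positivity of \<open>f 1\<close> propagates positivity of z step by step, so the
    minimum c over the initial segment is positive.\<close>
  have pos: "0 < z n" for n
  proof (induction n)
    case (Suc n)
    have "f 1 * z n \<le> (\<Sum>j=1..Suc n. f j * z (Suc n - j))"
      using member_le_sum[of 1 "{1..Suc n}" "\<lambda>j. f j * z (Suc n - j)"] f z_nonneg by simp
    with z[of "Suc n"] mult_pos_pos[OF f(2) Suc] show ?case by linarith
  qed (rule z0)
  define c where "c = Min ((\<lambda>n. z n * exp (\<epsilon> * real n)) ` {..Suc J})"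
  have "0 < c"
    unfolding c_def using pos by (subst Min_gr_iff) auto
  moreover have "c * exp (- \<epsilon> * real n) \<le> z n" for n
  proof (induction n rule: less_induct)
    case (less n)
    show ?case
    proof (cases "n \<le> Suc J")
      case True
      then have "c \<le> z n * exp (\<epsilon> * real n)"
        unfolding c_def by (intro Min_le) auto
      then have "c * exp (- \<epsilon> * real n) \<le> z n * exp (\<epsilon> * real n) * exp (- \<epsilon> * real n)"
        by (intro mult_right_mono) auto
      also have "\<dots> = z n"
        by (simp add: mult.assoc flip: exp_add)
      finally show ?thesis .
    next
      case False
      have "c * exp (- \<epsilon> * real n) \<le> (\<Sum>j<Suc (Suc J). f j * exp (\<epsilon> * real j)) * (c * exp (- \<epsilon> * real n))"
        using mult_right_mono[OF J1, of "c * exp (- \<epsilon> * real n)"] \<open>0 < c\<close> by simp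
      also have "\<dots> = (\<Sum>j<Suc (Suc J). f j * (c * exp (- \<epsilon> * real (n - j))))"
        unfolding sum_distrib_right using False
        by (intro sum.cong refl) (auto simp: of_nat_diff algebra_simps simp flip: exp_add)
      also have "\<dots> = (\<Sum>j=1..Suc J. f j * (c * exp (- \<epsilon> * real (n - j))))"
        using f(3) by (intro sum.mono_neutral_right) (auto simp: not_less_eq_eq)
      also have "\<dots> \<le> (\<Sum>j=1..Suc J. f j * z (n - j))"
        using False by (intro sum_mono mult_left_mono less f) auto
      also have "\<dots> \<le> (\<Sum>j=1..n. f j * z (n - j))"
        using False f z_nonneg by (intro sum_mono2) auto
      also have "\<dots> \<le> z n" by (rule z)
      finally show ?thesis .
    qed
  qed
  ultimately show ?thesis by blast
qed

lemma square_le_exp: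
  assumes "0 < \<epsilon>"
  shows "\<exists>K. \<forall>n. (real n + 1)\<^sup>2 \<le> K * exp (\<epsilon> * real n)"
proof -
  define m where "m = min 1 (\<epsilon> / 2)"
  have m: "0 < m" "m \<le> 1" "m \<le> \<epsilon> / 2"
    using assms by (auto simp: m_def)
  have "(real n + 1)\<^sup>2 \<le> 1 / m\<^sup>2 * exp (\<epsilon> * real n)" for n
  proof -
    have "m * (real n + 1) \<le> \<epsilon> / 2 * real n + 1"
      using m mult_right_mono[OF m(3), of "real n"] by (simp add: algebra_simps)
    also have "\<dots> \<le> exp (\<epsilon> / 2 * real n)"
      using exp_ge_add_one_self[of "\<epsilon> / 2 * real n"] by linarith
    finally have "(m * (real n + 1))\<^sup>2 \<le> (exp (\<epsilon> / 2 * real n))\<^sup>2"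
      using m by (intro power_mono) auto
    also have "(exp (\<epsilon> / 2 * real n))\<^sup>2 = exp (\<epsilon> * real n)"
      by (simp flip: exp_double)
    finally show ?thesis
      using m unfolding power_mult_distrib by (simp add: pos_le_divide_eq mult.commute)
  qed
  then show ?thesis by blast
qed

lemma exponential_rate:
  fixes Z :: "nat \<Rightarrow> real"
  assumes lower: "\<And>\<epsilon>. 0 < \<epsilon> \<Longrightarrow> \<exists>c>0. \<forall>n. c * exp ((r - \<epsilon>) * real n) \<le> Z n"
    and upper: "\<And>\<epsilon>. 0 < \<epsilon> \<Longrightarrow> \<exists>C. \<forall>n. Z n \<le> C * exp ((r + \<epsilon>) * real n)"
  shows "(\<lambda>n. ln (Z n) / real n) \<longlonglongrightarrow> r"
proof (rule LIMSEQ_I)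
  fix \<epsilon> :: real assume "0 < \<epsilon>"
  then have \<epsilon>: "0 < \<epsilon> / 2" by simp
  obtain c where c: "0 < c" "\<And>n. c * exp ((r - \<epsilon> / 2) * real n) \<le> Z n"
    using lower[OF \<epsilon>] by blast
  obtain C where C: "\<And>n. Z n \<le> C * exp ((r + \<epsilon> / 2) * real n)"
    using upper[OF \<epsilon>] by blast
  have "0 < C"
    using c(2)[of 0] C[of 0] c(1) by simp
  obtain N where N: "real N > (\<bar>ln c\<bar> + \<bar>ln C\<bar> + 1) / (\<epsilon> / 2)"
    using reals_Archimedean2 by blast
  have "norm (ln (Z n) / real n - r) < \<epsilon>" if "N \<le> n" for n
  proof -
    have n: "\<bar>ln c\<bar> + \<bar>ln C\<bar> + 1 < real n * (\<epsilon> / 2)"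
      using N that \<epsilon> by (simp add: field_simps) (smt (verit) mult_left_mono of_nat_mono)
    then have "0 < real n"
      using \<epsilon> by (cases n) auto
    have Zn: "0 < Z n"
      using c(2)[of n] c(1) by (smt (verit) exp_gt_zero mult_pos_pos)
    have "ln c + (r - \<epsilon> / 2) * real n \<le> ln (Z n)"
      using c(1) c(2)[of n] Zn ln_mono[of "c * exp ((r - \<epsilon> / 2) * real n)" "Z n"] by (simp add: ln_mult)
    moreover have "ln (Z n) \<le> ln C + (r + \<epsilon> / 2) * real n"
      using \<open>0 < C\<close> C[of n] Zn ln_mono[of "Z n" "C * exp ((r + \<epsilon> / 2) * real n)"] by (simp add: ln_mult)
    ultimately have "\<bar>ln (Z n) - r * real n\<bar> < \<epsilon> * real n"
      using n by (simp add: algebra_simps abs_less_iff) linarith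
    moreover have "ln (Z n) / real n - r = (ln (Z n) - r * real n) / real n"
      using \<open>0 < real n\<close> by (simp add: field_simps)
    ultimately show ?thesis
      using \<open>0 < real n\<close> by (simp add: abs_divide pos_divide_less_eq)
  qed
  then show "\<exists>N. \<forall>n\<ge>N. norm (ln (Z n) / real n - r) < \<epsilon>" by blast
qed

section \<open>Finite paths and their averaged weights\<close>

lemma embed_add: "embed (x + y) = embed x + embed y"
  by (simp add: embed_def vec_eq_iff)

lemma embed_zero [simp]: "embed 0 = 0"
  by (simp add: embed_def vec_eq_iff)

lemma embed_minus: "embed (- x) = - embed x"
  by (simp add: embed_def vec_eq_iff)

text \<open>Finite paths are coded by their increments and start at the origin, so that
  concatenation of paths is \<open>@\<close> and the translation of the second path is explicit in
  \<open>pos_append_right\<close>.\<close>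

definition pos :: "(int ^ 'd) list \<Rightarrow> nat \<Rightarrow> int ^ 'd" where
  "pos zs i = sum_list (take i zs)"

definition step_lists :: "nat \<Rightarrow> (int ^ 'd) list set" where
  "step_lists n = {zs. length zs = n \<and> set zs \<subseteq> unit_steps}"

definition path_weight :: "'d environment \<Rightarrow> int ^ 'd \<Rightarrow> (int ^ 'd) list \<Rightarrow> real" where
  "path_weight \<omega> x zs = (\<Prod>i<length zs. pmf (\<omega> (x + pos zs i)) (zs ! i))"

definition path_cylinder :: "(int ^ 'd) list \<Rightarrow> 'd path set" where
  "path_cylinder zs = {X. \<forall>i\<le>length zs. X i = pos zs i}"

lemma pos_0 [simp]: "pos zs 0 = 0"
  by (simp add: pos_def)

lemma pos_Suc: "i < length zs \<Longrightarrow> pos zs (Suc i) = pos zs i + zs ! i"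
  by (simp add: pos_def take_Suc_conv_app_nth)

lemma pos_append_left: "i \<le> length ys \<Longrightarrow> pos (ys @ zs) i = pos ys i"
  by (simp add: pos_def)

lemma pos_append_right: "pos (ys @ zs) (length ys + i) = pos ys (length ys) + pos zs i"
  by (simp add: pos_def)

lemma pos_take: "i \<le> j \<Longrightarrow> pos (take j zs) i = pos zs i"
  by (simp add: pos_def min_def)

lemma finite_step_lists: "finite (step_lists n :: (int ^ 'd) list set)"
  using finite_lists_length_eq[OF finite_unit_steps, of n]
  by (simp add: step_lists_def conj_commute)

lemma step_lists_0 [simp]: "step_lists 0 = {[]}"
  by (auto simp: step_lists_def)

lemma step_lists_append:
  "bij_betw (\<lambda>(ys, zs). ys @ zs) (step_lists m \<times> step_lists n) (step_lists (m + n))"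
proof (rule bij_betwI[where g = "\<lambda>cs. (take m cs, drop m cs)"])
  show "(\<lambda>cs. (take m cs, drop m cs)) \<in> step_lists (m + n) \<rightarrow> step_lists m \<times> step_lists n"
    using set_take_subset set_drop_subset by (fastforce simp: step_lists_def)
qed (auto simp: step_lists_def)

lemma sum_step_lists_append:
  "(\<Sum>cs\<in>step_lists (m + n). F cs) = (\<Sum>ys\<in>step_lists m. \<Sum>zs\<in>step_lists n. F (ys @ zs))"
  unfolding sum.cartesian_product
  by (subst sum.reindex_bij_betw[OF step_lists_append, symmetric]) (simp add: case_prod_unfold)

lemma step_lists_1: "step_lists 1 = (\<lambda>z. [z]) ` unit_steps"
  by (auto simp: step_lists_def length_Suc_conv)

lemma sum_step_lists_Suc:
  "(\<Sum>cs\<in>step_lists (Suc n). F cs) = (\<Sum>z\<in>unit_steps. \<Sum>zs\<in>step_lists n. F (z # zs))"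
proof -
  have "(\<Sum>ys\<in>step_lists 1. \<Sum>zs\<in>step_lists n. F (ys @ zs)) = (\<Sum>z\<in>unit_steps. \<Sum>zs\<in>step_lists n. F (z # zs))"
    unfolding step_lists_1 by (subst sum.reindex) (auto simp: inj_on_def)
  then show ?thesis
    unfolding sum_step_lists_append[symmetric] by simp
qed

lemma path_weight_Nil [simp]: "path_weight \<omega> x [] = 1"
  by (simp add: path_weight_def)

lemma path_weight_Cons: "path_weight \<omega> x (z # zs) = pmf (\<omega> x) z * path_weight \<omega> (x + z) zs"
proof -
  have "pos (z # zs) (Suc i) = z + pos zs i" for i
    by (simp add: pos_def)
  then show ?thesis
    by (simp add: path_weight_def prod.lessThan_Suc_shift add.assoc del: prod.lessThan_Suc)
qed

lemma path_weight_nonneg: "0 \<le> path_weight \<omega> x zs"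
  by (simp add: path_weight_def prod_nonneg)

lemma path_weight_le_1: "path_weight \<omega> x zs \<le> 1"
  unfolding path_weight_def by (intro prod_le_1) (auto simp: pmf_le_1)

lemma path_cylinder_measurable: "path_cylinder zs \<in> sets (path_space :: 'd::finite path measure)"
proof -
  have "path_cylinder zs = cylinder (map (pos zs) [0..<Suc (length zs)])"
    by (auto simp: path_cylinder_def cylinder_def less_Suc_eq_le simp del: upt_Suc)
  then show ?thesis by (simp add: cylinder_sets)
qed

lemma emeasure_quenched_path_cylinder:
  fixes \<omega> :: "'d::finite environment"
  shows "emeasure (quenched \<omega> 0) (path_cylinder zs) = ennreal (path_weight \<omega> 0 zs)"
proof -
  have "emeasure (quenched \<omega> 0) (path_cylinder zs) =
      (\<Prod>i<length zs. ennreal (pmf (\<omega> (pos zs i)) (pos zs (Suc i) - pos zs i)))"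
    unfolding path_cylinder_def quenched_cylinder by simp
  also have "\<dots> = (\<Prod>i<length zs. ennreal (pmf (\<omega> (pos zs i)) (zs ! i)))"
    by (intro prod.cong refl) (simp add: pos_Suc)
  also have "\<dots> = ennreal (path_weight \<omega> 0 zs)"
    by (simp add: path_weight_def prod_ennreal)
  finally show ?thesis .
qed

lemma space_site_space [simp]: "space site_space = UNIV"
  by (simp add: site_space_def)

lemma space_env_space [simp]: "space env_space = UNIV"
  by (simp add: env_space_def space_PiM)

lemma space_path_space [simp]: "space path_space = UNIV"
  by (simp add: path_space_def space_PiM)

lemma measurable_path_component: "(\<lambda>X. X n) \<in> measurable path_space (count_space UNIV)"
  unfolding path_space_def by (rule measurable_component_singleton) simp

locale iid_walk =
  fixes P :: "'d::finite environment measure" and u :: "real ^ 'd"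
  assumes random_env: "random_environment P"
    and nearest: "nearest_neighbor P"
    and elliptic: "uniformly_elliptic P"
    and iid: "iid_environment P"
    and norm_u: "norm u = 1"
begin

sublocale prob_space P
  using random_env by (simp add: random_environment_def)

lemma sets_P [measurable_cong]: "sets P = sets env_space"
  using random_env by (simp add: random_environment_def)

lemma space_P [simp]: "space P = UNIV"
  using sets_eq_imp_space_eq[OF sets_P] by simp

lemma measurable_site [measurable]: "(\<lambda>\<omega>. \<omega> x) \<in> measurable P site_space"
  unfolding measurable_cong_sets[OF sets_P refl] env_space_def
  by (rule measurable_component_singleton) simp

lemmas [measurable] = measurable_pmf_site

lemma measurable_path_weight [measurable]: "(\<lambda>\<omega>. path_weight \<omega> x zs) \<in> borel_measurable P"
proof -
  have "(\<lambda>\<omega>. pmf (\<omega> y) z) \<in> borel_measurable P" for y z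
    by (rule measurable_compose[OF measurable_site measurable_pmf_site])
  then show ?thesis unfolding path_weight_def by measurable
qed

lemma distr_site: "distr P site_space (\<lambda>\<omega>. \<omega> x) = distr P site_space (\<lambda>\<omega>. \<omega> 0)"
  using iid unfolding iid_environment_def by blast

lemma expectation_site:
  assumes [measurable]: "\<phi> \<in> borel_measurable site_space"
  shows "(\<integral>\<omega>. \<phi> (\<omega> x) \<partial>P) = (\<integral>\<omega>. \<phi> (\<omega> 0) \<partial>P :: real)"
proof -
  have "(\<integral>\<omega>. \<phi> (\<omega> x) \<partial>P) = (\<integral>p. \<phi> p \<partial>distr P site_space (\<lambda>\<omega>. \<omega> x))"
    by (rule integral_distr[symmetric]) simp_all
  also have "distr P site_space (\<lambda>\<omega>. \<omega> x) = distr P site_space (\<lambda>\<omega>. \<omega> 0)"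
    by (rule distr_site)
  also have "(\<integral>p. \<phi> p \<partial>distr P site_space (\<lambda>\<omega>. \<omega> 0)) = (\<integral>\<omega>. \<phi> (\<omega> 0) \<partial>P)"
    by (rule integral_distr) simp_all
  finally show ?thesis .
qed

lemma AE_site:
  assumes "AE \<omega> in P. Q (\<omega> 0)" and Q [measurable]: "Measurable.pred site_space Q"
  shows "AE \<omega> in P. Q (\<omega> x)"
proof -
  have Q': "{p \<in> space site_space. Q p} \<in> sets site_space"
    using predE[OF Q] .
  have "AE p in distr P site_space (\<lambda>\<omega>. \<omega> 0). Q p"
    using assms(1) by (subst AE_distr_iff[OF measurable_site Q'])
  then have "AE p in distr P site_space (\<lambda>\<omega>. \<omega> x). Q p"
    unfolding distr_site[of x] .
  then show ?thesis
    by (subst (asm) AE_distr_iff[OF measurable_site Q'])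
qed

lemma expectation_prod_sites:
  assumes A: "finite A" and \<phi>: "\<And>y. y \<in> A \<Longrightarrow> \<phi> y \<in> borel_measurable site_space"
    and bounded: "\<And>y p. y \<in> A \<Longrightarrow> \<bar>\<phi> y p\<bar> \<le> (1 :: real)"
  shows "(\<integral>\<omega>. (\<Prod>y\<in>A. \<phi> y (\<omega> y)) \<partial>P) = (\<Prod>y\<in>A. \<integral>\<omega>. \<phi> y (\<omega> 0) \<partial>P)"
proof -
  have "indep_vars (\<lambda>_. site_space) (\<lambda>x \<omega>. \<omega> x) A"
    using iid indep_vars_subset unfolding iid_environment_def by blast
  then have "indep_vars (\<lambda>_. borel) (\<lambda>y \<omega>. \<phi> y (\<omega> y)) A"
    by (rule indep_vars_compose2) (rule \<phi>)
  moreover have "integrable P (\<lambda>\<omega>. \<phi> y (\<omega> y))" if "y \<in> A" for y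
    by (rule integrable_const_bound[of _ 1])
       (use bounded \<phi> that in \<open>auto intro: measurable_compose[OF measurable_site]\<close>)
  ultimately have "(\<integral>\<omega>. (\<Prod>y\<in>A. \<phi> y (\<omega> y)) \<partial>P) = (\<Prod>y\<in>A. \<integral>\<omega>. \<phi> y (\<omega> y) \<partial>P)"
    using A by (intro indep_vars_lebesgue_integral)
  also have "\<dots> = (\<Prod>y\<in>A. \<integral>\<omega>. \<phi> y (\<omega> 0) \<partial>P)"
    by (intro prod.cong refl expectation_site \<phi>)
  finally show ?thesis .
qed

section \<open>Averaged weights of finite paths, site by site\<close>

definition W :: "(int ^ 'd) list \<Rightarrow> real" where
  "W zs = (\<integral>\<omega>. path_weight \<omega> 0 zs \<partial>P)"

definition ellipticity :: real where
  "ellipticity = (SOME \<kappa>. 0 < \<kappa> \<and> (\<forall>z\<in>unit_steps. AE \<omega> in P. \<kappa> \<le> pmf (\<omega> 0) z))"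

lemma ellipticity: "0 < ellipticity" "z \<in> unit_steps \<Longrightarrow> AE \<omega> in P. ellipticity \<le> pmf (\<omega> 0) z"
proof -
  have "\<exists>\<kappa>>0. \<forall>z\<in>unit_steps. AE \<omega> in P. \<kappa> \<le> pmf (\<omega> 0) z"
    using elliptic by (simp add: uniformly_elliptic_def)
  from someI_ex[OF this] show "0 < ellipticity"
      "z \<in> unit_steps \<Longrightarrow> AE \<omega> in P. ellipticity \<le> pmf (\<omega> 0) z"
    unfolding ellipticity_def by blast+
qed

lemma AE_elliptic: "AE \<omega> in P. \<forall>x. \<forall>z\<in>unit_steps. ellipticity \<le> pmf (\<omega> x) z"
proof -
  have "AE \<omega> in P. \<forall>z\<in>unit_steps. ellipticity \<le> pmf (\<omega> x) z" for x
    using ellipticity(2) finite_unit_steps AE_site[of "\<lambda>p. ellipticity \<le> pmf p _" x]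
    by (subst AE_finite_all) auto
  then show ?thesis
    by (subst AE_all_countable) auto
qed

lemma AE_nearest: "AE \<omega> in P. \<forall>x. \<forall>z. z \<notin> unit_steps \<longrightarrow> pmf (\<omega> x) z = 0"
proof -
  have "AE \<omega> in P. z \<notin> unit_steps \<longrightarrow> pmf (\<omega> x) z = 0" for x z
    using nearest AE_site[of "\<lambda>p. pmf p z = 0" x] by (cases "z \<in> unit_steps") (auto simp: nearest_neighbor_def)
  then show ?thesis
    by (simp add: AE_all_countable)
qed

lemma AE_sum_pmf: "AE \<omega> in P. \<forall>x. (\<Sum>z\<in>unit_steps. pmf (\<omega> x) z) = 1"
  using AE_nearest
proof eventually_elim
  case (elim \<omega>)
  show ?case
  proof
    fix x
    have "set_pmf (\<omega> x) \<subseteq> unit_steps"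
    proof
      fix z assume "z \<in> set_pmf (\<omega> x)"
      then show "z \<in> unit_steps"
        using elim[rule_format, of z x] unfolding set_pmf_iff by blast
    qed
    then show "(\<Sum>z\<in>unit_steps. pmf (\<omega> x) z) = 1"
      by (rule sum_pmf_eq_1[OF finite_unit_steps])
  qed
qed

lemma integrable_path_weight: "integrable P (\<lambda>\<omega>. path_weight \<omega> x zs)"
  by (rule integrable_const_bound[of _ 1]) (auto simp: path_weight_nonneg path_weight_le_1)

lemma sum_W: "(\<Sum>zs\<in>step_lists n. W zs) = 1"
proof -
  have "AE \<omega> in P. \<forall>x. (\<Sum>zs\<in>step_lists n. path_weight \<omega> x zs) = 1"
    using AE_sum_pmf
  proof eventually_elim
    case (elim \<omega>)
    show ?case
    proof (induction n)
      case (Suc n)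
      show ?case
        by (simp add: sum_step_lists_Suc path_weight_Cons Suc elim flip: sum_distrib_left)
    qed simp
  qed
  then have "AE \<omega> in P. (\<Sum>zs\<in>step_lists n. path_weight \<omega> 0 zs) = 1"
    by eventually_elim simp
  then have "(\<integral>\<omega>. (\<Sum>zs\<in>step_lists n. path_weight \<omega> 0 zs) \<partial>P) = (\<integral>\<omega>. 1 \<partial>P)"
    by (intro integral_cong_AE) auto
  then show ?thesis
    by (simp add: W_def integrable_path_weight prob_space[simplified])
qed

lemma W_pos:
  assumes "zs \<in> step_lists n"
  shows "0 < W zs"
proof -
  have "AE \<omega> in P. ellipticity ^ n \<le> path_weight \<omega> 0 zs"
    using AE_elliptic
  proof eventually_elim
    case (elim \<omega>)
    have "ellipticity ^ n = (\<Prod>i<length zs. ellipticity)"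
      using assms by (simp add: step_lists_def)
    also have "\<dots> \<le> path_weight \<omega> 0 zs"
      unfolding path_weight_def using elim assms ellipticity(1)
      by (intro prod_mono) (auto simp: step_lists_def subset_iff)
    finally show ?case .
  qed
  then have "(\<integral>\<omega>. ellipticity ^ n \<partial>P) \<le> W zs"
    unfolding W_def by (intro integral_mono_AE integrable_path_weight) auto
  then have "ellipticity ^ n \<le> W zs"
    by (simp add: prob_space[simplified])
  then show ?thesis
    using ellipticity(1) by (meson less_le_trans zero_less_power)
qed

text \<open>Only times before the last one count: the weight contains no transition out of the
  endpoint.\<close>

definition occ :: "(int ^ 'd) list \<Rightarrow> int ^ 'd \<Rightarrow> nat set" where
  "occ zs y = {i. i < length zs \<and> pos zs i = y}"

definition site_weight :: "(int ^ 'd) list \<Rightarrow> nat set \<Rightarrow> real" where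
  "site_weight zs I = (\<integral>\<omega>. (\<Prod>i\<in>I. pmf (\<omega> 0) (zs ! i)) \<partial>P)"

text \<open>Grouping the steps by the site they leave turns the weight into a product of functions
  of different sites, whose expectation factorises. Each factor is expressed at the site 0, which
  builds translation invariance into the formula.\<close>

lemma W_eq_prod_sites: "W zs = (\<Prod>y\<in>pos zs ` {..<length zs}. site_weight zs (occ zs y))"
proof -
  have "path_weight \<omega> 0 zs = (\<Prod>y\<in>pos zs ` {..<length zs}. \<Prod>i\<in>occ zs y. pmf (\<omega> y) (zs ! i))" for \<omega>
  proof -
    have "path_weight \<omega> 0 zs = (\<Prod>y\<in>pos zs ` {..<length zs}. \<Prod>i\<in>{i \<in> {..<length zs}. pos zs i = y}. pmf (\<omega> (pos zs i)) (zs ! i))"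
      unfolding path_weight_def by (subst prod.group) auto
    also have "\<dots> = (\<Prod>y\<in>pos zs ` {..<length zs}. \<Prod>i\<in>occ zs y. pmf (\<omega> y) (zs ! i))"
      by (intro prod.cong refl) (auto simp: occ_def)
    finally show ?thesis .
  qed
  then show ?thesis
    unfolding W_def site_weight_def
    by (simp only:) (intro expectation_prod_sites, auto simp: abs_prod intro!: prod_le_1 pmf_le_1)
qed

text \<open>The sites left by \<open>ys\<close> and by the translated \<open>zs\<close> are
  disjoint, so the site factors separate, and those of the second path do not see the translation.
  The endpoint of \<open>ys\<close> counts as a site of the second path.\<close>

lemma W_append:
  assumes disj: "\<And>i j. i < length ys \<Longrightarrow> j < length zs \<Longrightarrow> pos ys i \<noteq> pos ys (length ys) + pos zs j"
  shows "W (ys @ zs) = W ys * W zs"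
proof -
  let ?m = "length ys" and ?n = "length zs"
  let ?x = "pos ys ?m"
  let ?A = "pos ys ` {..<?m}" and ?B = "(+) ?x ` pos zs ` {..<?n}"
  have split: "{..<?m + ?n} = {..<?m} \<union> (+) ?m ` {..<?n}"
    unfolding lessThan_atLeast0 image_add_atLeastLessThan by auto
  have img: "pos (ys @ zs) ` {..<length (ys @ zs)} = ?A \<union> ?B"
    unfolding length_append split image_Un image_image pos_append_right
    by (intro arg_cong2[of _ _ _ _ "(\<union>)"] image_cong refl) (simp add: pos_append_left)
  have occ_A: "site_weight (ys @ zs) (occ (ys @ zs) y) = site_weight ys (occ ys y)" if y: "y \<in> ?A" for y
  proof -
    have "occ (ys @ zs) y = occ ys y"
    proof -
      have "i < ?m" if i: "i < ?m + ?n" "pos (ys @ zs) i = y" for i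
      proof (rule ccontr)
        assume "\<not> i < ?m"
        then obtain j where "i = ?m + j" by (metis le_iff_add not_less)
        with i have j: "j < ?n" "y = ?x + pos zs j"
          by (auto simp: pos_append_right)
        obtain l where "l < ?m" "y = pos ys l"
          using y by auto
        with disj[of l j] j show False by simp
      qed
      then have "i \<in> occ (ys @ zs) y \<longleftrightarrow> i \<in> occ ys y" for i
        using pos_append_left[of i ys zs] by (cases "i < ?m") (auto simp: occ_def)
      then show ?thesis by blast
    qed
    moreover have "(\<Prod>i\<in>occ ys y. pmf (\<omega> 0) ((ys @ zs) ! i)) = (\<Prod>i\<in>occ ys y. pmf (\<omega> 0) (ys ! i))" for \<omega> :: "'d environment"
      by (intro prod.cong refl) (simp add: occ_def nth_append)
    ultimately show ?thesis
      unfolding site_weight_def by (simp only:)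
  qed
  have occ_B: "site_weight (ys @ zs) (occ (ys @ zs) (?x + y)) = site_weight zs (occ zs y)" if y: "y \<in> pos zs ` {..<?n}" for y
  proof -
    have "occ (ys @ zs) (?x + y) = (+) ?m ` occ zs y"
    proof -
      have "i \<ge> ?m" if i: "i < ?m + ?n" "pos (ys @ zs) i = ?x + y" for i
      proof (rule ccontr)
        assume "\<not> ?m \<le> i"
        moreover obtain j where "j < ?n" "y = pos zs j"
          using y by auto
        ultimately show False
          using disj[of i j] i(2) by (simp add: pos_append_left)
      qed
      then show ?thesis
        by (force simp: occ_def pos_append_right image_iff le_iff_add)
    qed
    then show ?thesis
      unfolding site_weight_def by (simp add: prod.reindex nth_append o_def)
  qed
  have "W (ys @ zs) = (\<Prod>y\<in>?A. site_weight (ys @ zs) (occ (ys @ zs) y)) * (\<Prod>y\<in>?B. site_weight (ys @ zs) (occ (ys @ zs) y))"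
    unfolding W_eq_prod_sites img using disj by (intro prod.union_disjoint) auto
  also have "(\<Prod>y\<in>?A. site_weight (ys @ zs) (occ (ys @ zs) y)) = W ys"
    unfolding W_eq_prod_sites by (intro prod.cong refl occ_A)
  also have "(\<Prod>y\<in>?B. site_weight (ys @ zs) (occ (ys @ zs) y)) = (\<Prod>y\<in>pos zs ` {..<?n}. site_weight (ys @ zs) (occ (ys @ zs) (?x + y)))"
    by (subst prod.reindex) (auto simp: inj_on_def)
  also have "\<dots> = W zs"
    unfolding W_eq_prod_sites by (intro prod.cong refl occ_B)
  finally show ?thesis .
qed

end

section \<open>Regeneration decomposition\<close>

context iid_walk
begin

definition path_law :: "'d path measure" where
  "path_law = distr (averaged P 0) path_space snd"

lemma sets_averaged: "sets (averaged P 0) = sets (env_space \<Otimes>\<^sub>M path_space)"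
  unfolding averaged_def by (rule sets_bind) auto

lemma space_averaged [simp]: "space (averaged P 0) = UNIV"
  using sets_eq_imp_space_eq[OF sets_averaged] by (simp add: space_pair_measure)

lemma measurable_snd_averaged: "snd \<in> measurable (averaged P 0) path_space"
  unfolding measurable_cong_sets[OF sets_averaged refl] by simp

lemma sets_path_law [measurable_cong]: "sets path_law = sets path_space"
  by (simp add: path_law_def)

lemma space_path_law [simp]: "space path_law = UNIV"
  by (simp add: path_law_def)

lemma emeasure_path_law:
  assumes "A \<in> sets path_space"
  shows "emeasure path_law A = (\<integral>\<^sup>+\<omega>. emeasure (quenched \<omega> 0) A \<partial>P)"
proof -
  have "emeasure path_law A = emeasure (averaged P 0) (UNIV \<times> A)"
    unfolding path_law_def using assms
    by (subst emeasure_distr[OF measurable_snd_averaged]) (auto intro: arg_cong[where f = "emeasure _"])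
  also have "\<dots> = (\<integral>\<^sup>+\<omega>. emeasure (quenched \<omega> 0) (Pair \<omega> -` (UNIV \<times> A)) \<partial>P)"
    by (rule emeasure_averaged[OF random_env]) (use assms in \<open>auto intro!: pair_measureI simp flip: space_env_space\<close>)
  finally show ?thesis by simp
qed

sublocale PL: prob_space path_law
proof (rule prob_spaceI)
  have "space (quenched \<omega> 0) = UNIV" for \<omega> :: "'d environment"
    using sets_eq_imp_space_eq[OF sets_quenched] by simp
  then have "emeasure (quenched \<omega> 0) UNIV = 1" for \<omega> :: "'d environment"
    using prob_space.emeasure_space_1[OF prob_space_quenched, of \<omega> 0] by simp
  then show "emeasure path_law (space path_law) = 1"
    using sets.top[of "path_space :: 'd path measure"]
    by (simp add: emeasure_path_law emeasure_space_1[simplified])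
qed

lemma cylinder_event [measurable]: "path_cylinder zs \<in> PL.events"
  using path_cylinder_measurable by (simp add: sets_path_law)

lemma prob_path_cylinder: "PL.prob (path_cylinder zs) = W zs"
proof -
  have "emeasure path_law (path_cylinder zs) = (\<integral>\<^sup>+\<omega>. ennreal (path_weight \<omega> 0 zs) \<partial>P)"
    by (simp add: emeasure_path_law path_cylinder_measurable emeasure_quenched_path_cylinder)
  also have "\<dots> = ennreal (W zs)"
    unfolding W_def by (rule nn_integral_eq_integral[OF integrable_path_weight]) (simp add: path_weight_nonneg)
  finally show ?thesis
    by (simp add: measure_def W_def path_weight_nonneg)
qed

lemma path_cylinder_inj:
  assumes "X \<in> path_cylinder cs" "X \<in> path_cylinder ds" "length cs = length ds"
  shows "cs = ds"
proof (rule nth_equalityI)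
  fix i assume i: "i < length cs"
  then have "pos cs i = pos ds i" "pos cs (Suc i) = pos ds (Suc i)"
    using assms by (auto simp: path_cylinder_def Suc_le_eq)
  then show "cs ! i = ds ! i"
    using i assms(3) by (simp add: pos_Suc)
qed (rule assms)

lemma disjoint_path_cylinders: "disjoint_family_on (\<lambda>cs. path_cylinder cs \<inter> A) (step_lists n)"
  unfolding disjoint_family_on_def step_lists_def using path_cylinder_inj by fastforce

lemma AE_path_cylinder: "AE X in path_law. X \<in> (\<Union>cs\<in>step_lists n. path_cylinder cs)"
proof -
  have "PL.prob (\<Union>cs\<in>step_lists n. path_cylinder cs \<inter> UNIV) = (\<Sum>cs\<in>step_lists n. PL.prob (path_cylinder cs \<inter> UNIV))"
    by (rule PL.finite_measure_finite_Union[OF finite_step_lists _ disjoint_path_cylinders]) auto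
  then have "PL.prob (\<Union>cs\<in>step_lists n. path_cylinder cs) = 1"
    by (simp add: prob_path_cylinder sum_W)
  then show ?thesis
    by (subst PL.AE_in_set_eq_1) (auto intro!: sets.finite_UN finite_step_lists)
qed

lemma prob_eq_sum_cylinders:
  assumes [measurable]: "A \<in> PL.events"
  shows "PL.prob A = (\<Sum>cs\<in>step_lists n. PL.prob (path_cylinder cs \<inter> A))"
proof -
  have "PL.prob A = PL.prob (\<Union>cs\<in>step_lists n. path_cylinder cs \<inter> A)"
    using AE_path_cylinder[of n]
    by (intro PL.finite_measure_eq_AE) (auto intro!: sets.finite_UN finite_step_lists)
  also have "\<dots> = (\<Sum>cs\<in>step_lists n. PL.prob (path_cylinder cs \<inter> A))"
    by (rule PL.finite_measure_finite_Union[OF finite_step_lists _ disjoint_path_cylinders]) auto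
  finally show ?thesis .
qed

section \<open>Ladder points and half-space events\<close>

definition height :: "int ^ 'd \<Rightarrow> real" where
  "height x = embed x \<bullet> u"

abbreviation hp :: "(int ^ 'd) list \<Rightarrow> nat \<Rightarrow> real" where
  "hp cs i \<equiv> height (pos cs i)"

lemma height_add: "height (x + y) = height x + height y"
  by (simp add: height_def embed_add inner_add_left)

lemma height_0 [simp]: "height 0 = 0"
  by (simp add: height_def)

lemma measurable_height [measurable]: "(\<lambda>X. height (X k)) \<in> borel_measurable path_law"
  unfolding measurable_cong_sets[OF sets_path_law refl]
  by (rule measurable_compose[OF measurable_path_component]) simp

text \<open>Strict, whereas \<open>upward\<close> allows equality, as in the definition of the
  regeneration time. Together they separate the sites left before a ladder point from those of an
  upward continuation.\<close>

definition ladder :: "(int ^ 'd) list \<Rightarrow> bool" where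
  "ladder cs \<longleftrightarrow> (\<forall>i<length cs. hp cs i < hp cs (length cs))"

definition upward :: "(int ^ 'd) list \<Rightarrow> bool" where
  "upward cs \<longleftrightarrow> (\<forall>i\<le>length cs. 0 \<le> hp cs i)"

definition stay :: "nat \<Rightarrow> real \<Rightarrow> 'd path set" where
  "stay n l = {X. \<forall>k\<ge>n. l \<le> height (X k)}"

text \<open>Staying above a level forever depends on the whole future; a finite horizon N turns it
  into a finite sum of path weights, and N tends to infinity afterwards.\<close>

definition stay_for :: "nat \<Rightarrow> real \<Rightarrow> nat \<Rightarrow> 'd path set" where
  "stay_for n l N = {X. \<forall>k. n \<le> k \<and> k \<le> n + N \<longrightarrow> l \<le> height (X k)}"

lemma stay_event [measurable]: "stay n l \<in> PL.events"
proof -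
  have "{X \<in> space path_law. \<forall>k\<ge>n. l \<le> height (X k)} \<in> PL.events" by measurable
  then show ?thesis by (simp add: stay_def)
qed

lemma stay_for_event [measurable]: "stay_for n l N \<in> PL.events"
proof -
  have "{X \<in> space path_law. \<forall>k. n \<le> k \<and> k \<le> n + N \<longrightarrow> l \<le> height (X k)} \<in> PL.events" by measurable
  then show ?thesis by (simp add: stay_for_def)
qed

lemma prob_cylinder_stay_for:
  assumes as: "as \<in> step_lists n"
  shows "PL.prob (path_cylinder as \<inter> stay_for n l N) =
    (\<Sum>xs\<in>step_lists N. if \<forall>k\<le>N. l \<le> height (pos as n + pos xs k) then W (as @ xs) else 0)"
proof -
  let ?A = "path_cylinder as \<inter> stay_for n l N"
  let ?C = "\<lambda>xs. \<forall>k\<le>N. l \<le> height (pos as n + pos xs k)"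
  have len: "length as = n"
    using as by (simp add: step_lists_def)
  have *: "PL.prob (path_cylinder (bs @ xs) \<inter> ?A) = (if bs = as then if ?C xs then W (as @ xs) else 0 else 0)"
    if bs: "bs \<in> step_lists n" and xs: "xs \<in> step_lists N" for bs xs
  proof (cases "bs = as")
    case False
    have "path_cylinder (bs @ xs) \<subseteq> path_cylinder bs"
      by (auto simp: path_cylinder_def pos_append_left)
    then have "path_cylinder (bs @ xs) \<inter> ?A = {}"
      using path_cylinder_inj[of _ bs as] False bs len by (auto simp: step_lists_def)
    then show ?thesis using False by simp
  next
    case True
    have X: "X (n + k) = pos as n + pos xs k" if "X \<in> path_cylinder (as @ xs)" "k \<le> N" for X k
      using that len xs pos_append_right[of as xs k] by (auto simp: path_cylinder_def step_lists_def)
    have sub: "path_cylinder (as @ xs) \<subseteq> path_cylinder as"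
      by (auto simp: path_cylinder_def pos_append_left)
    have "PL.prob (path_cylinder (as @ xs) \<inter> ?A) = (if ?C xs then W (as @ xs) else 0)"
    proof (cases "?C xs")
      case True
      have "X \<in> stay_for n l N" if "X \<in> path_cylinder (as @ xs)" for X
        unfolding stay_for_def
      proof safe
        fix k assume "n \<le> k" "k \<le> n + N"
        then obtain i where "k = n + i" "i \<le> N" by (metis add_le_cancel_left le_iff_add)
        then show "l \<le> height (X k)" using X[OF that] True by simp
      qed
      with sub have "path_cylinder (as @ xs) \<inter> ?A = path_cylinder (as @ xs)" by auto
      then show ?thesis unfolding if_P[OF True] by (simp only: prob_path_cylinder)
    next
      case False
      then obtain k where k: "k \<le> N" "\<not> l \<le> height (pos as n + pos xs k)" by blast
      have "X \<notin> stay_for n l N" if "X \<in> path_cylinder (as @ xs)" for X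
        using X[OF that k(1)] k by (auto simp: stay_for_def intro!: exI[of _ "n + k"])
      then have "path_cylinder (as @ xs) \<inter> ?A = {}" by auto
      then show ?thesis unfolding if_not_P[OF False] by (simp only: measure_empty)
    qed
    then show ?thesis unfolding True by (simp only: if_True refl)
  qed
  have "PL.prob ?A = (\<Sum>bs\<in>step_lists n. \<Sum>xs\<in>step_lists N. PL.prob (path_cylinder (bs @ xs) \<inter> ?A))"
    by (subst prob_eq_sum_cylinders[of _ "n + N"]) (auto simp: sum_step_lists_append)
  also have "\<dots> = (\<Sum>bs\<in>step_lists n. if bs = as then \<Sum>xs\<in>step_lists N. if ?C xs then W (as @ xs) else 0 else 0)"
    by (intro sum.cong refl) (simp add: *)
  also have "\<dots> = (\<Sum>xs\<in>step_lists N. if ?C xs then W (as @ xs) else 0)"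
    by (subst sum.delta[OF finite_step_lists]) (simp add: as)
  finally show ?thesis .
qed

lemma prob_cylinder_stay_limit:
  "(\<lambda>N. PL.prob (path_cylinder as \<inter> stay_for n l N)) \<longlonglongrightarrow> PL.prob (path_cylinder as \<inter> stay n l)"
proof -
  have "(\<lambda>N. PL.prob (path_cylinder as \<inter> stay_for n l N)) \<longlonglongrightarrow> PL.prob (\<Inter>N. path_cylinder as \<inter> stay_for n l N)"
    by (rule PL.finite_Lim_measure_decseq) (auto simp: decseq_def stay_for_def)
  also have "(\<Inter>N. path_cylinder as \<inter> stay_for n l N) = path_cylinder as \<inter> stay n l"
    by (fastforce simp: stay_for_def stay_def le_iff_add)
  finally show ?thesis .
qed

text \<open>Beyond a ladder point the path visits only fresh sites as long as it stays above it, so the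
  future after that point is independent of the past.\<close>

lemma prob_ladder_stay:
  assumes ys: "ys \<in> step_lists m" "ladder ys" and zs: "zs \<in> step_lists n" "upward zs"
  shows "PL.prob (path_cylinder (ys @ zs) \<inter> stay (m + n) (hp ys m)) = W ys * PL.prob (path_cylinder zs \<inter> stay n 0)"
proof (rule LIMSEQ_unique[OF prob_cylinder_stay_limit])
  have len: "length ys = m" "length zs = n"
    using ys zs by (auto simp: step_lists_def)
  have "PL.prob (path_cylinder (ys @ zs) \<inter> stay_for (m + n) (hp ys m) N) = W ys * PL.prob (path_cylinder zs \<inter> stay_for n 0 N)" for N
  proof -
    have yz: "ys @ zs \<in> step_lists (m + n)"
      using ys zs by (auto simp: step_lists_def)
    have pos_yz: "pos (ys @ zs) (m + n) = pos ys m + pos zs n"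
      using pos_append_right[of ys zs n] len by simp
    have "(if \<forall>k\<le>N. hp ys m \<le> height (pos (ys @ zs) (m + n) + pos xs k) then W ((ys @ zs) @ xs) else 0) =
        W ys * (if \<forall>k\<le>N. 0 \<le> height (pos zs n + pos xs k) then W (zs @ xs) else 0)"
      if xs: "xs \<in> step_lists N" for xs
    proof (cases "\<forall>k\<le>N. 0 \<le> height (pos zs n + pos xs k)")
      case True
      have "W (ys @ zs @ xs) = W ys * W (zs @ xs)"
      proof (rule W_append)
        fix i j assume i: "i < length ys" and j: "j < length (zs @ xs)"
        have "0 \<le> hp (zs @ xs) j"
        proof (cases "j \<le> n")
          case True
          then show ?thesis using zs(2) len by (simp add: upward_def pos_append_left)
        next
          case False
          with le_Suc_ex[of n j] obtain k where k: "j = n + k" by auto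
          moreover have "k \<le> N"
            using j xs len k by (simp add: step_lists_def)
          ultimately show ?thesis using True pos_append_right[of zs xs k] len by simp
        qed
        then have "height (pos ys i) < height (pos ys (length ys) + pos (zs @ xs) j)"
          using ys(2) i by (force simp: ladder_def height_add)
        then show "pos ys i \<noteq> pos ys (length ys) + pos (zs @ xs) j" by auto
      qed
      with True show ?thesis by (simp add: pos_yz height_add add.assoc)
    next
      case False
      then show ?thesis by (auto simp: pos_yz height_add add.assoc)
    qed
    then show ?thesis
      unfolding prob_cylinder_stay_for[OF yz] prob_cylinder_stay_for[OF zs(1)] sum_distrib_left
      by (intro sum.cong refl)
  qed
  then show "(\<lambda>N. PL.prob (path_cylinder (ys @ zs) \<inter> stay_for (m + n) (hp ys m) N)) \<longlonglongrightarrow> W ys * PL.prob (path_cylinder zs \<inter> stay n 0)"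
    by (simp add: tendsto_mult_left prob_cylinder_stay_limit)
qed

text \<open>For j = 0 the joint condition on i and k is vacuous and \<open>regen 0\<close> contains
  every path; hence the explicit \<open>0 < j\<close> in what follows.\<close>

definition regen :: "nat \<Rightarrow> 'd path set" where
  "regen j = {X. \<forall>i k. i < j \<and> j < k \<longrightarrow> height (X i) < height (X j) \<and> height (X j) \<le> height (X k)}"

definition first_regen :: "nat \<Rightarrow> 'd path set" where
  "first_regen j = {X. 0 < j \<and> X \<in> regen j \<and> (\<forall>i. 0 < i \<and> i < j \<longrightarrow> X \<notin> regen i)}"

text \<open>Excludes only times below n, so that it is the event that the regeneration time is at
  least n and still contains \<open>first_regen n\<close>.\<close>

definition no_regen_before :: "nat \<Rightarrow> 'd path set" where
  "no_regen_before n = {X. \<forall>j. 0 < j \<and> j < n \<longrightarrow> X \<notin> regen j}"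

text \<open>The excluded cut points are those that any future above the endpoint would turn into
  regeneration times, which is why the condition on later heights stops at the end of the
  list.\<close>

definition irreducible_path :: "(int ^ 'd) list \<Rightarrow> bool" where
  "irreducible_path cs \<longleftrightarrow> cs \<noteq> [] \<and> ladder cs \<and>
     (\<forall>i. 0 < i \<and> i < length cs \<longrightarrow>
        \<not> ((\<forall>l<i. hp cs l < hp cs i) \<and> (\<forall>k. i \<le> k \<and> k \<le> length cs \<longrightarrow> hp cs i \<le> hp cs k)))"

lemma le_regeneration_time: "enat n \<le> regeneration_time u X \<longleftrightarrow> X \<in> no_regen_before n"
proof -
  have *: "{j. 0 < j \<and> (\<forall>i k. i < j \<and> j < k \<longrightarrow> embed (X i) \<bullet> u < embed (X j) \<bullet> u \<and>
      embed (X j) \<bullet> u \<le> embed (X k) \<bullet> u)} = {j. 0 < j \<and> X \<in> regen j}"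
    by (simp add: regen_def height_def)
  show ?thesis
    unfolding regeneration_time_def * le_Inf_iff no_regen_before_def
    by (auto simp flip: not_less)
qed

lemma regen_event [measurable]: "regen j \<in> PL.events"
proof -
  have "{X \<in> space path_law. height (X i) < height (X j) \<and> height (X j) \<le> height (X k)} \<in> PL.events" for i k
    by (intro sets.sets_Collect_conj borel_measurable_less borel_measurable_le measurable_height)
  then have "{X \<in> space path_law. i < j \<and> j < k \<longrightarrow> height (X i) < height (X j) \<and> height (X j) \<le> height (X k)} \<in> PL.events" for i k
    using sets.top[of path_law] by (cases "i < j \<and> j < k") auto
  then have "{X \<in> space path_law. \<forall>i k. i < j \<and> j < k \<longrightarrow> height (X i) < height (X j) \<and> height (X j) \<le> height (X k)} \<in> PL.events"
    by (intro sets.sets_Collect_countable_All)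
  then show ?thesis by (simp add: regen_def)
qed

lemma first_regen_event [measurable]: "first_regen j \<in> PL.events"
proof -
  have "{X \<in> space path_law. 0 < j \<and> X \<in> regen j \<and> (\<forall>i. 0 < i \<and> i < j \<longrightarrow> X \<notin> regen i)} \<in> PL.events"
    by measurable
  then show ?thesis by (simp add: first_regen_def)
qed

lemma no_regen_before_event [measurable]: "no_regen_before n \<in> PL.events"
proof -
  have "{X \<in> space path_law. \<forall>j. 0 < j \<and> j < n \<longrightarrow> X \<notin> regen j} \<in> PL.events"
    by measurable
  then show ?thesis by (simp add: no_regen_before_def)
qed

lemma first_regen_unique: "X \<in> first_regen i \<Longrightarrow> X \<in> first_regen j \<Longrightarrow> i = j"
  unfolding first_regen_def by (cases i j rule: linorder_cases) auto

lemma first_regen_exists: "X \<in> regen j \<Longrightarrow> 0 < j \<Longrightarrow> \<exists>i\<in>{1..j}. X \<in> first_regen i"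
proof (induction j rule: less_induct)
  case (less j)
  show ?case
  proof (cases "\<exists>i. 0 < i \<and> i < j \<and> X \<in> regen i")
    case True
    then obtain i where i: "0 < i" "i < j" "X \<in> regen i" by blast
    from less.IH[OF i(2,3,1)] i(2) show ?thesis by fastforce
  next
    case False
    with less.prems show ?thesis by (intro bexI[of _ j]) (auto simp: first_regen_def)
  qed
qed

lemma regen_eq: "0 < j \<Longrightarrow> regen j = {X. (\<forall>i<j. height (X i) < height (X j)) \<and> (\<forall>k>j. height (X j) \<le> height (X k))}"
  unfolding regen_def by blast

text \<open>That j is the first regeneration involves the whole future. Once the path is known to
  stay above its height at j, however, an earlier i is a regeneration as soon as its conditions hold
  up to time j: later heights are at least the height at j, and this is at least the height at
  i.\<close>

lemma cylinder_first_regen: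
  assumes cs: "length cs = n" and j: "1 \<le> j" "j \<le> n"
  shows "path_cylinder cs \<inter> first_regen j =
    (if irreducible_path (take j cs) \<and> upward (drop j cs) then path_cylinder cs \<inter> stay n (hp cs j) else {})"
proof -
  let ?ys = "take j cs" and ?zs = "drop j cs"
  have len: "length ?ys = j" "length ?zs = n - j"
    using cs j by auto
  have pos_ys: "pos ?ys i = pos cs i" if "i \<le> j" for i
    using that by (rule pos_take)
  have pos_zs: "pos cs (j + i) = pos cs j + pos ?zs i" for i
    using pos_append_right[of ?ys ?zs i] len pos_ys[of j] by simp
  have up: "upward ?zs \<longleftrightarrow> (\<forall>k. j \<le> k \<and> k \<le> n \<longrightarrow> hp cs j \<le> hp cs k)"
  proof -
    have "upward ?zs \<longleftrightarrow> (\<forall>i\<le>n - j. hp cs j \<le> hp cs (j + i))"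
      by (simp add: upward_def cs pos_zs height_add)
    also have "\<dots> \<longleftrightarrow> (\<forall>k. j \<le> k \<and> k \<le> n \<longrightarrow> hp cs j \<le> hp cs k)"
    proof safe
      fix k assume "\<forall>i\<le>n - j. hp cs j \<le> hp cs (j + i)" "j \<le> k" "k \<le> n"
      then show "hp cs j \<le> hp cs k" by (auto dest!: spec[of _ "k - j"])
    qed (use j in auto)
    finally show ?thesis .
  qed
  have main: "X \<in> first_regen j \<longleftrightarrow> irreducible_path ?ys \<and> upward ?zs \<and> X \<in> stay n (hp cs j)"
    if X: "X \<in> path_cylinder cs" for X
  proof -
    have Xi: "X i = pos cs i" if "i \<le> n" for i
      using X that cs by (auto simp: path_cylinder_def)
    have lad: "ladder ?ys \<longleftrightarrow> (\<forall>i<j. height (X i) < height (X j))"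
      unfolding ladder_def len using j by (simp add: pos_ys Xi)
    have ups: "upward ?zs \<and> X \<in> stay n (hp cs j) \<longleftrightarrow> (\<forall>k>j. height (X j) \<le> height (X k))" (is "?l \<longleftrightarrow> ?r")
    proof
      assume ?l
      show ?r
      proof safe
        fix k assume "j < k"
        show "height (X j) \<le> height (X k)"
        proof (cases "k \<le> n")
          case True
          then show ?thesis using \<open>?l\<close> \<open>j < k\<close> j by (simp add: up Xi)
        next
          case False
          then show ?thesis using \<open>?l\<close> j by (simp add: stay_def Xi)
        qed
      qed
    next
      assume r: ?r
      have *: "hp cs j \<le> height (X k)" if "j \<le> k" for k
        using r that j Xi[of j] by (cases "k = j") auto
      have "hp cs j \<le> hp cs k" if "j \<le> k" "k \<le> n" for k
        using *[OF that(1)] Xi[OF that(2)] by simp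
      moreover have "X \<in> stay n (hp cs j)"
        unfolding stay_def using * j by (auto intro: order_trans)
      ultimately show ?l by (simp add: up)
    qed
    have cut: "(\<forall>l<i. hp ?ys l < hp ?ys i) \<and> (\<forall>k. i \<le> k \<and> k \<le> length ?ys \<longrightarrow> hp ?ys i \<le> hp ?ys k) \<longleftrightarrow> X \<in> regen i"
      if i: "0 < i" "i < j" and r: "\<forall>k>j. height (X j) \<le> height (X k)" for i
    proof -
      have "(\<forall>l<i. hp ?ys l < hp ?ys i) \<longleftrightarrow> (\<forall>l<i. height (X l) < height (X i))"
        using i j by (simp add: pos_ys Xi)
      moreover have "(\<forall>k. i \<le> k \<and> k \<le> length ?ys \<longrightarrow> hp ?ys i \<le> hp ?ys k) \<longleftrightarrow> (\<forall>k>i. height (X i) \<le> height (X k))"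
      proof -
        have "(\<forall>k. i \<le> k \<and> k \<le> length ?ys \<longrightarrow> hp ?ys i \<le> hp ?ys k) \<longleftrightarrow> (\<forall>k. i \<le> k \<and> k \<le> j \<longrightarrow> height (X i) \<le> height (X k))"
          unfolding len using i j by (simp add: pos_ys Xi)
        also have "\<dots> \<longleftrightarrow> (\<forall>k>i. height (X i) \<le> height (X k))"
        proof safe
          fix k assume a: "\<forall>k. i \<le> k \<and> k \<le> j \<longrightarrow> height (X i) \<le> height (X k)" and "i < k"
          show "height (X i) \<le> height (X k)"
          proof (cases "k \<le> j")
            case False
            have "height (X i) \<le> height (X j)" using a i by simp
            also have "\<dots> \<le> height (X k)" using r False by simp
            finally show ?thesis .
          qed (use a \<open>i < k\<close> in simp)
        next
          fix k assume "\<forall>k>i. height (X i) \<le> height (X k)" "i \<le> k" "k \<le> j"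
          then show "height (X i) \<le> height (X k)" by (cases "i = k") auto
        qed
        finally show ?thesis .
      qed
      ultimately show ?thesis
        by (simp add: regen_eq[OF i(1)])
    qed
    have ne: "?ys \<noteq> []" using len(1) j by auto
    show ?thesis
    proof (cases "\<forall>k>j. height (X j) \<le> height (X k)")
      case True
      have "irreducible_path ?ys \<longleftrightarrow> ladder ?ys \<and> (\<forall>i. 0 < i \<and> i < j \<longrightarrow> X \<notin> regen i)"
        unfolding irreducible_path_def using ne cut[OF _ _ True] len(1) by metis
      moreover have "X \<in> regen j \<longleftrightarrow> ladder ?ys"
        using j True lad by (simp add: regen_eq)
      ultimately show ?thesis
        using ups True j by (auto simp: first_regen_def)
    next
      case False
      then show ?thesis
        using ups j by (auto simp: first_regen_def regen_eq)
    qed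
  qed
  then show ?thesis by auto
qed

lemma irreducible_imp_ladder: "irreducible_path cs \<Longrightarrow> ladder cs"
  by (simp add: irreducible_path_def)

definition upward_paths :: "'d path set" where
  "upward_paths = stay 0 0"

lemma upward_paths_event [measurable]: "upward_paths \<in> PL.events"
  by (simp add: upward_paths_def)

lemma cylinder_upward_paths:
  assumes "length cs = n"
  shows "path_cylinder cs \<inter> upward_paths = (if upward cs then path_cylinder cs \<inter> stay n 0 else {})"
proof -
  have "X \<in> stay 0 0 \<longleftrightarrow> upward cs \<and> X \<in> stay n 0" if "X \<in> path_cylinder cs" for X
  proof -
    have Xi: "X i = pos cs i" if "i \<le> n" for i
      using that assms \<open>X \<in> path_cylinder cs\<close> by (auto simp: path_cylinder_def)
    have "(\<forall>k. 0 \<le> height (X k)) \<longleftrightarrow> (\<forall>k\<le>n. 0 \<le> height (X k)) \<and> (\<forall>k\<ge>n. 0 \<le> height (X k))"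
      by (meson le_cases)
    then show ?thesis
      by (auto simp: stay_def upward_def assms Xi)
  qed
  then show ?thesis
    unfolding upward_paths_def by auto
qed

lemma prob_cylinder_first_regen:
  assumes "ys \<in> step_lists j" "zs \<in> step_lists m" "1 \<le> j"
  shows "PL.prob (path_cylinder (ys @ zs) \<inter> first_regen j) =
    (if irreducible_path ys then W ys * PL.prob (path_cylinder zs \<inter> upward_paths) else 0)"
proof -
  have len: "length ys = j" "length zs = m"
    using assms by (auto simp: step_lists_def)
  have "path_cylinder (ys @ zs) \<inter> first_regen j =
      (if irreducible_path ys \<and> upward zs then path_cylinder (ys @ zs) \<inter> stay (j + m) (hp ys j) else {})"
    using cylinder_first_regen[of "ys @ zs" "j + m" j] len assms(3) by (simp add: pos_append_left)
  then show ?thesis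
    using prob_ladder_stay[OF assms(1) irreducible_imp_ladder assms(2)] cylinder_upward_paths[OF len(2)] by auto
qed

text \<open>After a regeneration at j the path stays above its height at j, so whether it ever drops
  below 0 is decided by the first j steps.\<close>

lemma upward_paths_first_regen:
  assumes "ys \<in> step_lists j"
  shows "path_cylinder (ys @ zs) \<inter> upward_paths \<inter> first_regen j =
    (if upward ys then path_cylinder (ys @ zs) \<inter> first_regen j else {})"
proof -
  have len: "length ys = j"
    using assms by (simp add: step_lists_def)
  have "X \<in> upward_paths \<longleftrightarrow> upward ys" if X: "X \<in> path_cylinder (ys @ zs)" "X \<in> first_regen j" for X
  proof -
    have Xi: "X i = pos ys i" if "i \<le> j" for i
      using that len X(1) pos_append_left[of i ys zs] by (auto simp: path_cylinder_def)
    have j: "0 < j" "X \<in> regen j"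
      using X(2) by (auto simp: first_regen_def)
    have "X \<in> upward_paths \<longleftrightarrow> (\<forall>k. 0 \<le> height (X k))"
      by (simp add: upward_paths_def stay_def)
    also have "\<dots> \<longleftrightarrow> (\<forall>k\<le>j. 0 \<le> height (X k))"
    proof safe
      fix k assume a: "\<forall>k\<le>j. 0 \<le> height (X k)"
      show "0 \<le> height (X k)"
      proof (cases "k \<le> j")
        case False
        then have "height (X j) \<le> height (X k)"
          using j by (simp add: regen_eq)
        with a show ?thesis by (meson order_refl order_trans)
      qed (use a in simp)
    qed auto
    also have "\<dots> \<longleftrightarrow> upward ys"
      by (simp add: upward_def len Xi)
    finally show ?thesis .
  qed
  then show ?thesis by auto
qed

end

text \<open>Nonnegativity allows the passage between the unordered sum over blocks, used by the
  implicit function, and the series over their lengths, used by the renewal equation.\<close>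

lemma has_sum_iff_graded_sums:
  fixes h :: "'a \<Rightarrow> real" and l :: "'a \<Rightarrow> nat"
  assumes nonneg: "\<And>x. x \<in> A \<Longrightarrow> 0 \<le> h x" and fin: "\<And>n. finite {x \<in> A. l x = n}"
  shows "(h has_sum S) A \<longleftrightarrow> (\<lambda>n. \<Sum>x | x \<in> A \<and> l x = n. h x) sums S"
proof
  have fibre: "(h has_sum (\<Sum>x | x \<in> A \<and> l x = n. h x)) (A \<inter> l -` {n})" for n
  proof -
    have "A \<inter> l -` {n} = {x \<in> A. l x = n}" by auto
    then show ?thesis using fin[of n] by simp
  qed
  show "(\<lambda>n. \<Sum>x | x \<in> A \<and> l x = n. h x) sums S" if "(h has_sum S) A"
    by (rule has_sum_imp_sums[OF has_sum_fibres[OF that fibre]])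
  assume "(\<lambda>n. \<Sum>x | x \<in> A \<and> l x = n. h x) sums S"
  then have sum: "((\<lambda>n. \<Sum>x | x \<in> A \<and> l x = n. h x) has_sum S) UNIV"
    by (rule sums_nonneg_imp_has_sum) (auto intro: sum_nonneg nonneg)
  have bij: "bij_betw (\<lambda>x. (l x, x)) A (Sigma UNIV (\<lambda>n. A \<inter> l -` {n}))"
    by (rule bij_betwI[of _ _ _ snd]) auto
  have "((\<lambda>(n, x). h x) has_sum S) (Sigma UNIV (\<lambda>n. A \<inter> l -` {n}))"
  proof (rule has_sum_SigmaI[OF _ sum])
    show "(\<lambda>(n, x). h x) summable_on Sigma UNIV (\<lambda>n. A \<inter> l -` {n})"
      by (rule summable_on_SigmaI[OF _ has_sum_imp_summable[OF sum]]) (use fibre nonneg in auto)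
  qed (use fibre in auto)
  then show "(h has_sum S) A"
    using has_sum_reindex_bij_betw[OF bij, of "\<lambda>(n, x). h x" S] by simp
qed

context iid_walk
begin

section \<open>Tilted generating functions and renewal inequalities\<close>

definition tilt :: "real ^ 'd \<Rightarrow> (int ^ 'd) list \<Rightarrow> real" where
  "tilt \<theta> cs = exp (\<theta> \<bullet> embed (pos cs (length cs)))"

definition mgf :: "real ^ 'd \<Rightarrow> nat \<Rightarrow> real" where
  "mgf \<theta> n = (\<Sum>cs\<in>step_lists n. W cs * tilt \<theta> cs)"

definition upward_mgf :: "real ^ 'd \<Rightarrow> nat \<Rightarrow> real" where
  "upward_mgf \<theta> n = (\<Sum>cs\<in>step_lists n. PL.prob (path_cylinder cs \<inter> upward_paths) * tilt \<theta> cs)"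

definition unfinished_mgf :: "real ^ 'd \<Rightarrow> nat \<Rightarrow> real" where
  "unfinished_mgf \<theta> n = (\<Sum>cs\<in>step_lists n. PL.prob (path_cylinder cs \<inter> no_regen_before n) * tilt \<theta> cs)"

text \<open>The unconditioned walk may drop below its starting level before it regenerates, so a
  first block need not be upward; later blocks are.\<close>

definition initial_block :: "real ^ 'd \<Rightarrow> nat \<Rightarrow> real" where
  "initial_block \<theta> j = (\<Sum>cs | cs \<in> step_lists j \<and> irreducible_path cs. W cs * tilt \<theta> cs)"

definition block :: "real ^ 'd \<Rightarrow> nat \<Rightarrow> real" where
  "block \<theta> j = (\<Sum>cs | cs \<in> step_lists j \<and> irreducible_path cs \<and> upward cs. W cs * tilt \<theta> cs)"

definition escape_prob :: real where
  "escape_prob = PL.prob upward_paths"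

lemma tilt_pos [simp]: "0 < tilt \<theta> cs"
  by (simp add: tilt_def)

lemma tilt_nonneg [simp]: "0 \<le> tilt \<theta> cs"
  by (simp add: tilt_def)

lemma tilt_append: "tilt \<theta> (ys @ zs) = tilt \<theta> ys * tilt \<theta> zs"
  using pos_append_right[of ys zs "length zs"]
  by (simp add: tilt_def embed_add inner_add_right exp_add)

lemma tilt_Nil [simp]: "tilt \<theta> [] = 1"
  by (simp add: tilt_def)

lemma tilt_zero [simp]: "tilt 0 cs = 1"
  by (simp add: tilt_def)

lemma W_nonneg [simp]: "0 \<le> W cs"
  unfolding W_def by (intro integral_nonneg_AE) (simp add: path_weight_nonneg)

lemma block_nonneg [simp]: "0 \<le> block \<theta> j"
  by (simp add: block_def sum_nonneg)

lemma initial_block_nonneg [simp]: "0 \<le> initial_block \<theta> j"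
  by (simp add: initial_block_def sum_nonneg)

lemma upward_mgf_nonneg [simp]: "0 \<le> upward_mgf \<theta> n"
  by (simp add: upward_mgf_def sum_nonneg)

lemma block_0 [simp]: "block \<theta> 0 = 0"
  by (auto simp: block_def irreducible_path_def intro!: sum.neutral)

text \<open>At the first regeneration a path splits into an irreducible piece and an upward
  continuation, and the probability, the tilt and the set of step lists all factorise.\<close>

lemma sum_first_regen:
  assumes "1 \<le> j" "j \<le> n"
  shows "(\<Sum>cs\<in>step_lists n. PL.prob (path_cylinder cs \<inter> first_regen j) * tilt \<theta> cs) =
    initial_block \<theta> j * upward_mgf \<theta> (n - j)"
proof -
  have "(\<Sum>cs\<in>step_lists n. PL.prob (path_cylinder cs \<inter> first_regen j) * tilt \<theta> cs) =
      (\<Sum>ys\<in>step_lists j. \<Sum>zs\<in>step_lists (n - j). PL.prob (path_cylinder (ys @ zs) \<inter> first_regen j) * tilt \<theta> (ys @ zs))"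
    using sum_step_lists_append[of "\<lambda>cs. PL.prob (path_cylinder cs \<inter> first_regen j) * tilt \<theta> cs" j "n - j"] assms by simp
  also have "\<dots> = (\<Sum>ys\<in>step_lists j. \<Sum>zs\<in>step_lists (n - j). if irreducible_path ys
      then (W ys * tilt \<theta> ys) * (PL.prob (path_cylinder zs \<inter> upward_paths) * tilt \<theta> zs) else 0)"
    by (intro sum.cong refl) (simp add: prob_cylinder_first_regen[OF _ _ assms(1)] tilt_append)
  also have "\<dots> = (\<Sum>ys\<in>step_lists j. if irreducible_path ys then (W ys * tilt \<theta> ys) * upward_mgf \<theta> (n - j) else 0)"
    by (intro sum.cong refl) (simp add: upward_mgf_def sum_distrib_left)
  also have "\<dots> = initial_block \<theta> j * upward_mgf \<theta> (n - j)"
    unfolding initial_block_def sum_distrib_right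
    using sum.inter_filter[OF finite_step_lists[of j], of "\<lambda>ys. (W ys * tilt \<theta> ys) * upward_mgf \<theta> (n - j)" irreducible_path]
    by simp
  finally show ?thesis .
qed

lemma sum_upward_first_regen:
  assumes "1 \<le> j" "j \<le> n"
  shows "(\<Sum>cs\<in>step_lists n. PL.prob (path_cylinder cs \<inter> upward_paths \<inter> first_regen j) * tilt \<theta> cs) =
    block \<theta> j * upward_mgf \<theta> (n - j)"
proof -
  have "(\<Sum>cs\<in>step_lists n. PL.prob (path_cylinder cs \<inter> upward_paths \<inter> first_regen j) * tilt \<theta> cs) =
      (\<Sum>ys\<in>step_lists j. \<Sum>zs\<in>step_lists (n - j). PL.prob (path_cylinder (ys @ zs) \<inter> upward_paths \<inter> first_regen j) * tilt \<theta> (ys @ zs))"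
    using sum_step_lists_append[of "\<lambda>cs. PL.prob (path_cylinder cs \<inter> upward_paths \<inter> first_regen j) * tilt \<theta> cs" j "n - j"] assms by simp
  also have "\<dots> = (\<Sum>ys\<in>step_lists j. \<Sum>zs\<in>step_lists (n - j). if irreducible_path ys \<and> upward ys
      then (W ys * tilt \<theta> ys) * (PL.prob (path_cylinder zs \<inter> upward_paths) * tilt \<theta> zs) else 0)"
    by (intro sum.cong refl)
       (simp add: upward_paths_first_regen prob_cylinder_first_regen[OF _ _ assms(1)] tilt_append)
  also have "\<dots> = (\<Sum>ys\<in>step_lists j. if irreducible_path ys \<and> upward ys then (W ys * tilt \<theta> ys) * upward_mgf \<theta> (n - j) else 0)"
    by (intro sum.cong refl) (auto simp: upward_mgf_def sum_distrib_left intro!: sum.neutral)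
  also have "\<dots> = block \<theta> j * upward_mgf \<theta> (n - j)"
    unfolding block_def sum_distrib_right
    using sum.inter_filter[OF finite_step_lists[of j], of "\<lambda>ys. (W ys * tilt \<theta> ys) * upward_mgf \<theta> (n - j)" "\<lambda>ys. irreducible_path ys \<and> upward ys"]
    by simp
  finally show ?thesis .
qed

lemma no_regen_or_first_regen: "X \<in> no_regen_before n \<or> (\<exists>j\<in>{1..n}. X \<in> first_regen j)"
proof (cases "X \<in> no_regen_before n")
  case False
  then obtain j where j: "0 < j" "j < n" "X \<in> regen j"
    by (auto simp: no_regen_before_def)
  from first_regen_exists[OF j(3,1)] j(2) show ?thesis by fastforce
qed simp

lemma first_regen_subset: "first_regen j \<subseteq> no_regen_before j"
  by (auto simp: first_regen_def no_regen_before_def)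

text \<open>The pieces overlap in \<open>first_regen n\<close>, so this is a union bound; an
  inequality is enough for exponential rates.\<close>

lemma prob_decomp_le:
  assumes [measurable]: "A \<in> PL.events"
  shows "PL.prob A \<le> PL.prob (A \<inter> no_regen_before n) + (\<Sum>j=1..n. PL.prob (A \<inter> first_regen j))"
proof -
  have "PL.prob A \<le> PL.prob ((A \<inter> no_regen_before n) \<union> (\<Union>j\<in>{1..n}. A \<inter> first_regen j))"
    using no_regen_or_first_regen by (intro PL.finite_measure_mono) (auto intro!: sets.Un sets.finite_UN)
  also have "\<dots> \<le> PL.prob (A \<inter> no_regen_before n) + PL.prob (\<Union>j\<in>{1..n}. A \<inter> first_regen j)"
    by (rule measure_Un_le) (auto intro!: sets.finite_UN)
  also have "PL.prob (\<Union>j\<in>{1..n}. A \<inter> first_regen j) \<le> (\<Sum>j=1..n. PL.prob (A \<inter> first_regen j))"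
    by (rule PL.finite_measure_subadditive_finite) auto
  finally show ?thesis by simp
qed

lemma prob_decomp_ge:
  assumes [measurable]: "A \<in> PL.events"
  shows "(\<Sum>j=1..n. PL.prob (A \<inter> first_regen j)) \<le> PL.prob A"
proof -
  have "(\<Sum>j=1..n. PL.prob (A \<inter> first_regen j)) = PL.prob (\<Union>j\<in>{1..n}. A \<inter> first_regen j)"
    by (rule PL.finite_measure_finite_Union[symmetric])
       (use first_regen_unique in \<open>auto simp: disjoint_family_on_def\<close>)
  also have "\<dots> \<le> PL.prob A"
    by (intro PL.finite_measure_mono) auto
  finally show ?thesis .
qed

lemma mgf_le: "mgf \<theta> n \<le> unfinished_mgf \<theta> n + (\<Sum>j=1..n. initial_block \<theta> j * upward_mgf \<theta> (n - j))"
proof -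
  have "mgf \<theta> n \<le> (\<Sum>cs\<in>step_lists n. (PL.prob (path_cylinder cs \<inter> no_regen_before n) +
      (\<Sum>j=1..n. PL.prob (path_cylinder cs \<inter> first_regen j))) * tilt \<theta> cs)"
    unfolding mgf_def
  proof (intro sum_mono mult_right_mono)
    show "W cs \<le> PL.prob (path_cylinder cs \<inter> no_regen_before n) + (\<Sum>j=1..n. PL.prob (path_cylinder cs \<inter> first_regen j))" for cs
      using prob_decomp_le[of "path_cylinder cs" n] by (simp add: prob_path_cylinder)
  qed simp
  also have "\<dots> = unfinished_mgf \<theta> n + (\<Sum>cs\<in>step_lists n. \<Sum>j=1..n. PL.prob (path_cylinder cs \<inter> first_regen j) * tilt \<theta> cs)"
    by (simp only: distrib_right sum.distrib unfinished_mgf_def sum_distrib_right)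
  also have "(\<Sum>cs\<in>step_lists n. \<Sum>j=1..n. PL.prob (path_cylinder cs \<inter> first_regen j) * tilt \<theta> cs) =
      (\<Sum>j=1..n. initial_block \<theta> j * upward_mgf \<theta> (n - j))"
    by (subst sum.swap) (intro sum.cong refl, simp add: sum_first_regen)
  finally show ?thesis .
qed

lemma upward_mgf_le: "upward_mgf \<theta> n \<le> unfinished_mgf \<theta> n + (\<Sum>j=1..n. block \<theta> j * upward_mgf \<theta> (n - j))"
proof -
  have "upward_mgf \<theta> n \<le> (\<Sum>cs\<in>step_lists n. (PL.prob (path_cylinder cs \<inter> no_regen_before n) +
      (\<Sum>j=1..n. PL.prob (path_cylinder cs \<inter> upward_paths \<inter> first_regen j))) * tilt \<theta> cs)"
    unfolding upward_mgf_def
  proof (intro sum_mono mult_right_mono)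
    show "PL.prob (path_cylinder cs \<inter> upward_paths) \<le> PL.prob (path_cylinder cs \<inter> no_regen_before n) +
        (\<Sum>j=1..n. PL.prob (path_cylinder cs \<inter> upward_paths \<inter> first_regen j))" for cs
    proof -
      \<comment> \<open>The half-space constraint is dropped in the unfinished part, so that one
        sequence serves both generating functions.\<close>
      have "PL.prob (path_cylinder cs \<inter> upward_paths \<inter> no_regen_before n) \<le> PL.prob (path_cylinder cs \<inter> no_regen_before n)"
        by (intro PL.finite_measure_mono) auto
      with prob_decomp_le[of "path_cylinder cs \<inter> upward_paths" n] show ?thesis by simp
    qed
  qed simp
  also have "\<dots> = unfinished_mgf \<theta> n + (\<Sum>cs\<in>step_lists n. \<Sum>j=1..n. PL.prob (path_cylinder cs \<inter> upward_paths \<inter> first_regen j) * tilt \<theta> cs)"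
    by (simp only: distrib_right sum.distrib unfinished_mgf_def sum_distrib_right)
  also have "(\<Sum>cs\<in>step_lists n. \<Sum>j=1..n. PL.prob (path_cylinder cs \<inter> upward_paths \<inter> first_regen j) * tilt \<theta> cs) =
      (\<Sum>j=1..n. block \<theta> j * upward_mgf \<theta> (n - j))"
    by (subst sum.swap) (intro sum.cong refl, simp add: sum_upward_first_regen)
  finally show ?thesis .
qed

lemma upward_mgf_ge: "(\<Sum>j=1..n. block \<theta> j * upward_mgf \<theta> (n - j)) \<le> upward_mgf \<theta> n"
proof -
  have "(\<Sum>j=1..n. block \<theta> j * upward_mgf \<theta> (n - j)) =
      (\<Sum>j=1..n. \<Sum>cs\<in>step_lists n. PL.prob (path_cylinder cs \<inter> upward_paths \<inter> first_regen j) * tilt \<theta> cs)"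
    by (intro sum.cong refl) (simp add: sum_upward_first_regen)
  also have "\<dots> = (\<Sum>cs\<in>step_lists n. (\<Sum>j=1..n. PL.prob (path_cylinder cs \<inter> upward_paths \<inter> first_regen j)) * tilt \<theta> cs)"
    by (subst sum.swap) (simp only: sum_distrib_right)
  also have "\<dots> \<le> upward_mgf \<theta> n"
    unfolding upward_mgf_def by (intro sum_mono mult_right_mono prob_decomp_ge) auto
  finally show ?thesis .
qed

lemma upward_mgf_0: "upward_mgf \<theta> 0 = escape_prob"
  using prob_eq_sum_cylinders[OF upward_paths_event, of 0] by (simp add: upward_mgf_def escape_prob_def)

lemma upward_mgf_le_mgf: "upward_mgf \<theta> n \<le> mgf \<theta> n"
  unfolding upward_mgf_def mgf_def prob_path_cylinder[symmetric]
  by (intro sum_mono mult_right_mono PL.finite_measure_mono) auto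

text \<open>Moment bounds pass from the regeneration time to block weights in this way: an escape
  after the block, of probability \<open>escape_prob\<close>, makes its end the first
  regeneration.\<close>

lemma initial_block_le: "initial_block \<theta> j * escape_prob \<le> unfinished_mgf \<theta> j" if "1 \<le> j"
proof -
  have "initial_block \<theta> j * escape_prob = (\<Sum>cs\<in>step_lists j. PL.prob (path_cylinder cs \<inter> first_regen j) * tilt \<theta> cs)"
    using sum_first_regen[OF that, of j] by (simp add: upward_mgf_0)
  also have "\<dots> \<le> unfinished_mgf \<theta> j"
    unfolding unfinished_mgf_def using first_regen_subset[of j]
    by (intro sum_mono mult_right_mono PL.finite_measure_mono) auto
  finally show ?thesis .
qed

lemma block_le_initial_block: "block \<theta> j \<le> initial_block \<theta> j"
  unfolding block_def initial_block_def using finite_step_lists[of j]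
  by (intro sum_mono2) auto

lemma block_le: "block \<theta> j * escape_prob \<le> unfinished_mgf \<theta> j" if "1 \<le> j"
  using mult_right_mono[OF block_le_initial_block[of \<theta> j], of escape_prob] initial_block_le[OF that, of \<theta>]
  by (simp add: escape_prob_def)

lemma prob_first_regen: "PL.prob (first_regen j) = initial_block 0 j * escape_prob" if "1 \<le> j"
  using sum_first_regen[OF that, of j 0] prob_eq_sum_cylinders[of "first_regen j" j] by (simp add: upward_mgf_0)

lemma prob_upward_first_regen: "PL.prob (upward_paths \<inter> first_regen j) = block 0 j * escape_prob" if "1 \<le> j"
  using sum_upward_first_regen[OF that, of j 0] prob_eq_sum_cylinders[of "upward_paths \<inter> first_regen j" j]
  by (simp add: upward_mgf_0 Int_assoc)

lemma first_regen_0 [simp]: "first_regen 0 = {}"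
  by (simp add: first_regen_def)

section \<open>Almost sure regeneration and the exponential rate\<close>

definition regenerates :: bool where
  "regenerates \<longleftrightarrow> (AE X in path_law. \<exists>j. X \<in> first_regen j)"

lemma sums_prob_first_regen:
  assumes regenerates and A [measurable]: "A \<in> PL.events"
  shows "(\<lambda>j. PL.prob (A \<inter> first_regen j)) sums PL.prob A"
proof -
  have "(\<lambda>j. PL.prob (A \<inter> first_regen j)) sums PL.prob (\<Union>j. A \<inter> first_regen j)"
    by (rule PL.finite_measure_UNION) (use first_regen_unique in \<open>auto simp: disjoint_family_on_def\<close>)
  also have "PL.prob (\<Union>j. A \<inter> first_regen j) = PL.prob A"
    by (rule PL.finite_measure_eq_AE) (use assms(1) in \<open>auto simp: regenerates_def\<close>)
  finally show ?thesis .
qed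

text \<open>By \<open>prob_first_regen\<close> every first regeneration carries the factor
  \<open>escape_prob\<close>; if it vanished, regeneration would have probability 0.\<close>

lemma escape_prob_pos: "0 < escape_prob" if regenerates
proof (rule ccontr)
  assume "\<not> 0 < escape_prob"
  then have "escape_prob = 0"
    using measure_nonneg[of path_law upward_paths] by (simp add: escape_prob_def)
  then have "PL.prob (first_regen j) = 0" for j
    using prob_first_regen[of j] by (cases "j = 0") auto
  then have "(\<lambda>_. 0 :: real) sums PL.prob (space path_law)"
    using sums_prob_first_regen[OF that sets.top] by simp
  then have "PL.prob (space path_law) = 0"
    using sums_unique2 sums_zero by blast
  then show False
    using PL.prob_space by simp
qed

text \<open>Decomposing \<open>upward_paths\<close> by the first regeneration gives terms
  \<open>block 0 j * escape_prob\<close> that add up to \<open>escape_prob\<close>; the common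
  factor is positive and cancels.\<close>

lemma block_zero_sums: "block 0 sums 1" if regenerates
proof -
  have "(\<lambda>j. block 0 j * escape_prob) sums escape_prob"
  proof -
    have "PL.prob (upward_paths \<inter> first_regen j) = block 0 j * escape_prob" for j
      using prob_upward_first_regen[of j] by (cases "j = 0") auto
    then show ?thesis
      using sums_prob_first_regen[OF that upward_paths_event] by (simp add: escape_prob_def)
  qed
  from sums_divide[OF this, of escape_prob] show ?thesis
    using escape_prob_pos[OF that] by simp
qed

lemma integral_exp_path:
  "(\<integral>(\<omega>, X). exp (\<theta> \<bullet> embed (X n)) \<partial>averaged P 0) = mgf \<theta> n"
proof -
  let ?h = "\<lambda>X. exp (\<theta> \<bullet> embed (X n))"
  have h [measurable]: "?h \<in> borel_measurable path_space"
    by (rule measurable_compose[OF measurable_path_component]) simp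
  have "(\<integral>(\<omega>, X). exp (\<theta> \<bullet> embed (X n)) \<partial>averaged P 0) = (\<integral>X. ?h X \<partial>path_law)"
    unfolding path_law_def by (subst integral_distr[OF measurable_snd_averaged h]) (simp add: case_prod_unfold)
  also have "\<dots> = (\<integral>X. (\<Sum>cs\<in>step_lists n. tilt \<theta> cs * indicator (path_cylinder cs) X) \<partial>path_law)"
  proof (rule integral_cong_AE)
    show "AE X in path_law. ?h X = (\<Sum>cs\<in>step_lists n. tilt \<theta> cs * indicator (path_cylinder cs) X)"
      using AE_path_cylinder[of n]
    proof eventually_elim
      case (elim X)
      then obtain ds where ds: "ds \<in> step_lists n" "X \<in> path_cylinder ds" by blast
      have "(\<Sum>cs\<in>step_lists n. tilt \<theta> cs * indicator (path_cylinder cs) X) = (\<Sum>cs\<in>step_lists n. if cs = ds then tilt \<theta> ds else 0)"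
      proof (intro sum.cong refl)
        fix cs :: "(int ^ 'd) list" assume "cs \<in> step_lists n"
        then have "X \<in> path_cylinder cs \<longleftrightarrow> cs = ds"
          using ds path_cylinder_inj[OF _ ds(2), of cs] by (auto simp: step_lists_def)
        then show "tilt \<theta> cs * indicator (path_cylinder cs) X = (if cs = ds then tilt \<theta> ds else 0)"
          by (auto simp: indicator_def)
      qed
      also have "\<dots> = tilt \<theta> ds"
        by (subst sum.delta[OF finite_step_lists]) (simp add: ds)
      also have "\<dots> = ?h X"
        using ds by (simp add: tilt_def path_cylinder_def step_lists_def)
      finally show ?case by simp
    qed
  qed (use h in \<open>simp_all add: measurable_cong_sets[OF sets_path_law refl]\<close>)
  also have "\<dots> = (\<Sum>cs\<in>step_lists n. \<integral>X. tilt \<theta> cs * indicator (path_cylinder cs) X \<partial>path_law)"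
    by (rule Bochner_Integration.integral_sum)
       (auto intro!: integrable_mult_right integrable_real_indicator simp: less_top[symmetric])
  also have "\<dots> = mgf \<theta> n"
    by (simp add: mgf_def mult.commute prob_path_cylinder)
  finally show ?thesis .
qed

lemma log_mgf_eq_lim: "log_mgf P \<theta> = lim (\<lambda>n. ln (mgf \<theta> n) / real n)"
  unfolding log_mgf_def integral_exp_path ..

text \<open>The condition under which the renewal inequalities determine the exponential rate: the
  unfinished part must not outgrow a solution r of the root equation.\<close>

definition regular :: "real ^ 'd \<Rightarrow> real \<Rightarrow> bool" where
  "regular \<theta> r \<longleftrightarrow> (\<exists>C. \<forall>n. unfinished_mgf \<theta> n \<le> C * exp (r * real n))"

lemma regular_mono: "regular \<theta> r \<Longrightarrow> r \<le> s \<Longrightarrow> regular \<theta> s"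
proof -
  assume "regular \<theta> r" and rs: "r \<le> s"
  then obtain C where C: "\<And>n. unfinished_mgf \<theta> n \<le> C * exp (r * real n)"
    by (auto simp: regular_def)
  have "unfinished_mgf \<theta> n \<le> \<bar>C\<bar> * exp (s * real n)" for n
  proof -
    have "C * exp (r * real n) \<le> \<bar>C\<bar> * exp (s * real n)"
      using rs by (intro mult_mono) (auto intro: mult_right_mono)
    with C[of n] show ?thesis by linarith
  qed
  then show ?thesis by (auto simp: regular_def)
qed

text \<open>After multiplication by \<open>exp (- r * n)\<close> the upward part grows at most
  linearly, by \<open>renewal_upper_bound\<close>. The initial blocks are then merely bounded, so
  summing them against the linear bound costs a second power of n.\<close>

lemma mgf_upper_bound:
  assumes regenerates "regular \<theta> r" and le: "\<And>n. (\<Sum>j=1..n. block \<theta> j * exp (- r * real j)) \<le> 1"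
  shows "\<exists>K\<ge>0. \<forall>n. mgf \<theta> n \<le> K * (real n + 1)\<^sup>2 * exp (r * real n)"
proof -
  obtain C\<^sub>0 where C\<^sub>0: "\<And>n. unfinished_mgf \<theta> n \<le> C\<^sub>0 * exp (r * real n)"
    using assms(2) by (auto simp: regular_def)
  define C where "C = \<bar>C\<^sub>0\<bar>"
  have C: "0 \<le> C" "unfinished_mgf \<theta> n * exp (- r * real n) \<le> C" for n
  proof -
    have "unfinished_mgf \<theta> n * exp (- r * real n) \<le> C\<^sub>0 * exp (r * real n) * exp (- r * real n)"
      by (intro mult_right_mono C\<^sub>0) auto
    also have "\<dots> = C\<^sub>0" by (simp add: mult.assoc flip: exp_add)
    finally show "unfinished_mgf \<theta> n * exp (- r * real n) \<le> C" by (simp add: C_def)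
  qed (simp add: C_def)
  have p: "0 < escape_prob" by (rule escape_prob_pos[OF assms(1)])
  have exp_split: "a * b * exp (- r * real n) = (a * exp (- r * real j)) * (b * exp (- r * real (n - j)))" if "j \<le> n" for a b n j
  proof -
    have "exp (- r * real n) = exp (- r * real j) * exp (- r * real (n - j))"
      using that by (simp add: of_nat_diff algebra_simps flip: exp_add)
    then show ?thesis by simp
  qed
  define z where "z n = upward_mgf \<theta> n * exp (- r * real n)" for n
  have z_le: "z n \<le> C * (real n + 1)" for n
  proof (rule renewal_upper_bound[where f = "\<lambda>j. block \<theta> j * exp (- r * real j)"])
    fix n
    have "z n \<le> (unfinished_mgf \<theta> n + (\<Sum>j=1..n. block \<theta> j * upward_mgf \<theta> (n - j))) * exp (- r * real n)"
      unfolding z_def by (intro mult_right_mono upward_mgf_le) auto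
    also have "\<dots> = unfinished_mgf \<theta> n * exp (- r * real n) + (\<Sum>j=1..n. block \<theta> j * exp (- r * real j) * z (n - j))"
      unfolding distrib_right sum_distrib_right z_def by (intro arg_cong2[of _ _ _ _ "(+)"] sum.cong refl exp_split) auto
    finally show "z n \<le> C + (\<Sum>j=1..n. block \<theta> j * exp (- r * real j) * z (n - j))"
      using C(2)[of n] by simp
  qed (use C le in auto)
  have q_le: "initial_block \<theta> j * exp (- r * real j) \<le> C / escape_prob" if "1 \<le> j" for j
  proof -
    have "initial_block \<theta> j * escape_prob * exp (- r * real j) \<le> C"
      by (rule order_trans[OF mult_right_mono[OF initial_block_le[OF that]] C(2)]) simp
    then show ?thesis using p by (simp add: pos_le_divide_eq mult_ac)
  qed
  define K where "K = C + C / escape_prob * C"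
  have "0 \<le> K"
    using C p by (simp add: K_def)
  have "mgf \<theta> n \<le> K * (real n + 1)\<^sup>2 * exp (r * real n)" for n
  proof -
    have "mgf \<theta> n * exp (- r * real n) \<le> (unfinished_mgf \<theta> n + (\<Sum>j=1..n. initial_block \<theta> j * upward_mgf \<theta> (n - j))) * exp (- r * real n)"
      by (intro mult_right_mono mgf_le) auto
    also have "\<dots> = unfinished_mgf \<theta> n * exp (- r * real n) + (\<Sum>j=1..n. initial_block \<theta> j * exp (- r * real j) * z (n - j))"
      unfolding distrib_right sum_distrib_right z_def by (intro arg_cong2[of _ _ _ _ "(+)"] sum.cong refl exp_split) auto
    also have "\<dots> \<le> C + (\<Sum>j=1..n. C / escape_prob * (C * (real n + 1)))"
    proof (intro add_mono C sum_mono mult_mono q_le)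
      fix j assume "j \<in> {1..n}"
      show "z (n - j) \<le> C * (real n + 1)"
        by (rule order_trans[OF z_le]) (use C in \<open>auto intro: mult_left_mono\<close>)
      show "0 \<le> z (n - j)" by (simp add: z_def)
    qed (use C p in auto)
    also have "\<dots> = C + C / escape_prob * C * (real n * (real n + 1))"
      by simp
    also have "\<dots> \<le> C * (real n + 1)\<^sup>2 + C / escape_prob * C * (real n + 1)\<^sup>2"
    proof (intro add_mono mult_left_mono)
      show "C \<le> C * (real n + 1)\<^sup>2"
        using C(1) by (simp add: mult_le_cancel_left1 power2_eq_square algebra_simps)
      show "real n * (real n + 1) \<le> (real n + 1)\<^sup>2"
        by (simp add: power2_eq_square algebra_simps)
    qed (use C p in auto)
    also have "\<dots> = K * (real n + 1)\<^sup>2"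
      by (simp add: K_def algebra_simps)
    finally have "mgf \<theta> n * exp (- r * real n) * exp (r * real n) \<le> K * (real n + 1)\<^sup>2 * exp (r * real n)"
      by (intro mult_right_mono) auto
    then show ?thesis
      by (simp add: mult.assoc flip: exp_add)
  qed
  with \<open>0 \<le> K\<close> show ?thesis by blast
qed

lemma exists_upward_step: "\<exists>z\<in>unit_steps. 0 < height z"
proof -
  have "u \<noteq> 0" using norm_u by auto
  then obtain i where i: "u $ i \<noteq> 0" by (auto simp: vec_eq_iff)
  define z :: "int ^ 'd" where "z = axis i (if 0 < u $ i then 1 else - 1)"
  have "z \<in> unit_steps"
    by (simp add: z_def unit_steps_def axis_def if_distrib[of abs] cong: if_cong)
  moreover have "embed z = axis i (if 0 < u $ i then 1 else - 1)"
    by (simp add: z_def embed_def axis_def vec_eq_iff)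
  then have "height z = (if 0 < u $ i then 1 else - 1) * u $ i"
    by (simp add: height_def inner_axis' inner_real_def)
  then have "0 < height z" using i by (auto split: if_splits)
  ultimately show ?thesis by blast
qed

lemma single_step_block:
  assumes "z \<in> unit_steps" "0 < height z"
  shows "[z] \<in> step_lists 1 \<and> irreducible_path [z] \<and> upward [z]"
  using assms by (auto simp: step_lists_def irreducible_path_def ladder_def upward_def pos_def le_Suc_eq)

lemma block_1_pos: "0 < block \<theta> 1"
proof -
  obtain z where "z \<in> unit_steps" "0 < height z"
    using exists_upward_step by blast
  note z = single_step_block[OF this]
  show ?thesis
    unfolding block_def using z finite_step_lists[of 1] W_pos
    by (intro sum_pos2[of _ "[z]"]) auto
qed

text \<open>The block weights discounted at rate r form a probability on lengths with an atom at 1,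
  so \<open>renewal_lower_bound\<close> applies to the upward part, which the full generating
  function dominates.\<close>

lemma mgf_lower_bound:
  assumes regenerates and sums: "(\<lambda>j. block \<theta> j * exp (- r * real j)) sums 1" and \<epsilon>: "0 < \<epsilon>"
  shows "\<exists>c>0. \<forall>n. c * exp ((r - \<epsilon>) * real n) \<le> mgf \<theta> n"
proof -
  define z where "z n = upward_mgf \<theta> n * exp (- r * real n)" for n
  have "\<exists>c>0. \<forall>n. c * exp (- \<epsilon> * real n) \<le> z n"
  proof (rule renewal_lower_bound[OF _ _ _ _ _ _ sums \<epsilon>])
    fix n
    have "(\<Sum>j=1..n. block \<theta> j * exp (- r * real j) * z (n - j)) = (\<Sum>j=1..n. block \<theta> j * upward_mgf \<theta> (n - j)) * exp (- r * real n)"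
      unfolding sum_distrib_right z_def
    proof (intro sum.cong refl)
      fix j assume "j \<in> {1..n}"
      then have "exp (- r * real n) = exp (- r * real j) * exp (- r * real (n - j))"
        by (simp add: of_nat_diff algebra_simps flip: exp_add)
      then show "block \<theta> j * exp (- r * real j) * (upward_mgf \<theta> (n - j) * exp (- r * real (n - j))) =
          block \<theta> j * upward_mgf \<theta> (n - j) * exp (- r * real n)" by simp
    qed
    also have "\<dots> \<le> z n"
      unfolding z_def by (intro mult_right_mono upward_mgf_ge) auto
    finally show "(\<Sum>j=1..n. block \<theta> j * exp (- r * real j) * z (n - j)) \<le> z n" .
  qed (use escape_prob_pos[OF assms(1)] block_1_pos in \<open>simp_all add: z_def upward_mgf_0\<close>)
  then obtain c where c: "0 < c" "\<And>n. c * exp (- \<epsilon> * real n) \<le> z n" by blast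
  have "c * exp ((r - \<epsilon>) * real n) \<le> mgf \<theta> n" for n
  proof -
    have "c * exp ((r - \<epsilon>) * real n) = c * exp (- \<epsilon> * real n) * exp (r * real n)"
      by (simp add: algebra_simps flip: exp_add)
    also have "\<dots> \<le> z n * exp (r * real n)"
      by (intro mult_right_mono c) auto
    also have "\<dots> = upward_mgf \<theta> n"
      by (simp add: z_def mult.assoc flip: exp_add)
    also have "\<dots> \<le> mgf \<theta> n" by (rule upward_mgf_le_mgf)
    finally show ?thesis .
  qed
  with c(1) show ?thesis by blast
qed

lemma polynomial_exp_upper:
  assumes "\<exists>K\<ge>0. \<forall>n. Z n \<le> K * (real n + 1)\<^sup>2 * exp (r * real n)" "0 < \<epsilon>"
  shows "\<exists>C. \<forall>n. Z n \<le> C * exp ((r + \<epsilon>) * real n)"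
proof -
  obtain K where K: "0 \<le> K" "\<And>n. Z n \<le> K * (real n + 1)\<^sup>2 * exp (r * real n)"
    using assms(1) by blast
  obtain L where L: "\<And>n. (real n + 1)\<^sup>2 \<le> L * exp (\<epsilon> * real n)"
    using square_le_exp[OF assms(2)] by blast
  have "Z n \<le> K * L * exp ((r + \<epsilon>) * real n)" for n
  proof -
    have "K * (real n + 1)\<^sup>2 * exp (r * real n) \<le> K * (L * exp (\<epsilon> * real n)) * exp (r * real n)"
      using K(1) L by (intro mult_right_mono mult_left_mono) auto
    also have "\<dots> = K * L * exp ((r + \<epsilon>) * real n)"
      by (simp add: algebra_simps flip: exp_add)
    finally show ?thesis using K(2)[of n] by linarith
  qed
  then show ?thesis by blast
qed

text \<open>The two growth bounds squeeze the logarithm, so the limit exists and equals r. This is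
  what later turns the implicit function into \<open>log_mgf\<close>.\<close>

theorem log_mgf_eq_root:
  assumes regenerates "regular \<theta> r" and sums: "(\<lambda>j. block \<theta> j * exp (- r * real j)) sums 1"
  shows "log_mgf P \<theta> = r"
proof -
  have "(\<Sum>j=1..n. block \<theta> j * exp (- r * real j)) \<le> 1" for n
  proof -
    have "(\<Sum>j\<in>{1..n}. block \<theta> j * exp (- r * real j)) \<le> (\<Sum>j. block \<theta> j * exp (- r * real j))"
      by (rule sum_le_suminf) (use sums in \<open>auto simp: sums_iff\<close>)
    then show ?thesis using sums by (simp add: sums_iff)
  qed
  from mgf_upper_bound[OF assms(1,2) this]
  have "(\<lambda>n. ln (mgf \<theta> n) / real n) \<longlonglongrightarrow> r"
    by (intro exponential_rate mgf_lower_bound[OF assms(1) sums] polynomial_exp_upper)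
  then show ?thesis
    unfolding log_mgf_eq_lim by (rule limI)
qed

end

section \<open>Exponential moments of the regeneration time\<close>

context iid_walk
begin

lemma nn_integral_path_law:
  assumes "G \<in> borel_measurable path_space"
  shows "(\<integral>\<^sup>+X. G X \<partial>path_law) = (\<integral>\<^sup>+(\<omega>, X). G X \<partial>averaged P 0)"
  unfolding path_law_def
  by (subst nn_integral_distr[OF measurable_snd_averaged]) (use assms in \<open>simp_all add: case_prod_unfold\<close>)

lemma not_first_regen_iff: "(\<nexists>j. X \<in> first_regen j) \<longleftrightarrow> (\<forall>n. X \<in> no_regen_before n)"
proof
  assume "\<nexists>j. X \<in> first_regen j"
  then show "\<forall>n. X \<in> no_regen_before n"
    using no_regen_or_first_regen by blast
next
  assume "\<forall>n. X \<in> no_regen_before n"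
  then have "X \<notin> regen j" if "0 < j" for j
    using that unfolding no_regen_before_def by blast
  then show "\<nexists>j. X \<in> first_regen j"
    by (auto simp: first_regen_def)
qed

lemma unfinished_mgf_as_nn_integral:
  "ennreal (unfinished_mgf \<theta> n) =
    (\<integral>\<^sup>+X. (\<Sum>cs\<in>step_lists n. ennreal (tilt \<theta> cs) * indicator (path_cylinder cs \<inter> no_regen_before n) X) \<partial>path_law)"
proof -
  have "(\<integral>\<^sup>+X. (\<Sum>cs\<in>step_lists n. ennreal (tilt \<theta> cs) * indicator (path_cylinder cs \<inter> no_regen_before n) X) \<partial>path_law) =
      (\<Sum>cs\<in>step_lists n. \<integral>\<^sup>+X. ennreal (tilt \<theta> cs) * indicator (path_cylinder cs \<inter> no_regen_before n) X \<partial>path_law)"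
    by (rule nn_integral_sum) auto
  also have "\<dots> = (\<Sum>cs\<in>step_lists n. ennreal (tilt \<theta> cs * PL.prob (path_cylinder cs \<inter> no_regen_before n)))"
    by (intro sum.cong refl) (simp add: nn_integral_cmult_indicator PL.emeasure_eq_measure ennreal_mult)
  also have "\<dots> = ennreal (unfinished_mgf \<theta> n)"
    by (simp add: sum_ennreal unfinished_mgf_def mult.commute)
  finally show ?thesis by simp
qed

lemma sum_cylinder_indicators_le:
  fixes X :: "'d path"
  assumes "\<And>cs. cs \<in> step_lists n \<Longrightarrow> X \<in> path_cylinder cs \<Longrightarrow> X \<in> A \<Longrightarrow> ennreal (a cs) \<le> B"
  shows "(\<Sum>cs\<in>step_lists n. ennreal (a cs) * indicator (path_cylinder cs \<inter> A) X) \<le> B"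
proof (cases "\<exists>ds\<in>step_lists n. X \<in> path_cylinder ds \<and> X \<in> A")
  case True
  then obtain ds where ds: "ds \<in> step_lists n" "X \<in> path_cylinder ds" "X \<in> A" by blast
  have "(\<Sum>cs\<in>step_lists n. ennreal (a cs) * indicator (path_cylinder cs \<inter> A) X) =
      (\<Sum>cs\<in>step_lists n. if cs = ds then ennreal (a ds) else 0)"
  proof (intro sum.cong refl)
    fix cs :: "(int ^ 'd) list" assume "cs \<in> step_lists n"
    then have "X \<in> path_cylinder cs \<longleftrightarrow> cs = ds"
      using ds path_cylinder_inj[OF _ ds(2), of cs] by (auto simp: step_lists_def)
    then show "ennreal (a cs) * indicator (path_cylinder cs \<inter> A) X = (if cs = ds then ennreal (a ds) else 0)"
      using ds by (auto simp: indicator_def)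
  qed
  also have "\<dots> = ennreal (a ds)"
    by (subst sum.delta[OF finite_step_lists]) (simp add: ds)
  finally show ?thesis
    using assms ds by simp
next
  case False
  then have "(\<Sum>cs\<in>step_lists n. ennreal (a cs) * indicator (path_cylinder cs \<inter> A) X) = 0"
    by (intro sum.neutral) (auto simp: indicator_def)
  then show ?thesis by simp
qed

lemma measurable_cylinder_sum:
  "(\<lambda>X. \<Sum>cs\<in>step_lists n. ennreal (a cs) * indicator (path_cylinder cs \<inter> no_regen_before m) X) \<in> borel_measurable path_space"
proof -
  have "(\<lambda>X. \<Sum>cs\<in>step_lists n. ennreal (a cs) * indicator (path_cylinder cs \<inter> no_regen_before m) X) \<in> borel_measurable path_law"
    by measurable
  then show ?thesis
    by (simp add: measurable_cong_sets[OF sets_path_law refl])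
qed

text \<open>At most one cylinder of length n contains the path, so the tilted unfinished weight is
  the integral of a step function below F. The transfer from \<open>path_law\<close> to
  \<open>averaged\<close> is made for this step function, which is measurable; F is only compared
  with it pointwise.\<close>

lemma regular_unfinished_bound:
  assumes le: "\<And>n X cs. 1 \<le> n \<Longrightarrow> cs \<in> step_lists n \<Longrightarrow> X \<in> path_cylinder cs \<Longrightarrow> enat n \<le> regeneration_time u X \<Longrightarrow>
      ennreal (tilt \<theta> cs * exp (- r * real n)) \<le> F X"
    and fin: "(\<integral>\<^sup>+(\<omega>, X). F X \<partial>averaged P 0) < \<infinity>"
  shows "regular \<theta> r"
proof -
  obtain M where M: "0 \<le> M" "(\<integral>\<^sup>+(\<omega>, X). F X \<partial>averaged P 0) = ennreal M"
    using fin by (cases "\<integral>\<^sup>+(\<omega>, X). F X \<partial>averaged P 0") auto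
  have "unfinished_mgf \<theta> n \<le> max 1 M * exp (r * real n)" for n
  proof (cases "n = 0")
    \<comment> \<open>The hypothesis starts at n = 1, as does the supremum in
      \<open>range_exp_moment\<close>; \<open>max 1 M\<close> covers n = 0.\<close>
    case True
    then show ?thesis
      using PL.prob_le_1[of "path_cylinder [] \<inter> no_regen_before 0"] by (simp add: unfinished_mgf_def le_max_iff_disj)
  next
    case False
    let ?G = "\<lambda>X. \<Sum>cs\<in>step_lists n. ennreal (tilt \<theta> cs * exp (- r * real n)) * indicator (path_cylinder cs \<inter> no_regen_before n) X"
    have "ennreal (exp (- r * real n) * unfinished_mgf \<theta> n) = ennreal (exp (- r * real n)) * ennreal (unfinished_mgf \<theta> n)"
      by (rule ennreal_mult) (auto simp: unfinished_mgf_def intro!: sum_nonneg)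
    also have "\<dots> = (\<integral>\<^sup>+X. ennreal (exp (- r * real n)) *
        (\<Sum>cs\<in>step_lists n. ennreal (tilt \<theta> cs) * indicator (path_cylinder cs \<inter> no_regen_before n) X) \<partial>path_law)"
      unfolding unfinished_mgf_as_nn_integral by (rule nn_integral_cmult[symmetric]) measurable
    also have "\<dots> = (\<integral>\<^sup>+X. ?G X \<partial>path_law)"
      by (intro nn_integral_cong) (simp add: sum_distrib_left ennreal_mult mult_ac)
    also have "\<dots> = (\<integral>\<^sup>+(\<omega>, X). ?G X \<partial>averaged P 0)"
      by (rule nn_integral_path_law[OF measurable_cylinder_sum])
    also have "\<dots> \<le> (\<integral>\<^sup>+(\<omega>, X). F X \<partial>averaged P 0)"
    proof (rule nn_integral_mono)
      fix \<omega>X :: "'d environment \<times> 'd path"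
      obtain \<omega> X where \<omega>X: "\<omega>X = (\<omega>, X)" by (cases \<omega>X)
      have "?G X \<le> F X"
        by (rule sum_cylinder_indicators_le) (use le False in \<open>auto simp: le_regeneration_time\<close>)
      then show "(case \<omega>X of (\<omega>, X) \<Rightarrow> ?G X) \<le> (case \<omega>X of (\<omega>, X) \<Rightarrow> F X)"
        by (simp add: \<omega>X)
    qed
    finally have "exp (- r * real n) * unfinished_mgf \<theta> n \<le> M"
      unfolding M(2) using M(1) by (simp add: ennreal_le_iff)
    then have "exp (- r * real n) * unfinished_mgf \<theta> n * exp (r * real n) \<le> max 1 M * exp (r * real n)"
      by (intro mult_right_mono) auto
    moreover have "exp (- r * real n) * unfinished_mgf \<theta> n * exp (r * real n) =
        unfinished_mgf \<theta> n * (exp (- r * real n) * exp (r * real n))"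
      by (simp only: mult_ac)
    moreover have "exp (- r * real n) * exp (r * real n) = 1"
      by (simp flip: exp_add)
    ultimately show ?thesis
      by (simp only: mult_1_right)
  qed
  then show ?thesis
    by (auto simp: regular_def)
qed

section \<open>Displacement bounds and the two moment conditions\<close>

lemma l1_norm_embed_unit_step: "z \<in> unit_steps \<Longrightarrow> (\<Sum>i\<in>UNIV. \<bar>embed z $ i\<bar>) = 1" for z :: "int ^ 'd"
proof -
  assume "z \<in> unit_steps"
  then have "real_of_int (\<Sum>i\<in>UNIV. \<bar>z $ i\<bar>) = 1"
    by (simp add: unit_steps_def)
  then show ?thesis
    by (simp add: embed_def)
qed

lemma l1_norm_pos_le:
  fixes cs :: "(int ^ 'd) list"
  assumes "cs \<in> step_lists n" "k \<le> n"
  shows "(\<Sum>i\<in>UNIV. \<bar>embed (pos cs k) $ i\<bar>) \<le> real k"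
  using assms(2)
proof (induction k)
  case (Suc k)
  then have "cs ! k \<in> unit_steps" "k < length cs"
    using assms(1) by (auto simp: step_lists_def subset_iff)
  then have "(\<Sum>i\<in>UNIV. \<bar>embed (pos cs (Suc k)) $ i\<bar>) \<le>
      (\<Sum>i\<in>UNIV. \<bar>embed (pos cs k) $ i\<bar>) + (\<Sum>i\<in>UNIV. \<bar>embed (cs ! k) $ i\<bar>)"
    unfolding sum.distrib[symmetric]
    by (intro sum_mono) (simp add: pos_Suc embed_add abs_triangle_ineq)
  also have "\<dots> \<le> real k + 1"
    using Suc l1_norm_embed_unit_step[OF \<open>cs ! k \<in> unit_steps\<close>] by simp
  finally show ?case by simp
qed simp

lemma norm_pos_le:
  fixes cs :: "(int ^ 'd) list"
  assumes "cs \<in> step_lists n"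
  shows "norm (embed (pos cs n)) \<le> real n"
  using norm_le_l1_cart[of "embed (pos cs n)"] l1_norm_pos_le[OF assms order_refl] by linarith

lemma tilt_bounds:
  fixes cs :: "(int ^ 'd) list"
  assumes "cs \<in> step_lists n"
  shows "tilt \<theta> cs \<le> exp (norm \<theta> * real n)" "exp (- norm \<theta> * real n) \<le> tilt \<theta> cs"
proof -
  have "\<bar>\<theta> \<bullet> embed (pos cs n)\<bar> \<le> norm \<theta> * norm (embed (pos cs n))"
    by (rule Cauchy_Schwarz_ineq2)
  also have "\<dots> \<le> norm \<theta> * real n"
    by (intro mult_left_mono norm_pos_le[OF assms]) auto
  finally show "tilt \<theta> cs \<le> exp (norm \<theta> * real n)" "exp (- norm \<theta> * real n) \<le> tilt \<theta> cs"
    using assms by (auto simp: tilt_def step_lists_def abs_le_iff)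
qed

text \<open>In n steps the tilt is at most \<open>exp (norm \<theta> * n)\<close>, whereas n steps
  without regeneration cost a factor \<open>exp (- c * n)\<close>.\<close>

lemma regular_time_moment:
  assumes c: "0 < c" and fin: "time_exp_moment P u c < \<infinity>"
  shows "regular \<theta> (norm \<theta> - c)"
proof (rule regular_unfinished_bound)
  show "(\<integral>\<^sup>+(\<omega>, X). exp_enat c (regeneration_time u X) \<partial>averaged P 0) < \<infinity>"
    using fin by (simp add: time_exp_moment_def)
  fix n and cs :: "(int ^ 'd) list" and X :: "'d path"
  assume cs: "cs \<in> step_lists n" and n: "enat n \<le> regeneration_time u X"
  have "tilt \<theta> cs * exp (- (norm \<theta> - c) * real n) \<le> exp (norm \<theta> * real n) * exp (- (norm \<theta> - c) * real n)"
    by (intro mult_right_mono tilt_bounds(1)[OF cs]) auto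
  also have "\<dots> = exp (c * real n)"
    by (simp add: algebra_simps flip: exp_add)
  finally have "ennreal (tilt \<theta> cs * exp (- (norm \<theta> - c) * real n)) \<le> ennreal (exp (c * real n))"
    by (rule ennreal_leI)
  also have "\<dots> \<le> exp_enat c (regeneration_time u X)"
    using n c by (auto simp: exp_enat_def split: enat.split intro!: ennreal_leI)
  finally show "ennreal (tilt \<theta> cs * exp (- (norm \<theta> - c) * real n)) \<le> exp_enat c (regeneration_time u X)" .
qed

text \<open>A time n up to the regeneration time is one of the times in the supremum, which
  therefore bounds the tilt. The bound has no decay in n, hence the rate 0.\<close>

lemma regular_range_moment:
  assumes c: "norm \<theta> \<le> c" and fin: "range_exp_moment P u c < \<infinity>"
  shows "regular \<theta> 0"
proof (rule regular_unfinished_bound)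
  show "(\<integral>\<^sup>+(\<omega>, X). (SUP i\<in>{i. 1 \<le> i \<and> enat i \<le> regeneration_time u X}. ennreal (exp (c * norm (embed (X i))))) \<partial>averaged P 0) < \<infinity>"
    using fin by (simp add: range_exp_moment_def)
  fix n cs and X :: "'d path"
  assume cs: "1 \<le> n" "cs \<in> step_lists n" "X \<in> path_cylinder cs" and n: "enat n \<le> regeneration_time u X"
  have Xn: "X n = pos cs n" "length cs = n"
    using cs by (auto simp: path_cylinder_def step_lists_def)
  have "\<theta> \<bullet> embed (X n) \<le> norm \<theta> * norm (embed (X n))"
    by (rule norm_cauchy_schwarz)
  also have "\<dots> \<le> c * norm (embed (X n))"
    using c by (intro mult_right_mono) auto
  finally have "ennreal (tilt \<theta> cs * exp (- 0 * real n)) \<le> ennreal (exp (c * norm (embed (X n))))"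
    by (simp add: tilt_def Xn ennreal_leI)
  also have "\<dots> \<le> (SUP i\<in>{i. 1 \<le> i \<and> enat i \<le> regeneration_time u X}. ennreal (exp (c * norm (embed (X i)))))"
    using cs n by (intro SUP_upper) auto
  finally show "ennreal (tilt \<theta> cs * exp (- 0 * real n)) \<le>
      (SUP i\<in>{i. 1 \<le> i \<and> enat i \<le> regeneration_time u X}. ennreal (exp (c * norm (embed (X i)))))" .
qed

text \<open>At \<theta> = 0 the unfinished part is the probability of no regeneration before n, and
  its rate - c is negative.\<close>

lemma regenerates_time_moment:
  assumes c: "0 < c" and fin: "time_exp_moment P u c < \<infinity>"
  shows regenerates
proof -
  obtain C where C: "\<And>n. unfinished_mgf 0 n \<le> C * exp (- c * real n)"
    using regular_time_moment[OF assms, of 0] by (auto simp: regular_def)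
  let ?N = "\<Inter>n. no_regen_before n"
  have N [measurable]: "?N \<in> PL.events"
    by (intro sets.countable_INT) auto
  have "PL.prob ?N \<le> C * exp (- c * real n)" for n
  proof -
    have "PL.prob ?N \<le> PL.prob (no_regen_before n)"
      by (intro PL.finite_measure_mono) auto
    also have "\<dots> = unfinished_mgf 0 n"
      using prob_eq_sum_cylinders[of "no_regen_before n" n] by (simp add: unfinished_mgf_def)
    finally show ?thesis using C[of n] by simp
  qed
  moreover have "(\<lambda>n. C * exp (- c * real n)) \<longlonglongrightarrow> C * 0"
  proof (intro tendsto_mult tendsto_const)
    have "(\<lambda>n. exp (- c) ^ n) \<longlonglongrightarrow> 0"
      using c by (intro LIMSEQ_power_zero) auto
    then show "(\<lambda>n. exp (- c * real n)) \<longlonglongrightarrow> 0"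
      by (simp add: exp_of_nat2_mult[symmetric] mult.commute)
  qed
  ultimately have "PL.prob ?N \<le> C * 0"
    by (intro LIMSEQ_le_const) auto
  then have "PL.prob ?N = 0"
    using measure_nonneg[of path_law ?N] by linarith
  then have "AE X in path_law. X \<notin> ?N"
    using PL.prob_eq_0 N by blast
  then show ?thesis
    unfolding regenerates_def by eventually_elim (use not_first_regen_iff in auto)
qed

text \<open>Without regeneration the supremum runs over all times and is infinite, because the
  height, and with it the norm, tends to infinity.\<close>

lemma regenerates_range_moment:
  assumes c: "0 < c" and fin: "range_exp_moment P u c < \<infinity>" and T: "condition_T P u"
  shows regenerates
proof -
  let ?N = "\<Inter>n. no_regen_before n"
  have N: "?N \<in> sets path_space"
    using no_regen_before_event sets_path_law by (intro sets.countable_INT) auto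
  \<comment> \<open>The indicator restricts to paths without regeneration, whose index set is all of
    \<open>{1..}\<close>; this supremum has a fixed index set, hence is measurable, and lies below
    the given one.\<close>
  let ?S = "\<lambda>X. SUP i\<in>{1..}. ennreal (exp (c * norm (embed (X i)))) * indicator ?N X"
  have S: "?S \<in> borel_measurable path_space"
  proof -
    have "(\<lambda>X :: 'd path. ennreal (exp (c * norm (embed (X i))))) \<in> borel_measurable path_space" for i
      by (rule measurable_compose[OF measurable_path_component]) simp
    note [measurable] = this N
    have "(\<lambda>X. ennreal (exp (c * norm (embed (X i)))) * indicator ?N X) \<in> borel_measurable path_space" for i
      by measurable
    then show ?thesis
      by (intro borel_measurable_SUP) auto
  qed
  have "(\<integral>\<^sup>+(\<omega>, X). ?S X \<partial>averaged P 0) \<le> range_exp_moment P u c"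
    unfolding range_exp_moment_def
  proof (rule nn_integral_mono)
    fix \<omega>X :: "'d environment \<times> 'd path"
    obtain \<omega> X where \<omega>X: "\<omega>X = (\<omega>, X)" by (cases \<omega>X)
    have "?S X \<le> (SUP i\<in>{i. 1 \<le> i \<and> enat i \<le> regeneration_time u X}. ennreal (exp (c * norm (embed (X i)))))"
    proof (intro SUP_least)
      fix i :: nat assume i: "i \<in> {1..}"
      show "ennreal (exp (c * norm (embed (X i)))) * indicator ?N X \<le>
          (SUP i\<in>{i. 1 \<le> i \<and> enat i \<le> regeneration_time u X}. ennreal (exp (c * norm (embed (X i)))))"
      proof (cases "X \<in> ?N")
        case True
        then have "enat i \<le> regeneration_time u X"
          by (simp add: le_regeneration_time)
        with True i show ?thesis
          by (auto intro!: SUP_upper2[of i])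
      qed simp
    qed
    then show "(case \<omega>X of (\<omega>, X) \<Rightarrow> ?S X) \<le>
      (case \<omega>X of (\<omega>, X) \<Rightarrow> SUP i\<in>{i. 1 \<le> i \<and> enat i \<le> regeneration_time u X}. ennreal (exp (c * norm (embed (X i)))))"
      by (simp add: \<omega>X)
  qed
  also note fin
  finally have "(\<integral>\<^sup>+x. ?S (snd x) \<partial>averaged P 0) \<noteq> \<infinity>"
    by (simp add: case_prod_unfold)
  then have "AE x in averaged P 0. ?S (snd x) \<noteq> \<infinity>"
    by (intro nn_integral_noteq_infinite measurable_compose[OF measurable_snd_averaged S])
  moreover have "AE x in averaged P 0. filterlim (\<lambda>n. embed (snd x n) \<bullet> u) at_top sequentially"
    using T by (simp add: condition_T_def case_prod_unfold)
  ultimately have "AE x in averaged P 0. snd x \<notin> ?N"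
  proof eventually_elim
    case (elim x)
    show "snd x \<notin> ?N"
    proof
      assume N: "snd x \<in> ?N"
      obtain B where B: "0 \<le> B" "?S (snd x) = ennreal B"
        using elim(1) by (cases "?S (snd x)") auto
      have "eventually (\<lambda>n. B / c \<le> embed (snd x n) \<bullet> u) sequentially"
        using elim(2) by (simp add: filterlim_at_top)
      then obtain n where n: "1 \<le> n" "B / c \<le> embed (snd x n) \<bullet> u"
        unfolding eventually_sequentially by (metis nat_le_linear)
      have "embed (snd x n) \<bullet> u \<le> norm (embed (snd x n))"
        using norm_cauchy_schwarz[of "embed (snd x n)" u] norm_u by simp
      with n have "B / c \<le> norm (embed (snd x n))"
        by linarith
      then have "B \<le> c * norm (embed (snd x n))"
        using c by (simp add: pos_divide_le_eq mult.commute)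
      then have "B < exp (c * norm (embed (snd x n)))"
        using exp_ge_add_one_self[of "c * norm (embed (snd x n))"] by linarith
      then have "ennreal B < ennreal (exp (c * norm (embed (snd x n)))) * indicator ?N (snd x)"
        using N B(1) by (simp add: ennreal_lessI)
      also have "\<dots> \<le> ?S (snd x)"
        using n(1) by (intro SUP_upper) auto
      finally show False unfolding B(2) by simp
    qed
  qed
  moreover have "{X \<in> space path_space. X \<notin> ?N} \<in> sets path_space"
    using sets.compl_sets[OF N] by (simp only: set_diff_eq)
  ultimately have "AE X in path_law. X \<notin> ?N"
    unfolding path_law_def by (subst AE_distr_iff[OF measurable_snd_averaged])
  then show ?thesis
    unfolding regenerates_def by eventually_elim (use not_first_regen_iff in auto)
qed

end

section \<open>Slowdown by traps in the nestling case\<close>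

lemma finite_lattice_ball: "finite {x :: int ^ 'd::finite. (norm (embed x))\<^sup>2 < B}"
proof (rule finite_subset)
  let ?N = "\<lceil>sqrt B\<rceil>"
  show "{x :: int ^ 'd. (norm (embed x))\<^sup>2 < B} \<subseteq> vec_lambda ` (PiE UNIV (\<lambda>_. {- ?N .. ?N}))"
  proof
    fix x :: "int ^ 'd" assume "x \<in> {x. (norm (embed x))\<^sup>2 < B}"
    then have "norm (embed x) \<le> sqrt B"
      by (intro real_le_rsqrt) simp
    then have "\<bar>real_of_int (x $ i)\<bar> \<le> sqrt B" for i
      using component_le_norm_cart[of "embed x" i] by (simp add: embed_def)
    then have "- ?N \<le> x $ i \<and> x $ i \<le> ?N" for i
      by (smt (verit, best) le_of_int_ceiling of_int_le_iff of_int_minus)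
    then have "vec_nth x \<in> PiE UNIV (\<lambda>_. {- ?N .. ?N})"
      by (auto simp: PiE_def)
    then show "x \<in> vec_lambda ` (PiE UNIV (\<lambda>_. {- ?N .. ?N}))"
      by (intro image_eqI[of _ _ "vec_nth x"]) auto
  qed
  show "finite (vec_lambda ` (PiE UNIV (\<lambda>_ :: 'd. {- ?N .. ?N})) :: (int ^ 'd) set)"
    by (intro finite_imageI finite_PiE) auto
qed

lemma norm_unit_step:
  fixes z :: "int ^ 'd::finite"
  assumes "z \<in> unit_steps"
  shows "(norm (embed z))\<^sup>2 = 1"
proof -
  have sum: "(\<Sum>i\<in>UNIV. \<bar>z $ i\<bar>) = 1"
    using assms by (simp add: unit_steps_def)
  have "(z $ i)\<^sup>2 = \<bar>z $ i\<bar>" for i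
  proof -
    have "\<bar>z $ i\<bar> \<le> (\<Sum>i\<in>UNIV. \<bar>z $ i\<bar>)"
      by (rule member_le_sum) auto
    then have "z $ i \<in> {-1, 0, 1}"
      using sum by auto
    then show ?thesis by auto
  qed
  then have "(\<Sum>i\<in>UNIV. (z $ i)\<^sup>2) = 1"
    using sum by simp
  then have "real_of_int (\<Sum>i\<in>UNIV. (z $ i)\<^sup>2) = 1"
    by simp
  moreover have "(norm (embed z))\<^sup>2 = (\<Sum>i\<in>UNIV. (embed z $ i)\<^sup>2)"
    unfolding power2_norm_eq_inner by (simp add: inner_vec_def power2_eq_square)
  ultimately show ?thesis
    by (simp add: embed_def)
qed

context iid_walk
begin

text \<open>A step z from x changes the squared distance from 0 by
  \<open>2 * (embed z \<bullet> embed x) + 1\<close>, so at such a site the mean increase is at most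
  2. The bound is 1 rather than 0 because nestling provides drifts below every positive level, not
  necessarily an inward drift.\<close>

definition trap_site :: "int ^ 'd \<Rightarrow> (int ^ 'd) pmf \<Rightarrow> bool" where
  "trap_site x p \<longleftrightarrow> 2 * (\<Sum>z\<in>unit_steps. pmf p z * (embed z \<bullet> embed x)) \<le> 1"

lemma trap_site_measurable [measurable]: "Measurable.pred site_space (trap_site x)"
  unfolding trap_site_def by measurable

lemma measurable_drift [measurable]: "(\<lambda>\<omega>. drift \<omega> v) \<in> borel_measurable P"
  unfolding drift_def
  by (intro borel_measurable_sum borel_measurable_times borel_measurable_const
      measurable_compose[OF measurable_site measurable_pmf_site])

text \<open>Otherwise the drift in the direction of x would almost surely be at least
  \<open>1 / (2 * norm (embed x))\<close>, and the walk would be non-nestling.\<close>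

lemma prob_trap_site_pos:
  assumes "\<not> non_nestling P"
  shows "0 < prob {\<omega>. trap_site x (\<omega> 0)}"
proof (rule ccontr)
  assume "\<not> 0 < prob {\<omega>. trap_site x (\<omega> 0)}"
  then have 0: "prob {\<omega>. trap_site x (\<omega> 0)} = 0"
    using measure_nonneg[of P "{\<omega>. trap_site x (\<omega> 0)}"] by linarith
  have "{\<omega> \<in> space P. trap_site x (\<omega> 0)} \<in> events"
    by measurable
  then have event: "{\<omega>. trap_site x (\<omega> 0)} \<in> events"
    by simp
  have AE: "AE \<omega> in P. \<not> trap_site x (\<omega> 0)"
    using prob_eq_0[OF event] 0 by simp
  show False
  proof (cases "embed x = 0")
    case True
    then have "trap_site x p" for p
      by (simp add: trap_site_def)
    with AE have "AE \<omega> in P. False" by simp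
    then show False
      by (simp add: AE_False)
  next
    case False
    define v where "v = embed x /\<^sub>R norm (embed x)"
    define a where "a = 1 / (2 * norm (embed x))"
    have a: "0 < a" using False by (simp add: a_def)
    have "norm v = 1" using False by (simp add: v_def)
    have "AE \<omega> in P. a \<le> drift \<omega> v"
      using AE
    proof eventually_elim
      case (elim \<omega>)
      have "drift \<omega> v = (\<Sum>z\<in>unit_steps. pmf (\<omega> 0) z * (embed z \<bullet> embed x)) / norm (embed x)"
        unfolding drift_def sum_divide_distrib
        by (intro sum.cong refl) (simp add: v_def divide_inverse mult_ac)
      moreover have "1 / 2 < (\<Sum>z\<in>unit_steps. pmf (\<omega> 0) z * (embed z \<bullet> embed x))"
        using elim by (simp add: trap_site_def)
      then have "1 / 2 / norm (embed x) \<le> (\<Sum>z\<in>unit_steps. pmf (\<omega> 0) z * (embed z \<bullet> embed x)) / norm (embed x)"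
        by (intro divide_right_mono) auto
      ultimately show ?case by (simp add: a_def)
    qed
    then have "esssup P (\<lambda>\<omega>. - ereal (drift \<omega> v)) \<le> - ereal a"
      by (intro esssup_I) auto
    then have "ereal a \<le> ess_inf P (\<lambda>\<omega>. drift \<omega> v)"
      unfolding ess_inf_def by (metis ereal_uminus_le_reorder ereal_uminus_uminus uminus_ereal.simps(1))
    then have "0 < ess_inf P (\<lambda>\<omega>. drift \<omega> v)"
      using a by (meson ereal_less(2) less_le_trans)
    with \<open>norm v = 1\<close> assms show False
      by (auto simp: non_nestling_def non_nestling_along_def)
  qed
qed

lemma prob_trap_pos:
  assumes "\<not> non_nestling P" "finite A"
  shows "0 < prob {\<omega>. \<forall>x\<in>A. trap_site x (\<omega> x)}"
proof -
  have ind: "indicator {\<omega>. \<forall>x\<in>A. trap_site x (\<omega> x)} \<omega> = (\<Prod>x\<in>A. of_bool (trap_site x (\<omega> x)) :: real)" for \<omega>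
    using assms(2) by (induction A rule: finite_induct) (auto simp: indicator_def)
  have [measurable]: "(\<lambda>p. of_bool (trap_site x p) :: real) \<in> borel_measurable site_space" for x
    by measurable
  have "{\<omega> \<in> space P. \<forall>x\<in>A. trap_site x (\<omega> x)} \<in> events"
    using assms(2) by measurable
  then have "prob {\<omega>. \<forall>x\<in>A. trap_site x (\<omega> x)} = (\<integral>\<omega>. indicator {\<omega>. \<forall>x\<in>A. trap_site x (\<omega> x)} \<omega> \<partial>P)"
    by simp
  also have "\<dots> = (\<Prod>x\<in>A. \<integral>\<omega>. of_bool (trap_site x (\<omega> 0)) \<partial>P)"
    unfolding ind by (rule expectation_prod_sites[OF assms(2)]) auto
  also have "\<dots> > 0"
  proof (rule prod_pos)
    fix x
    have "(\<integral>\<omega>. of_bool (trap_site x (\<omega> 0)) \<partial>P) = (\<integral>\<omega>. indicator {\<omega>. trap_site x (\<omega> 0)} \<omega> \<partial>P :: real)"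
      by (intro Bochner_Integration.integral_cong refl) (auto simp: indicator_def)
    also have "\<dots> = prob {\<omega>. trap_site x (\<omega> 0)}"
      by simp
    finally show "0 < (\<integral>\<omega>. of_bool (trap_site x (\<omega> 0)) \<partial>P :: real)"
      using prob_trap_site_pos[OF assms(1)] by simp
  qed
  finally show ?thesis .
qed

definition bump :: "real \<Rightarrow> int ^ 'd \<Rightarrow> real" where
  "bump B x = max 0 (B - (norm (embed x))\<^sup>2)"

section \<open>Slow decay of the bump inside a trap\<close>

lemma norm_embed_add_unit_step:
  assumes "z \<in> unit_steps"
  shows "(norm (embed (x + z :: int ^ 'd)))\<^sup>2 = (norm (embed x))\<^sup>2 + 2 * (embed z \<bullet> embed x) + 1"
  using norm_unit_step[OF assms]
  by (simp add: embed_add power2_norm_eq_inner inner_add_left inner_add_right inner_commute)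

text \<open>Some coordinate has modulus above m, and the unit step against its sign is the required
  one.\<close>

lemma exists_inward_step:
  assumes "real CARD('d) * m\<^sup>2 < (norm (embed x))\<^sup>2" "0 \<le> m"
  shows "\<exists>z\<in>unit_steps. embed z \<bullet> embed (x :: int ^ 'd) < - m"
proof -
  have "\<exists>i. m < \<bar>embed x $ i\<bar>"
  proof (rule ccontr)
    assume "\<nexists>i. m < \<bar>embed x $ i\<bar>"
    then have "(embed x $ i)\<^sup>2 \<le> m\<^sup>2" for i
      by (metis abs_ge_zero not_less power2_abs power_mono)
    then have "(\<Sum>i\<in>UNIV. (embed x $ i)\<^sup>2) \<le> (\<Sum>i\<in>(UNIV :: 'd set). m\<^sup>2)"
      by (intro sum_mono)
    then have "(norm (embed x))\<^sup>2 \<le> real CARD('d) * m\<^sup>2"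
      unfolding power2_norm_eq_inner by (simp add: inner_vec_def power2_eq_square)
    with assms(1) show False by simp
  qed
  then obtain i where i: "m < \<bar>embed x $ i\<bar>" ..
  define s :: int where "s = (if 0 < embed x $ i then - 1 else 1)"
  have "axis i s \<in> unit_steps"
    by (simp add: unit_steps_def axis_def s_def if_distrib[of abs] cong: if_cong)
  moreover have "embed (axis i s) = axis i (real_of_int s)"
    by (simp add: embed_def axis_def vec_eq_iff)
  then have "embed (axis i s) \<bullet> embed x = real_of_int s * embed x $ i"
    by (simp add: inner_axis' inner_real_def)
  then have "embed (axis i s) \<bullet> embed x < - m"
    using i by (auto simp: s_def abs_if split: if_splits)
  ultimately show ?thesis by blast
qed

text \<open>Well inside the ball the drift condition makes the bump almost harmonic; near the boundary,
  where the bump is small compared with its gradient, a single inward step of probability at least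
  the ellipticity constant suffices.\<close>

lemma bump_subharmonic:
  assumes \<delta>: "0 < \<delta>" "\<delta> \<le> 1"
  shows "\<exists>B>0. \<forall>\<omega>. (\<forall>x. \<forall>z\<in>unit_steps. ellipticity \<le> pmf (\<omega> x) z) \<longrightarrow> (\<forall>x. (\<Sum>z\<in>unit_steps. pmf (\<omega> x) z) = 1) \<longrightarrow>
    (\<forall>x. (norm (embed x))\<^sup>2 < B \<longrightarrow> trap_site x (\<omega> x)) \<longrightarrow>
    (\<forall>x. (1 - \<delta>) * bump B x \<le> (\<Sum>z\<in>unit_steps. pmf (\<omega> x) z * bump B (x + z)))"
proof -
  \<comment> \<open>m makes \<open>ellipticity * (2 * m - 1)\<close> equal to
    \<open>2 / \<delta>\<close>; B forces every point of the ball with bump below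
    \<open>2 / \<delta>\<close> to satisfy the hypothesis of
    \<open>exists_inward_step\<close>.\<close>
  define m where "m = (2 / (\<delta> * ellipticity) + 1) / 2"
  define B where "B = 2 / \<delta> + real CARD('d) * m\<^sup>2"
  have m: "0 \<le> m" using \<delta> ellipticity(1) by (simp add: m_def)
  have B: "0 < B" using \<delta> by (simp add: B_def add_pos_nonneg)
  have "(1 - \<delta>) * bump B x \<le> (\<Sum>z\<in>unit_steps. pmf (\<omega> x) z * bump B (x + z))"
    if ell: "\<And>x z. z \<in> unit_steps \<Longrightarrow> ellipticity \<le> pmf (\<omega> x) z" and sum1: "\<And>x. (\<Sum>z\<in>unit_steps. pmf (\<omega> x) z) = 1"
      and trap: "\<And>x. (norm (embed x))\<^sup>2 < B \<Longrightarrow> trap_site x (\<omega> x)" for \<omega> :: "'d environment" and x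
  proof (cases "(norm (embed x))\<^sup>2 < B")
    case False
    then have "bump B x = 0" by (simp add: bump_def)
    then show ?thesis by (auto simp: bump_def intro!: sum_nonneg)
  next
    case inside: True
    define s where "s = B - (norm (embed x))\<^sup>2"
    have s: "0 < s" "bump B x = s" using inside by (auto simp: s_def bump_def)
    have bump_ge: "s - 2 * (embed z \<bullet> embed x) - 1 \<le> bump B (x + z)" if "z \<in> unit_steps" for z
      using norm_embed_add_unit_step[OF that, of x] by (simp add: bump_def s_def)
    have "(1 - \<delta>) * s \<le> (\<Sum>z\<in>unit_steps. pmf (\<omega> x) z * bump B (x + z))"
    proof (cases "2 \<le> \<delta> * s")
      \<comment> \<open>The drift condition loses at most 2 in the mean, which here is at most the
        fraction \<delta> of s.\<close>
      case True
      have "(\<Sum>z\<in>unit_steps. pmf (\<omega> x) z * (s - 2 * (embed z \<bullet> embed x) - 1)) =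
          (\<Sum>z\<in>unit_steps. pmf (\<omega> x) z) * (s - 1) - 2 * (\<Sum>z\<in>unit_steps. pmf (\<omega> x) z * (embed z \<bullet> embed x))"
        by (simp add: sum_distrib_left sum_distrib_right flip: sum_subtractf) (simp add: algebra_simps)
      then have "s - 2 \<le> (\<Sum>z\<in>unit_steps. pmf (\<omega> x) z * (s - 2 * (embed z \<bullet> embed x) - 1))"
        using trap[OF inside] sum1 by (simp add: trap_site_def)
      also have "\<dots> \<le> (\<Sum>z\<in>unit_steps. pmf (\<omega> x) z * bump B (x + z))"
        by (intro sum_mono mult_left_mono bump_ge) auto
      finally show ?thesis using True by (simp add: algebra_simps)
    next
      case False
      then have "s < 2 / \<delta>" using \<delta> by (simp add: field_simps)
      then have "real CARD('d) * m\<^sup>2 < (norm (embed x))\<^sup>2"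
        by (simp add: s_def B_def)
      from exists_inward_step[OF this m] obtain z where z: "z \<in> unit_steps" "embed z \<bullet> embed x < - m" by blast
      have "2 * ((a + 1) / 2) - 1 = a" for a :: real
        by (simp add: field_simps)
      then have "2 * m - 1 = 2 / (\<delta> * ellipticity)"
        unfolding m_def .
      then have "ellipticity * (2 * m - 1) = 2 / \<delta>"
        using ellipticity(1) by simp
      then have "s \<le> ellipticity * (2 * m - 1)"
        using \<open>s < 2 / \<delta>\<close> by simp
      also have "\<dots> \<le> ellipticity * bump B (x + z)"
        using bump_ge[OF z(1)] z(2) s(1) ellipticity(1) by (intro mult_left_mono) auto
      also have "\<dots> \<le> pmf (\<omega> x) z * bump B (x + z)"
        by (intro mult_right_mono ell z) (simp add: bump_def)
      also have "\<dots> \<le> (\<Sum>z\<in>unit_steps. pmf (\<omega> x) z * bump B (x + z))"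
        by (rule member_le_sum) (use z finite_unit_steps in \<open>auto simp: bump_def\<close>)
      finally have "s \<le> (\<Sum>z\<in>unit_steps. pmf (\<omega> x) z * bump B (x + z))" .
      moreover have "(1 - \<delta>) * s \<le> 1 * s"
        using \<delta> s(1) by (intro mult_right_mono) auto
      ultimately show ?thesis by linarith
    qed
    then show ?thesis by (simp add: s)
  qed
  with B show ?thesis by blast
qed

text \<open>With positive probability a whole ball consists of trap sites. In such an environment
  the quenched mean of the bump decays no faster than \<open>exp (- \<epsilon> * n)\<close>, and the
  tilt dominates a multiple of the bump because the bump vanishes off the ball.\<close>

lemma mgf_nestling_lower_bound:
  assumes nest: "\<not> non_nestling P" and \<epsilon>: "0 < \<epsilon>"
  shows "\<exists>c>0. \<forall>n. c * exp (- \<epsilon> * real n) \<le> mgf \<theta> n"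
proof -
  define \<delta> where "\<delta> = 1 - exp (- \<epsilon>)"
  have \<delta>: "0 < \<delta>" "\<delta> \<le> 1" "1 - \<delta> = exp (- \<epsilon>)"
    using \<epsilon> by (auto simp: \<delta>_def)
  obtain B where B: "0 < B" and sub: "\<And>\<omega> x. (\<forall>x. \<forall>z\<in>unit_steps. ellipticity \<le> pmf (\<omega> x) z) \<Longrightarrow> (\<forall>x. (\<Sum>z\<in>unit_steps. pmf (\<omega> x) z) = 1) \<Longrightarrow>
    (\<forall>x. (norm (embed x))\<^sup>2 < B \<longrightarrow> trap_site x (\<omega> x)) \<Longrightarrow>
    (1 - \<delta>) * bump B x \<le> (\<Sum>z\<in>unit_steps. pmf (\<omega> x) z * bump B (x + z))"
    using bump_subharmonic[OF \<delta>(1,2)] by blast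
  let ?A = "{x :: int ^ 'd. (norm (embed x))\<^sup>2 < B}"
  let ?G = "{\<omega>. \<forall>x\<in>?A. trap_site x (\<omega> x)}"
  have "{\<omega> \<in> space P. \<forall>x\<in>?A. trap_site x (\<omega> x)} \<in> events"
    using finite_lattice_ball by measurable
  then have G [measurable]: "?G \<in> events" by simp
  have pG: "0 < prob ?G"
    by (rule prob_trap_pos[OF nest finite_lattice_ball])
  \<comment> \<open>On the ball the tilt is at least \<open>exp (- norm \<theta> * sqrt B)\<close>
    and the bump is at most B.\<close>
  define c where "c = exp (- norm \<theta> * sqrt B) / B"
  have c: "0 < c" using B by (simp add: c_def)
  have tilt_ge: "c * bump B (pos cs (length cs)) \<le> tilt \<theta> cs" for cs :: "(int ^ 'd) list"
  proof (cases "pos cs (length cs) \<in> ?A")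
    case False
    then have "bump B (pos cs (length cs)) = 0" by (simp add: bump_def)
    then show ?thesis by simp
  next
    case True
    then have "norm (embed (pos cs (length cs))) \<le> sqrt B"
      by (intro real_le_rsqrt) simp
    then have "norm \<theta> * norm (embed (pos cs (length cs))) \<le> norm \<theta> * sqrt B"
      by (intro mult_left_mono) auto
    with Cauchy_Schwarz_ineq2[of \<theta> "embed (pos cs (length cs))"]
    have "- norm \<theta> * sqrt B \<le> \<theta> \<bullet> embed (pos cs (length cs))"
      by (auto simp: abs_le_iff)
    then have "exp (- norm \<theta> * sqrt B) \<le> tilt \<theta> cs"
      by (simp add: tilt_def)
    moreover have "bump B (pos cs (length cs)) \<le> B"
      using B by (simp add: bump_def)
    then have "c * bump B (pos cs (length cs)) \<le> c * B"
      using c by (intro mult_left_mono) auto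
    moreover have "c * B = exp (- norm \<theta> * sqrt B)"
      using B by (simp add: c_def)
    ultimately show ?thesis by linarith
  qed
  \<comment> \<open>The quenched mean of the bump after n steps from x; conditioning on the first
    step propagates the subharmonic bound.\<close>
  define Q where "Q n x \<omega> = (\<Sum>cs\<in>step_lists n. path_weight \<omega> x cs * bump B (x + pos cs (length cs)))" for n x \<omega>
  have Q_Suc: "Q (Suc n) x \<omega> = (\<Sum>z\<in>unit_steps. pmf (\<omega> x) z * Q n (x + z) \<omega>)" for n x \<omega>
  proof -
    have "pos (z # zs) (length (z # zs)) = z + pos zs (length zs)" for z :: "int ^ 'd" and zs
      by (simp add: pos_def)
    then show ?thesis
      unfolding Q_def sum_step_lists_Suc
      by (simp add: path_weight_Cons sum_distrib_left mult_ac add.assoc)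
  qed
  have AE_Q: "AE \<omega> in P. \<omega> \<in> ?G \<longrightarrow> (\<forall>n x. (1 - \<delta>) ^ n * bump B x \<le> Q n x \<omega>)"
    using AE_elliptic AE_sum_pmf
  proof eventually_elim
    case (elim \<omega>)
    show ?case
    proof (intro impI allI)
      fix n x assume G: "\<omega> \<in> ?G"
      show "(1 - \<delta>) ^ n * bump B x \<le> Q n x \<omega>"
      proof (induction n arbitrary: x)
        case 0
        show ?case by (simp add: Q_def)
      next
        case (Suc n)
        have "(1 - \<delta>) ^ Suc n * bump B x \<le> (1 - \<delta>) ^ n * (\<Sum>z\<in>unit_steps. pmf (\<omega> x) z * bump B (x + z))"
          using mult_left_mono[OF sub[of \<omega> x], of "(1 - \<delta>) ^ n"] elim G \<delta> by (simp add: mult_ac)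
        also have "\<dots> = (\<Sum>z\<in>unit_steps. pmf (\<omega> x) z * ((1 - \<delta>) ^ n * bump B (x + z)))"
          by (simp add: sum_distrib_left mult_ac)
        also have "\<dots> \<le> Q (Suc n) x \<omega>"
          unfolding Q_Suc by (intro sum_mono mult_left_mono Suc) auto
        finally show ?case .
      qed
    qed
  qed
  have mgf_eq: "mgf \<theta> n = (\<integral>\<omega>. (\<Sum>cs\<in>step_lists n. path_weight \<omega> 0 cs * tilt \<theta> cs) \<partial>P)" for n
    unfolding mgf_def W_def
    by (subst Bochner_Integration.integral_sum) (auto intro!: integrable_path_weight)
  have "c * B * prob ?G * exp (- \<epsilon> * real n) \<le> mgf \<theta> n" for n
  proof -
    have "c * B * prob ?G * exp (- \<epsilon> * real n) = (\<integral>\<omega>. c * ((1 - \<delta>) ^ n * bump B 0) * indicator ?G \<omega> \<partial>P)"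
      using B by (simp add: bump_def \<delta>(3) mult_ac flip: exp_of_nat_mult)
    also have "\<dots> \<le> mgf \<theta> n"
      unfolding mgf_eq
    proof (rule integral_mono_AE)
      show "AE \<omega> in P. c * ((1 - \<delta>) ^ n * bump B 0) * indicator ?G \<omega> \<le> (\<Sum>cs\<in>step_lists n. path_weight \<omega> 0 cs * tilt \<theta> cs)"
        using AE_Q
      proof eventually_elim
        case (elim \<omega>)
        show ?case
        proof (cases "\<omega> \<in> ?G")
          case True
          have "c * ((1 - \<delta>) ^ n * bump B 0) \<le> c * Q n 0 \<omega>"
            using elim True c by (intro mult_left_mono) auto
          also have "\<dots> = (\<Sum>cs\<in>step_lists n. path_weight \<omega> 0 cs * (c * bump B (pos cs (length cs))))"
            by (simp add: Q_def sum_distrib_left mult_ac)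
          also have "\<dots> \<le> (\<Sum>cs\<in>step_lists n. path_weight \<omega> 0 cs * tilt \<theta> cs)"
            by (intro sum_mono mult_left_mono tilt_ge path_weight_nonneg)
          finally show ?thesis using True by simp
        qed (auto intro!: sum_nonneg simp: path_weight_nonneg)
      qed
      show "integrable P (\<lambda>\<omega>. c * ((1 - \<delta>) ^ n * bump B 0) * indicator ?G \<omega>)"
        by (rule integrable_mult_right[OF integrable_real_indicator[OF G]]) (simp add: emeasure_eq_measure)
    qed (auto intro!: integrable_path_weight)
    finally show ?thesis .
  qed
  then show ?thesis
    using c B pG by (intro exI[of _ "c * B * prob ?G"]) auto
qed

end

section \<open>Analyticity and strict convexity\<close>

context iid_walk
begin

definition blocks :: "(int ^ 'd) list set" where
  "blocks = {cs. set cs \<subseteq> unit_steps \<and> irreducible_path cs \<and> upward cs}"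

lemma blocks_has_sum_iff:
  "((\<lambda>cs. W cs * tilt \<theta> cs * exp (- r * real (length cs))) has_sum S) blocks \<longleftrightarrow>
    (\<lambda>n. block \<theta> n * exp (- r * real n)) sums S"
proof -
  have eq: "{cs \<in> blocks. length cs = n} = {cs. cs \<in> step_lists n \<and> irreducible_path cs \<and> upward cs}" for n
    by (auto simp: blocks_def step_lists_def)
  have "finite {cs \<in> blocks. length cs = n}" for n
    unfolding eq by (rule finite_subset[OF _ finite_step_lists[of n]]) auto
  then have "((\<lambda>cs. W cs * tilt \<theta> cs * exp (- r * real (length cs))) has_sum S) blocks \<longleftrightarrow>
      (\<lambda>n. \<Sum>cs | cs \<in> blocks \<and> length cs = n. W cs * tilt \<theta> cs * exp (- r * real (length cs))) sums S"
    by (intro has_sum_iff_graded_sums) auto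
  also have "(\<lambda>n. \<Sum>cs | cs \<in> blocks \<and> length cs = n. W cs * tilt \<theta> cs * exp (- r * real (length cs))) =
      (\<lambda>n. block \<theta> n * exp (- r * real n))"
    unfolding block_def sum_distrib_right eq
    by (intro ext sum.cong refl) (auto simp: step_lists_def)
  finally show ?thesis .
qed

text \<open>By \<open>block_le\<close> the weights grow at most at the unfinished rate, so the
  series is dominated by a geometric one of ratio \<open>exp (r\<^sub>1 - r)\<close>.\<close>

lemma summable_block:
  assumes regenerates "regular \<theta> r\<^sub>1" "r\<^sub>1 < r"
  shows "summable (\<lambda>j. block \<theta> j * exp (- r * real j))"
proof -
  obtain C where C: "\<And>n. unfinished_mgf \<theta> n \<le> C * exp (r\<^sub>1 * real n)"
    using assms(2) by (auto simp: regular_def)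
  have p: "0 < escape_prob" by (rule escape_prob_pos[OF assms(1)])
  have bound: "norm (block \<theta> j * exp (- r * real j)) \<le> \<bar>C\<bar> / escape_prob * exp (r\<^sub>1 - r) ^ j" for j
  proof (cases "j = 0")
    case False
    then have "block \<theta> j * escape_prob \<le> C * exp (r\<^sub>1 * real j)"
      using block_le[of j \<theta>] C[of j] by simp
    also have "\<dots> \<le> \<bar>C\<bar> * exp (r\<^sub>1 * real j)"
      by (intro mult_right_mono) auto
    finally have "block \<theta> j \<le> \<bar>C\<bar> / escape_prob * exp (r\<^sub>1 * real j)"
      using p by (simp add: pos_le_divide_eq)
    then have "block \<theta> j * exp (- r * real j) \<le> \<bar>C\<bar> / escape_prob * exp (r\<^sub>1 * real j) * exp (- r * real j)"
      by (intro mult_right_mono) auto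
    moreover have "exp (r\<^sub>1 * real j) * exp (- r * real j) = exp (r\<^sub>1 - r) ^ j"
      by (simp add: algebra_simps flip: exp_add exp_of_nat_mult)
    ultimately have "block \<theta> j * exp (- r * real j) \<le> \<bar>C\<bar> / escape_prob * exp (r\<^sub>1 - r) ^ j"
      by (simp only: mult.assoc)
    then show ?thesis by simp
  qed (use p in simp)
  show ?thesis
  proof (rule summable_comparison_test')
    show "summable (\<lambda>j. \<bar>C\<bar> / escape_prob * exp (r\<^sub>1 - r) ^ j)"
      using assms(3) by (intro summable_mult summable_geometric) simp
  qed (rule bound)
qed

text \<open>In the variable t = exp (- r) the series is a power series that vanishes at 0 and is at
  least 1 at \<open>exp (- a)\<close>. The gap between \<open>r\<^sub>1\<close> and a puts this
  interval inside the disc of convergence, so the intermediate value theorem applies.\<close>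

lemma root_exists:
  assumes reg: regenerates "regular \<theta> r\<^sub>1" and a: "r\<^sub>1 < a"
    and ge: "1 \<le> (\<Sum>j. block \<theta> j * exp (- a * real j))"
  shows "\<exists>r\<ge>a. (\<lambda>j. block \<theta> j * exp (- r * real j)) sums 1"
proof -
  have pow: "exp (- r * real j) = exp (- r) ^ j" for r j
    by (simp add: mult.commute flip: exp_of_nat_mult)
  define b where "b = (r\<^sub>1 + a) / 2"
  have b: "r\<^sub>1 < b" "b < a" using a by (auto simp: b_def)
  have sum: "summable (\<lambda>j. block \<theta> j * exp (- b) ^ j)"
    using summable_block[OF reg b(1)] by (simp only: pow)
  let ?f = "\<lambda>t. \<Sum>j. block \<theta> j * t ^ j"
  have "\<exists>t\<ge>0. t \<le> exp (- a) \<and> ?f t = 1"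
  proof (rule IVT)
    show "?f 0 \<le> 1" by simp
    show "1 \<le> ?f (exp (- a))"
      using ge by (simp only: pow)
    show "\<forall>t. 0 \<le> t \<and> t \<le> exp (- a) \<longrightarrow> isCont ?f t"
    proof safe
      fix t :: real assume t: "0 \<le> t" "t \<le> exp (- a)"
      moreover have "exp (- a) < exp (- b)" using b by simp
      ultimately have "norm t < norm (exp (- b))"
        unfolding real_norm_def by linarith
      then show "isCont ?f t"
        by (rule isCont_powser[OF sum])
    qed
  qed simp
  then obtain t where t: "0 \<le> t" "t \<le> exp (- a)" "?f t = 1" by blast
  have "t \<noteq> 0" using t(3) by (intro notI) simp
  define r where "r = - ln t"
  have tr: "exp (- r) = t" using t(1) \<open>t \<noteq> 0\<close> by (simp add: r_def)
  have "a \<le> r" using t(2) unfolding tr[symmetric] by simp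
  moreover have "summable (\<lambda>j. block \<theta> j * exp (- r * real j))"
    using a \<open>a \<le> r\<close> by (intro summable_block[OF reg]) simp
  then have "(\<lambda>j. block \<theta> j * exp (- r * real j)) sums ?f t"
    unfolding pow tr by (rule summable_sums)
  ultimately show ?thesis using t(3) by auto
qed

section \<open>Enough blocks to determine a direction\<close>

lemma blockI:
  assumes "set cs \<subseteq> unit_steps" "irreducible_path cs" "upward cs"
  shows "cs \<in> blocks"
  using assms by (simp add: blocks_def)

lemma height_minus: "height (- x) = - height x"
  by (simp add: height_def embed_minus)

lemma uminus_unit_steps: "z \<in> unit_steps \<Longrightarrow> - z \<in> (unit_steps :: (int ^ 'd) set)"
  by (simp add: unit_steps_def)

lemma height_double: "height (2 * z) = 2 * height z"
  using height_add[of z z] by (simp only: mult_2)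

lemma embed_double: "embed (2 * z) = 2 *\<^sub>R embed (z :: int ^ 'd)"
  by (simp only: mult_2 embed_add scaleR_2)

text \<open>With h the height of z, the heights are 0, h, 0, h, 2h, so no interior time is a cut.
  The block covers the distance of two single steps in twice their time, which rules out a common
  nonzero speed.\<close>

lemma backtrack_block:
  assumes z: "z \<in> unit_steps" "0 < height z"
  shows "[z, - z, z, z] \<in> blocks"
proof (rule blockI)
  let ?cs = "[z, - z, z, z]"
  have hp: "hp ?cs 0 = 0" "hp ?cs 1 = height z" "hp ?cs 2 = 0" "hp ?cs 3 = height z" "hp ?cs 4 = 2 * height z"
    by (simp_all add: pos_def height_add height_minus height_double numeral_eq_Suc)
  have le_4_cases: "P i" if "i \<le> 4" "P 0" "P 1" "P 2" "P 3" "P 4" for P :: "nat \<Rightarrow> bool" and i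
  proof -
    have "i = 0 \<or> i = 1 \<or> i = 2 \<or> i = 3 \<or> i = 4" using that(1) by auto
    then show ?thesis using that by auto
  qed
  show "set ?cs \<subseteq> unit_steps"
    using z uminus_unit_steps by auto
  show "upward ?cs"
    unfolding upward_def
  proof safe
    fix i assume "i \<le> length ?cs"
    then have "i \<le> 4" by simp
    then show "0 \<le> hp ?cs i"
      by (rule le_4_cases) (use hp z in auto)
  qed
  show "irreducible_path ?cs"
    unfolding irreducible_path_def
  proof safe
    have "i < 4 \<longrightarrow> hp ?cs i < hp ?cs 4" if "i \<le> 4" for i
      using that by (rule le_4_cases) (use hp z in auto)
    then show "ladder ?cs"
      by (simp add: ladder_def numeral_eq_Suc)
    fix i assume i: "0 < i" "i < length ?cs" and low: "\<forall>l<i. hp ?cs l < hp ?cs i"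
      and up: "\<forall>k. i \<le> k \<and> k \<le> length ?cs \<longrightarrow> hp ?cs i \<le> hp ?cs k"
    have "i = 1 \<or> i = 2 \<or> i = 3" using i by auto
    then show False
      using low[rule_format, of 0] low[rule_format, of 1] up[rule_format, of 2] hp z by auto
  qed
qed

lemma sideways_block:
  assumes e: "e \<in> unit_steps" "height e = 0" and z: "z \<in> unit_steps" "0 < height z"
  shows "[e, z] \<in> blocks"
proof (rule blockI)
  have hp: "hp [e, z] 0 = 0" "hp [e, z] (Suc 0) = 0" "hp [e, z] (Suc (Suc 0)) = height z"
    using e by (simp_all add: pos_def height_add)
  show "set [e, z] \<subseteq> unit_steps"
    using e z by auto
  show "upward [e, z]"
    using hp z by (auto simp: upward_def le_Suc_eq)
  show "irreducible_path [e, z]"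
    using hp z by (auto simp: irreducible_path_def ladder_def less_Suc_eq)
qed

text \<open>Single upward steps have v-component c and \<open>backtrack_block\<close> forces 2c =
  4c, so c = 0. Then v is orthogonal to all unit steps of nonzero height, and
  \<open>sideways_block\<close> adds those of height 0.\<close>

lemma blocks_span:
  assumes "\<And>cs. cs \<in> blocks \<Longrightarrow> v \<bullet> embed (pos cs (length cs)) = c * real (length cs)"
  shows "v = 0"
proof -
  obtain z where z: "z \<in> unit_steps" "0 < height z"
    using exists_upward_step by blast
  have single: "v \<bullet> embed e = c" if "e \<in> unit_steps" "0 < height e" for e
  proof -
    have "[e] \<in> blocks"
      using single_step_block[OF that] that by (intro blockI) auto
    from assms[OF this] show ?thesis by (simp add: pos_def)
  qed
  have "v \<bullet> embed (2 * z) = c * 4"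
    using assms[OF backtrack_block[OF z]] by (simp add: pos_def)
  then have c: "c = 0"
    using single[OF z] by (simp add: embed_double)
  have "v \<bullet> embed e = 0" if e: "e \<in> unit_steps" for e
  proof (cases "height e" "0 :: real" rule: linorder_cases)
    case less
    then show ?thesis
      using single[of "- e"] uminus_unit_steps[OF e] c by (simp add: height_minus embed_minus)
  next
    case equal
    from assms[OF sideways_block[OF e this z]] single[OF z] c show ?thesis
      by (simp add: pos_def embed_add inner_add_right)
  next
    case greater
    then show ?thesis using single[OF e] c by simp
  qed
  moreover have "axis i 1 \<in> (unit_steps :: (int ^ 'd) set)" for i
    by (simp add: unit_steps_def axis_def if_distrib[of abs] cong: if_cong)
  moreover have "embed (axis i 1) = axis i 1" for i :: 'd
    by (simp add: embed_def axis_def vec_eq_iff)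
  ultimately have "v \<bullet> axis i 1 = 0" for i
    by metis
  then show ?thesis
    by (simp add: vec_eq_iff inner_axis)
qed

text \<open>The neighbourhood condition on \<open>regular\<close> makes every nearby solution a
  value of \<open>log_mgf\<close>. If the quadratic form were not positive at v, all squares in the
  convexity bound would vanish, and \<open>blocks_span\<close> would give v = 0.\<close>

theorem log_mgf_analytic_at:
  assumes reg: regenerates "regular \<theta> r\<^sub>1" and r: "r\<^sub>1 < r\<^sub>0"
    and root: "(\<lambda>j. block \<theta> j * exp (- r\<^sub>0 * real j)) sums 1"
    and \<sigma>\<^sub>0: "0 < \<sigma>\<^sub>0" "\<And>y r. y \<in> cube \<sigma>\<^sub>0 \<Longrightarrow> \<bar>r\<bar> \<le> \<sigma>\<^sub>0 \<Longrightarrow> regular (\<theta> + y) (r\<^sub>0 + r)"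
  shows "real_analytic_at (log_mgf P) \<theta> \<and> positive_definite (hessian (log_mgf P) \<theta>)"
proof -
  define w where "w cs = W cs * tilt \<theta> cs * exp (- r\<^sub>0 * real (length cs))" for cs
  define x where "x cs = embed (pos cs (length cs))" for cs :: "(int ^ 'd) list"
  \<comment> \<open>Half of the gap, so that \<open>r\<^sub>0 - \<eta>\<close> still exceeds
    \<open>r\<^sub>1\<close> and the block length has an exponential moment of order \<eta>.\<close>
  define \<eta> where "\<eta> = (r\<^sub>0 - r\<^sub>1) / 2"
  have w_tilt: "w cs * exp (y \<bullet> x cs - s * real (length cs)) =
      W cs * tilt (\<theta> + y) cs * exp (- (r\<^sub>0 + s) * real (length cs))" for cs y s
    by (simp add: w_def x_def tilt_def inner_add_left mult.assoc flip: exp_add) (simp add: algebra_simps)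
  interpret tilted_increments blocks w x "\<lambda>cs. real (length cs)" \<eta>
  proof
    show "0 \<le> w cs" for cs by (simp add: w_def)
    show "1 \<le> real (length cs)" if "cs \<in> blocks" for cs
      using that by (cases cs) (auto simp: blocks_def irreducible_path_def)
    show "(\<Sum>j\<in>UNIV. \<bar>x cs $ j\<bar>) \<le> real (length cs)" if "cs \<in> blocks" for cs
      using l1_norm_pos_le[of cs "length cs" "length cs"] that by (simp add: x_def blocks_def step_lists_def)
    show "(w has_sum 1) blocks"
      unfolding w_def blocks_has_sum_iff by (rule root)
    show "0 < \<eta>" using r by (simp add: \<eta>_def)
    have "r\<^sub>1 < r\<^sub>0 - \<eta>" using r by (simp add: \<eta>_def field_simps)
    from summable_sums[OF summable_block[OF reg this]]
    have "((\<lambda>cs. W cs * tilt \<theta> cs * exp (- (r\<^sub>0 - \<eta>) * real (length cs))) has_sum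
        (\<Sum>j. block \<theta> j * exp (- (r\<^sub>0 - \<eta>) * real j))) blocks"
      unfolding blocks_has_sum_iff .
    moreover have "W cs * tilt \<theta> cs * exp (- (r\<^sub>0 - \<eta>) * real (length cs)) = w cs * exp (\<eta> * real (length cs))" for cs
      using w_tilt[of cs 0 "- \<eta>"] by simp
    ultimately show "(\<lambda>cs. w cs * exp (\<eta> * real (length cs))) summable_on blocks"
      by (simp add: has_sum_imp_summable)
  qed
  have g: "log_mgf P (\<theta> + y) = r\<^sub>0 + s"
    if "y \<in> cube \<sigma>\<^sub>0" "\<bar>s\<bar> \<le> \<sigma>\<^sub>0" "((\<lambda>cs. w cs * exp (y \<bullet> x cs - s * real (length cs))) has_sum 1) blocks" for y s
    using that(3) unfolding w_tilt blocks_has_sum_iff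
    by (intro log_mgf_eq_root reg(1) \<sigma>\<^sub>0(2) that)
  note res = implicit_root_analytic[where g = "log_mgf P" and \<theta> = \<theta> and r\<^sub>0 = r\<^sub>0, OF \<sigma>\<^sub>0(1) g]
  have "0 < v \<bullet> (hessian (log_mgf P) \<theta> *v v)" if "v \<noteq> 0" for v
  proof (rule ccontr)
    assume neg: "\<not> 0 < v \<bullet> (hessian (log_mgf P) \<theta> *v v)"
    obtain c where c: "\<And>cs. cs \<in> blocks \<Longrightarrow> w cs / 8 * (v \<bullet> x cs - c * real (length cs))\<^sup>2 \<le>
        mean_time / 2 * (v \<bullet> (hessian (log_mgf P) \<theta> *v v))"
      using res(3) by blast
    have "v \<bullet> embed (pos cs (length cs)) = c * real (length cs)" if cs: "cs \<in> blocks" for cs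
    proof -
      have "mean_time / 2 * (v \<bullet> (hessian (log_mgf P) \<theta> *v v)) \<le> 0"
        using neg mean_time_ge_1 by (intro mult_nonneg_nonpos) auto
      with c[OF cs] have le: "w cs / 8 * (v \<bullet> x cs - c * real (length cs))\<^sup>2 \<le> 0" by linarith
      have "0 < w cs"
        using W_pos[of cs "length cs"] cs by (simp add: w_def blocks_def step_lists_def)
      then have "(v \<bullet> x cs - c * real (length cs))\<^sup>2 \<le> 0"
        using le by (simp add: mult_le_0_iff)
      then show ?thesis by (simp add: x_def)
    qed
    from blocks_span[OF this] that show False by simp
  qed
  with res(1,2) show ?thesis
    by (auto simp: positive_definite_def)
qed

section \<open>The non-nestling and the nestling region\<close>

lemma exists_small_cube:
  fixes a b :: real
  assumes "0 < a" "0 < b"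
  shows "\<exists>\<sigma>>0. \<forall>y\<in>cube \<sigma>. \<sigma> \<le> b \<and> norm (y :: real ^ 'd) + \<sigma> \<le> a"
proof (intro exI[of _ "min b (a / (real CARD('d) + 1))"] conjI ballI)
  let ?\<sigma> = "min b (a / (real CARD('d) + 1))"
  show "0 < ?\<sigma>" using assms by (simp add: add_nonneg_pos)
  fix y :: "real ^ 'd" assume "y \<in> cube ?\<sigma>"
  then have "(\<Sum>i\<in>UNIV. \<bar>y $ i\<bar>) \<le> (\<Sum>i\<in>(UNIV :: 'd set). ?\<sigma>)"
    by (intro sum_mono) (auto simp: cube_def)
  then have "norm y + ?\<sigma> \<le> (real CARD('d) + 1) * ?\<sigma>"
    using norm_le_l1_cart[of y] by (simp add: algebra_simps)
  also have "\<dots> \<le> (real CARD('d) + 1) * (a / (real CARD('d) + 1))"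
    by (intro mult_left_mono) auto
  also have "\<dots> = a"
    by (simp add: add_nonneg_eq_0_iff)
  finally show "norm y + ?\<sigma> \<le> a" .
qed simp

lemma non_nestling_region:
  assumes c: "0 < c" and fin: "time_exp_moment P u c < \<infinity>" and \<theta>: "norm \<theta> < c / 2"
  shows "real_analytic_at (log_mgf P) \<theta> \<and> positive_definite (hessian (log_mgf P) \<theta>)"
proof -
  have reg: regenerates by (rule regenerates_time_moment[OF c fin])
  note regular = regular_time_moment[OF c fin]
  have lt: "norm \<theta> - c < - norm \<theta>" using \<theta> by simp
  \<comment> \<open>Tilts are at least \<open>exp (- norm \<theta> * j)\<close>, so at the rate
    \<open>- norm \<theta>\<close> the tilted series dominates the untilted one, whose sum is
    1.\<close>
  have "1 \<le> (\<Sum>j. block \<theta> j * exp (- (- norm \<theta>) * real j))"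
  proof -
    have "block 0 j \<le> block \<theta> j * exp (- (- norm \<theta>) * real j)" for j
      unfolding block_def sum_distrib_right
    proof (rule sum_mono)
      fix cs assume "cs \<in> {cs. cs \<in> step_lists j \<and> irreducible_path cs \<and> upward cs}"
      then have "exp (- norm \<theta> * real j) * exp (norm \<theta> * real j) \<le> tilt \<theta> cs * exp (norm \<theta> * real j)"
        by (intro mult_right_mono tilt_bounds) auto
      then have "1 \<le> tilt \<theta> cs * exp (norm \<theta> * real j)"
        by (simp flip: exp_add)
      from mult_left_mono[OF this, of "W cs"]
      show "W cs * tilt 0 cs \<le> W cs * tilt \<theta> cs * exp (- (- norm \<theta>) * real j)"
        by (simp add: mult.assoc)
    qed
    then have "suminf (block 0) \<le> (\<Sum>j. block \<theta> j * exp (- (- norm \<theta>) * real j))"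
      by (rule suminf_le[OF _ sums_summable[OF block_zero_sums[OF reg]] summable_block[OF reg regular lt]])
    then show ?thesis
      using block_zero_sums[OF reg] by (simp add: sums_iff)
  qed
  from root_exists[OF reg regular lt this]
  obtain r\<^sub>0 where r\<^sub>0: "- norm \<theta> \<le> r\<^sub>0" "(\<lambda>j. block \<theta> j * exp (- r\<^sub>0 * real j)) sums 1" by blast
  obtain \<sigma> where \<sigma>: "0 < \<sigma>" "\<And>y. y \<in> cube \<sigma> \<Longrightarrow> norm (y :: real ^ 'd) + \<sigma> \<le> c - 2 * norm \<theta>"
    using exists_small_cube[of "c - 2 * norm \<theta>" 1] \<theta> by fastforce
  show ?thesis
  proof (rule log_mgf_analytic_at[OF reg regular _ r\<^sub>0(2) \<sigma>(1)])
    show "norm \<theta> - c < r\<^sub>0" using lt r\<^sub>0(1) by linarith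
    fix y :: "real ^ 'd" and r :: real assume "y \<in> cube \<sigma>" "\<bar>r\<bar> \<le> \<sigma>"
    then have "norm (\<theta> + y) - c \<le> r\<^sub>0 + r"
      using \<sigma>(2)[of y] r\<^sub>0(1) norm_triangle_ineq[of \<theta> y] by linarith
    then show "regular (\<theta> + y) (r\<^sub>0 + r)"
      by (rule regular_mono[OF regular])
  qed
qed

text \<open>As \<open>log_mgf\<close> is an arbitrary real number when the limit does not exist, the limit has to be
  identified even where it turns out to be \<open>0\<close>.\<close>

lemma nestling_root:
  assumes reg: regenerates "regular \<theta> 0" and nest: "\<not> non_nestling P" and pos: "0 < log_mgf P \<theta>"
  shows "\<exists>r>0. (\<lambda>j. block \<theta> j * exp (- r * real j)) sums 1"
proof (cases "\<exists>a>0. 1 \<le> (\<Sum>j. block \<theta> j * exp (- a * real j))")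
  case True
  then obtain a where "0 < a" "1 \<le> (\<Sum>j. block \<theta> j * exp (- a * real j))" by blast
  from root_exists[OF reg this] obtain r where "a \<le> r" "(\<lambda>j. block \<theta> j * exp (- r * real j)) sums 1"
    by blast
  with \<open>0 < a\<close> show ?thesis
    by (intro exI[of _ r]) auto
next
  case False
  \<comment> \<open>If the series stays below 1 at all positive rates, the upper renewal estimate
    holds at each of them; with the trap bound from below the limit is 0.\<close>
  have "\<exists>C. \<forall>n. mgf \<theta> n \<le> C * exp ((0 + \<epsilon>) * real n)" if \<epsilon>: "0 < \<epsilon>" for \<epsilon>
  proof -
    have "(\<Sum>j=1..n. block \<theta> j * exp (- (\<epsilon> / 2) * real j)) \<le> 1" for n
    proof -
      have "(\<Sum>j\<in>{1..n}. block \<theta> j * exp (- (\<epsilon> / 2) * real j)) \<le> (\<Sum>j. block \<theta> j * exp (- (\<epsilon> / 2) * real j))"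
        by (rule sum_le_suminf[OF summable_block[OF reg]]) (use \<epsilon> in auto)
      also have "\<dots> \<le> 1"
        using False \<epsilon> by (meson half_gt_zero linorder_not_le order_less_imp_le)
      finally show ?thesis .
    qed
    from polynomial_exp_upper[OF mgf_upper_bound[OF reg(1) regular_mono[OF reg(2)] this], of "\<epsilon> / 2"] \<epsilon>
    show ?thesis by simp
  qed
  then have "(\<lambda>n. ln (mgf \<theta> n) / real n) \<longlonglongrightarrow> 0"
    using mgf_nestling_lower_bound[OF nest] by (intro exponential_rate) auto
  then have "log_mgf P \<theta> = 0"
    unfolding log_mgf_eq_lim by (rule limI)
  with pos show ?thesis by simp
qed

text \<open>Points near \<theta> keep norm at most c and rates near the positive root stay
  nonnegative, so \<open>regular\<close>, known at rate 0, holds in a whole neighbourhood.\<close>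

lemma nestling_region:
  assumes nest: "\<not> non_nestling P" and T: "condition_T P u"
    and c: "0 < c" and fin: "range_exp_moment P u c < \<infinity>" and \<theta>: "norm \<theta> < c" "0 < log_mgf P \<theta>"
  shows "real_analytic_at (log_mgf P) \<theta> \<and> positive_definite (hessian (log_mgf P) \<theta>)"
proof -
  have reg: regenerates by (rule regenerates_range_moment[OF c fin T])
  have regular: "regular \<theta>' 0" if "norm \<theta>' \<le> c" for \<theta>'
    by (rule regular_range_moment[OF that fin])
  obtain r\<^sub>0 where r\<^sub>0: "0 < r\<^sub>0" "(\<lambda>j. block \<theta> j * exp (- r\<^sub>0 * real j)) sums 1"
    using nestling_root[OF reg regular nest \<theta>(2)] \<theta>(1) by auto
  obtain \<sigma> where \<sigma>: "0 < \<sigma>" "\<And>y. y \<in> cube \<sigma> \<Longrightarrow> \<sigma> \<le> r\<^sub>0 \<and> norm (y :: real ^ 'd) + \<sigma> \<le> c - norm \<theta>"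
    using exists_small_cube[of "c - norm \<theta>" r\<^sub>0] \<theta> r\<^sub>0 by fastforce
  show ?thesis
  proof (rule log_mgf_analytic_at[OF reg regular r\<^sub>0 \<sigma>(1)])
    fix y :: "real ^ 'd" and r :: real assume y: "y \<in> cube \<sigma>" and r: "\<bar>r\<bar> \<le> \<sigma>"
    have "norm (\<theta> + y) \<le> c" "0 \<le> r\<^sub>0 + r"
      using \<sigma>(2)[OF y] \<sigma>(1) r norm_triangle_ineq[of \<theta> y] by linarith+
    then show "regular (\<theta> + y) (r\<^sub>0 + r)"
      by (rule regular_mono[OF regular])
  qed (use \<theta> in simp)
qed

end

theorem lemma6:
  fixes P :: "'d::finite environment measure" and u :: "real ^ 'd" and c\<^sub>1 c\<^sub>2 :: real
  assumes "random_environment P"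
    and "nearest_neighbor P"
    and "uniformly_elliptic P"
    and "iid_environment P"
    and "\<exists>v. norm v = 1 \<and> condition_T P v"
    and "norm u = 1"
    and "non_nestling P \<Longrightarrow>
           non_nestling_along P u \<and> 0 < c\<^sub>2 \<and> time_exp_moment P u c\<^sub>2 < \<infinity>"
    and "\<not> non_nestling P \<Longrightarrow>
           condition_T P u \<and> 0 < c\<^sub>1 \<and> range_exp_moment P u c\<^sub>1 < \<infinity>"
  shows "real_analytic_on (log_mgf P) (regular_region P c\<^sub>1 c\<^sub>2) \<and>
         (\<forall>\<theta>\<in>regular_region P c\<^sub>1 c\<^sub>2. positive_definite (hessian (log_mgf P) \<theta>))"
proof -
  interpret iid_walk P u
    using assms(1-4,6) by unfold_locales
  have "real_analytic_at (log_mgf P) \<theta> \<and> positive_definite (hessian (log_mgf P) \<theta>)"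
    if "\<theta> \<in> regular_region P c\<^sub>1 c\<^sub>2" for \<theta>
  proof (cases "non_nestling P")
    case True
    then show ?thesis
      using assms(7)[OF True] that non_nestling_region[of c\<^sub>2 \<theta>] by (auto simp: regular_region_def)
  next
    case False
    then show ?thesis
      using assms(8)[OF False] that nestling_region[of c\<^sub>1 \<theta>] by (auto simp: regular_region_def)
  qed
  then show ?thesis
    by (simp add: real_analytic_on_def)
qed

end
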